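(* Consider the residual network, empirical square loss $\mathcal{L}$ and gradient descent (GD) described in the context. (a) Suppose the real-analyticity condition and the nonlinear architecture condition (defined in the context) hold. Then, for every $\tau>0$, there exist scale factors $c_0,\dots,c_{L-1}\in\mathbb{R}$ with $|c_\ell-1|<\tau$ such that, after replacing $\varphi_\ell$ by $c_\ell\varphi_\ell$ for $\ell=0,\dots,L-1$: for every fixed $\theta$ except for a measure-zero set in $\mathbb{R}^{\dim\theta}$, one has $$\mu_{\mathrm{low},\theta,X}>0$$ for all inputs $X=(x_1,\dots,x_N)\in\Omega^N$ except for a measure-zero set in $\mathbb{R}^{Nd}$. (b) Suppose moreover that the data condition and the polynomial regularity condition hold. Then for every $\tau>0$ there exist scale factors as in (a) such that, for the rescaled network, the following holds with probability $1$ over the joint distribution $\pi$ of $X$. There is a finite set $E$ of exceptional learning rates and, for each $\eta\in(0,1]\setminus E$, a measure-zero set $\mathcal{B}_\theta\subset\mathbb{R}^{\dim\theta}$ such that for every $\theta^0\notin\mathcal{B}_\theta$: if $\mathcal{L}$ satisfies the $(\theta^0,\theta^*,R,\rho,\epsilon_{\mathcal{L}})$-dissipative condition for a stationary point $\theta^*$, with $0<\delta<2$, $\rho\in\mathbb{R}$, $\epsilon_{\mathcal{L}}\ge0$, $R=\sqrt{\|\theta^0-\theta^*\|^2+\max\{\frac{4\rho+2}{\delta},0\}\mathcal{L}(\theta^0)}$, and $0<\eta\le\min\{(2-\delta)/\mathsf{L},1\}$ with $\mathsf{L}=S(\cdots,\|\theta_i^*\|+R+\max_{\theta\in B_{\theta^*}(R)}\|\nabla_{\theta_i}\mathcal{L}(\theta)\|,\cdots)$,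 then for every GD iterate $\theta^s$, $s\ge0$, $$\mu_{\mathrm{low},s,X}>0.$$ In particular, $$\|\nabla_\theta\mathcal{L}(\theta^s;X)\|^2\ge\frac{2\mu_{\mathrm{low},s,X}}{N}\mathcal{L}(\theta^s;X).$$
   Context: Norms: $\|\cdot\|$ is the $\ell^2$ norm of vectors and matrices; $B_w(r)$ is the open ball of radius $r$ centered at $w$. Network. Fix integers $N,d,L\ge1$. For $\ell=0,\dots,L$, $\varphi_\ell(\theta_\ell;u)\in\mathbb{R}^d$ is a layer map of a parameter $\theta_\ell$ and $u\in\mathbb{R}^d$; $\theta=(\theta_0,\dots,\theta_L)$, also regarded as a vector in $\mathbb{R}^{\dim\theta}$. For an input $x_i\in\mathbb{R}^d$: $u_{0,i}=x_i$; $u_{\ell+1,i}=u_{\ell,i}+\varphi_\ell(\theta_\ell;u_{\ell,i})$ for $\ell=0,\dots,L-1$; $f(\theta;x_i)=\varphi_L(\theta_L;u_{L,i})$. Let $\tilde f_\ell(\theta;u)$ be the output obtained by starting from hidden state $u$ at layer $\ell$ and composing the remaining layers, so $\tilde f_\ell(\theta;u_{\ell,i})=f(\theta;x_i)$. Loss and GD. $\mathcal{L}(\theta)=\mathcal{L}(\theta;X)=\frac1N\sum_{i=1}^N\frac12\|y_i-f(\theta;x_i)\|^2$; GD is $\theta^{k+1}=\theta^k-\eta\nabla_\theta\mathcal{L}(\theta^k)$. Frame bound. Let $J_X(\theta)\in\mathbb{R}^{Nd\times\dim\theta}$ be the vertical stack of $\nabla_\theta f(\theta;x_1),\dots,\nabla_\theta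 f(\theta;x_N)$. Then $\mu_{\mathrm{low},\theta,X}=\lambda_{\min}(J_X(\theta)J_X(\theta)^\top)$ and $\mu_{\mathrm{low},s,X}=\mu_{\mathrm{low},\theta^s,X}$. Polynomial notions. Let $\psi:\Omega'\subseteq\mathbb{R}^n\to\mathbb{R}^m$ with the variable $w$ split into blocks $w_1,\dots,w_{n_w}$ (matrices or vectors); $S$ denotes a polynomial all of whose coefficients are positive. $\psi$ is polynomially bounded if $\|\psi(w)\|\le S(\|w_1\|,\dots,\|w_{n_w}\|)$ for all $w$. $\psi$ satisfies polynomial generalized continuity if $\|\psi(w)-\psi(w')\|\le S(\|w_{\max,1}\|,\dots,\|w_{\max,n_w}\|)\|w-w'\|$ for all $w,w'$, where $\|w_{\max,i}\|=\max\{\|w_i\|,\|w_i'\|\}$. A $C^1$ map $\psi$ satisfies polynomial generalized smoothness if $\nabla\psi$ satisfies polynomial generalized continuity. (Each notion is with some such $S$.) Data condition. $(x_1,\dots,x_N)\sim\pi(z_1,\dots,z_N)\,dz_1\cdots dz_N$, where $\pi\in L^\infty$ is supported on $\Omega\times\cdots\times\Omega\subseteq\mathbb{R}^{Nd}$ with $\Omega\subseteq\mathbb{R}^d$ open and $|\Omega|<\infty$, and the law is absolutely continuous with respect to Lebesgue measure on $\mathbb{R}^{Nd}$; $y_1,\dots,y_N\in\mathbb{R}^d$ are arbitrary. Real-analyticity condition. $\varphi_\ell(\theta;u)$ is real-analytic for all $\theta,u$ for $\ell=1,\dots,L$, and $\varphi_0(\theta;u)$ is real-analytic for all $\theta$ and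 all $u$ in some bounded open neighborhood of $\bar\Omega$. Polynomial regularity condition. For all $\ell=0,\dots,L$, $\varphi_\ell(\theta;u)$ satisfies polynomial generalized continuity and smoothness in both $\theta$ and $u$, and $\varphi_\ell,\nabla_\theta\varphi_\ell,\nabla_u\varphi_\ell$ are polynomially bounded. Consequently $\|\nabla\mathcal{L}(\theta)-\nabla\mathcal{L}(\theta')\|\le S(\|\theta_{\max,1}\|,\dots,\|\theta_{\max,n_\theta}\|)\|\theta-\theta'\|$ for a polynomial $S$ with positive coefficients, where $\theta_1,\dots,\theta_{n_\theta}$ are the blocks of $\theta$; this is the $S$ used in $\mathsf L$. Nonlinear architecture condition. There is $\bar\ell\in\{0,\dots,L-1\}$ such that $\dim\theta_{\bar\ell}>Nd$ and, for all $\theta_{\bar\ell},\dots,\theta_L$ except for a measure-zero set, there exists a tuple $(u_1,\dots,u_N)$ for which the matrix obtained by stacking $\nabla_{\theta_{\bar\ell}}\tilde f_{\bar\ell}(\theta;u_1),\dots,\nabla_{\theta_{\bar\ell}}\tilde f_{\bar\ell}(\theta;u_N)$ vertically has full row rank $Nd$. Dissipative condition. A $C^1$ function $\psi$ satisfies the $(w,w^*,r,\rho,\epsilon)$-dissipative condition if $w^*$ is a stationary point of $\psi$, $r>\|w-w^*\|$, and for all $\tilde w\in B_{w^*}(r)\setminus\{v:\|\nabla\psi(v)\|\le\epsilon\}$, $\nabla\psi(\tilde w)^\top(\tilde w-w^* )\ge-\rho\|\nabla\psi(\tilde w)\|^2$, where $\rho\in\mathbb{R}$ does not depend on $\tilde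 w$.
   Formalization: If the layer in the nonlinear architecture condition is layer 0, the full-rank tuple is required in every product of connected components of the neighborhood of Ω̄ where φ_0 is analytic; a tuple elsewhere does not suffice, as φ_0 may be degenerate on Ω but not far away. *)

theory Defs
  imports "HOL-Probability.Probability"
begin

section \<open>Real analyticity\<close>

text \<open>Multi-indices are functions \<open>'m \<Rightarrow> nat\<close>. The notion is meant for open \<open>D\<close>: the ball of
  convergence can then be shrunk so that it lies inside \<open>D\<close>.\<close>

definition real_analytic_on :: "(real^'m \<Rightarrow> real^'r) \<Rightarrow> (real^'m) set \<Rightarrow> bool" where
  "real_analytic_on f D \<longleftrightarrow>
     (\<forall>x\<in>D. \<exists>r>0. \<exists>a :: ('m \<Rightarrow> nat) \<Rightarrow> real^'r. \<forall>z\<in>ball x r.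
        ((\<lambda>\<alpha>. (\<Prod>j\<in>UNIV. (z $ j - x $ j) ^ \<alpha> j) *\<^sub>R a \<alpha>) has_sum f z) UNIV)"

section \<open>Coordinate blocks\<close>

text \<open>A map \<open>\<beta>\<close> on the coordinates splits \<open>v\<close> into the blocks \<open>block \<beta> b v\<close>, each one padded with
  zeros to the full dimension. The same function is used for the layers of the parameter
  (\<open>\<theta>\<^sub>l\<close> is \<open>block lay l \<theta>\<close>) and for the finer blocks (weight matrices, bias vectors) on which
  the polynomial bounds depend. The norm of a block is the entrywise l2 norm, which for
  matrices is also the norm of the type \<open>real^'n^'m\<close>.\<close>

definition block :: "('m \<Rightarrow> 'b) \<Rightarrow> 'b \<Rightarrow> real^'m \<Rightarrow> real^'m" where
  "block \<beta> b v = (\<chi> j. if \<beta> j = b then v $ j else 0)"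

section \<open>Residual network\<close>

text \<open>All scalar parameters are indexed by \<open>'p\<close>, and \<open>lay j\<close> is the layer to which parameter \<open>j\<close>
  belongs. The layer map \<open>\<phi> l\<close> is only ever applied to zero-padded vectors \<open>\<theta>\<^sub>l\<close>.
  \<open>propagate lay \<phi> \<theta> l u k\<close> is the hidden state at layer \<open>l + k\<close> when the state at layer \<open>l\<close> is \<open>u\<close>.\<close>

type_synonym ('p, 'd) layer_maps = "nat \<Rightarrow> real^'p \<Rightarrow> real^'d \<Rightarrow> real^'d"

primrec propagate ::
  "('p \<Rightarrow> nat) \<Rightarrow> ('p::finite, 'd::finite) layer_maps \<Rightarrow> real^'p \<Rightarrow> nat \<Rightarrow> real^'d \<Rightarrow> nat \<Rightarrow> real^'d" where
  "propagate lay \<phi> \<theta> l u 0 = u"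
| "propagate lay \<phi> \<theta> l u (Suc k) =
     propagate lay \<phi> \<theta> l u k + \<phi> (l + k) (block lay (l + k) \<theta>) (propagate lay \<phi> \<theta> l u k)"

definition net_from ::
  "nat \<Rightarrow> ('p \<Rightarrow> nat) \<Rightarrow> ('p::finite, 'd::finite) layer_maps \<Rightarrow> nat \<Rightarrow> real^'p \<Rightarrow> real^'d \<Rightarrow> real^'d" where
  "net_from L lay \<phi> l \<theta> u = \<phi> L (block lay L \<theta>) (propagate lay \<phi> \<theta> l u (L - l))"

definition net :: "nat \<Rightarrow> ('p \<Rightarrow> nat) \<Rightarrow> ('p::finite, 'd::finite) layer_maps \<Rightarrow> real^'p \<Rightarrow> real^'d \<Rightarrow> real^'d" where
  "net L lay \<phi> \<theta> x = net_from L lay \<phi> 0 \<theta> x"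

definition rescale :: "nat \<Rightarrow> (nat \<Rightarrow> real) \<Rightarrow> ('p::finite, 'd::finite) layer_maps \<Rightarrow> ('p, 'd) layer_maps" where
  "rescale L c \<phi> = (\<lambda>l t u. if l < L then c l *\<^sub>R \<phi> l t u else \<phi> l t u)"

section \<open>Loss, gradient descent and frame bound\<close>

definition loss :: "nat \<Rightarrow> ('p \<Rightarrow> nat) \<Rightarrow> ('p::finite, 'd::finite) layer_maps \<Rightarrow> (real^'d)^'n \<Rightarrow> (real^'d)^'n \<Rightarrow>
    real^'p \<Rightarrow> real" where
  "loss L lay \<phi> y X \<theta> =
     1 / real CARD('n) * (\<Sum>i\<in>UNIV. 1/2 * (norm (y $ i - net L lay \<phi> \<theta> (X $ i)))\<^sup>2)"

definition gradient :: "(real^'p \<Rightarrow> real) \<Rightarrow> real^'p \<Rightarrow> real^'p" where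
  "gradient f x = (THE D. GDERIV f x :> D)"

definition gd_iterate :: "real \<Rightarrow> (real^'p \<Rightarrow> real) \<Rightarrow> real^'p \<Rightarrow> nat \<Rightarrow> real^'p" where
  "gd_iterate \<eta> F \<theta>0 s = ((\<lambda>\<theta>. \<theta> - \<eta> *\<^sub>R gradient F \<theta>) ^^ s) \<theta>0"

definition vstack :: "('n \<Rightarrow> real^'p^'d) \<Rightarrow> real^'p^('n::finite \<times> 'd::finite)" where
  "vstack A = (\<chi> r. A (fst r) $ snd r)"

definition net_jacobian ::
  "nat \<Rightarrow> ('p \<Rightarrow> nat) \<Rightarrow> ('p::finite, 'd::finite) layer_maps \<Rightarrow> (real^'d)^'n \<Rightarrow> real^'p \<Rightarrow> real^'p^('n::finite \<times> 'd::finite)" where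
  "net_jacobian L lay \<phi> X \<theta> = vstack (\<lambda>i. jacobian (\<lambda>t. net L lay \<phi> t (X $ i)) (at \<theta>))"

definition lambda_min :: "real^'m^'m \<Rightarrow> real" where
  "lambda_min A = Min {l. \<exists>v. v \<noteq> 0 \<and> A *v v = l *\<^sub>R v}"

definition mu_low ::
  "nat \<Rightarrow> ('p \<Rightarrow> nat) \<Rightarrow> ('p::finite, 'd::finite) layer_maps \<Rightarrow> (real^'d)^'n \<Rightarrow> real^'p \<Rightarrow> real" where
  "mu_low L lay \<phi> X \<theta> =
     lambda_min (net_jacobian L lay \<phi> X \<theta> ** transpose (net_jacobian L lay \<phi> X \<theta>))"

section \<open>Polynomial regularity of maps\<close>

text \<open>Polynomials that have at least one monomial and only positive coefficients.\<close>

definition positive_polynomial :: "(real^'k \<Rightarrow> real) \<Rightarrow> bool" where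
  "positive_polynomial S \<longleftrightarrow>
     (\<exists>M :: ('k \<Rightarrow> nat) set. \<exists>a. finite M \<and> M \<noteq> {} \<and> (\<forall>\<alpha>\<in>M. a \<alpha> > 0) \<and>
        S = (\<lambda>x. \<Sum>\<alpha>\<in>M. a \<alpha> * (\<Prod>i\<in>UNIV. (x $ i) ^ \<alpha> i)))"

definition poly_bounded ::
  "('m \<Rightarrow> 'k::finite) \<Rightarrow> (real^'m) set \<Rightarrow> (real^'m \<Rightarrow> 'c::real_normed_vector) \<Rightarrow> bool" where
  "poly_bounded \<beta> D \<psi> \<longleftrightarrow>
     (\<exists>S. positive_polynomial S \<and> (\<forall>w\<in>D. norm (\<psi> w) \<le> S (\<chi> i. norm (block \<beta> i w))))"

definition gen_continuous_with ::
  "(real^'k \<Rightarrow> real) \<Rightarrow> ('m \<Rightarrow> 'k::finite) \<Rightarrow> (real^'m) set \<Rightarrow>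
     (real^'m \<Rightarrow> 'c::real_normed_vector) \<Rightarrow> bool" where
  "gen_continuous_with S \<beta> D \<psi> \<longleftrightarrow>
     (\<forall>w\<in>D. \<forall>w'\<in>D. norm (\<psi> w - \<psi> w') \<le>
        S (\<chi> i. max (norm (block \<beta> i w)) (norm (block \<beta> i w'))) * norm (w - w'))"

definition poly_gen_continuous ::
  "('m \<Rightarrow> 'k::finite) \<Rightarrow> (real^'m) set \<Rightarrow> (real^'m \<Rightarrow> 'c::real_normed_vector) \<Rightarrow> bool" where
  "poly_gen_continuous \<beta> D \<psi> \<longleftrightarrow> (\<exists>S. positive_polynomial S \<and> gen_continuous_with S \<beta> D \<psi>)"

definition poly_gen_smooth ::
  "('m \<Rightarrow> 'k::finite) \<Rightarrow> (real^'m) set \<Rightarrow> (real^'m \<Rightarrow> real^'r) \<Rightarrow> bool" where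
  "poly_gen_smooth \<beta> D \<psi> \<longleftrightarrow>
     (\<forall>w\<in>D. \<psi> differentiable (at w)) \<and> continuous_on D (\<lambda>w. jacobian \<psi> (at w)) \<and>
     poly_gen_continuous \<beta> D (\<lambda>w. jacobian \<psi> (at w))"

section \<open>Conditions on the layers\<close>

text \<open>\<open>U\<close> is the bounded open neighbourhood of the closure of \<open>\<Omega>\<close> on which \<open>\<phi> 0\<close> is assumed to be
  analytic; the hidden states fed into layer \<open>l\<close> range over \<open>state_dom U l\<close>.\<close>

definition state_dom :: "(real^'d) set \<Rightarrow> nat \<Rightarrow> (real^'d) set" where
  "state_dom U l = (if l = 0 then U else UNIV)"

text \<open>A pair \<open>(\<theta>, u)\<close> is encoded as one vector indexed by \<open>'p + 'd\<close>.\<close>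

definition par :: "real^('p::finite + 'd::finite) \<Rightarrow> real^'p" where
  "par w = (\<chi> j. w $ Inl j)"

definition hid :: "real^('p::finite + 'd::finite) \<Rightarrow> real^'d" where
  "hid w = (\<chi> k. w $ Inr k)"

definition layer_fun :: "('p \<Rightarrow> nat) \<Rightarrow> ('p::finite, 'd::finite) layer_maps \<Rightarrow> nat \<Rightarrow> real^('p::finite + 'd::finite) \<Rightarrow> real^'d" where
  "layer_fun lay \<phi> l w = \<phi> l (block lay l (par w)) (hid w)"

definition real_analyticity ::
  "nat \<Rightarrow> ('p \<Rightarrow> nat) \<Rightarrow> ('p::finite, 'd::finite) layer_maps \<Rightarrow> (real^'d) set \<Rightarrow> bool" where
  "real_analyticity L lay \<phi> U \<longleftrightarrow>
     (\<forall>l\<le>L. real_analytic_on (layer_fun lay \<phi> l) {w. hid w \<in> state_dom U l})"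

text \<open>The pairs \<open>(\<theta>\<^sub>l, u)\<close>, with \<open>\<theta>\<^sub>l\<close> padded by zeros, and their blocks: those of the parameter,
  and \<open>u\<close> as a single further block \<open>None\<close>.\<close>

definition layer_dom ::
  "('p \<Rightarrow> nat) \<Rightarrow> (real^'d) set \<Rightarrow> nat \<Rightarrow> (real^('p::finite + 'd::finite)) set" where
  "layer_dom lay U l = {w. block lay l (par w) = par w \<and> hid w \<in> state_dom U l}"

definition layer_blk :: "('p \<Rightarrow> 'k) \<Rightarrow> 'p + 'd \<Rightarrow> 'k option" where
  "layer_blk blk = case_sum (\<lambda>j. Some (blk j)) (\<lambda>_. None)"

definition poly_regularity ::
  "nat \<Rightarrow> ('p \<Rightarrow> nat) \<Rightarrow> ('p \<Rightarrow> 'k::finite) \<Rightarrow> ('p::finite, 'd::finite) layer_maps \<Rightarrow> (real^'d) set \<Rightarrow> bool" where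
  "poly_regularity L lay blk \<phi> U \<longleftrightarrow>
     (\<forall>l\<le>L.
        poly_gen_continuous (layer_blk blk) (layer_dom lay U l) (layer_fun lay \<phi> l) \<and>
        poly_gen_smooth (layer_blk blk) (layer_dom lay U l) (layer_fun lay \<phi> l) \<and>
        poly_bounded (layer_blk blk) (layer_dom lay U l) (layer_fun lay \<phi> l) \<and>
        poly_bounded (layer_blk blk) (layer_dom lay U l)
          (\<lambda>w. jacobian (\<lambda>t. \<phi> l (block lay l t) (hid w)) (at (par w))) \<and>
        poly_bounded (layer_blk blk) (layer_dom lay U l)
          (\<lambda>w. jacobian (\<lambda>u. \<phi> l (block lay l (par w)) u) (at (hid w))))"

text \<open>The derivative with respect to \<open>\<theta>\<^sub>l\<close> alone: the columns that belong to other layers vanish,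
  which does not affect the rank.\<close>

definition tail_jacobian ::
  "nat \<Rightarrow> ('p \<Rightarrow> nat) \<Rightarrow> ('p::finite, 'd::finite) layer_maps \<Rightarrow> nat \<Rightarrow> real^'p \<Rightarrow> (real^'d)^'n \<Rightarrow>
     real^'p^('n::finite \<times> 'd::finite)" where
  "tail_jacobian L lay \<phi> l \<theta> u =
     vstack (\<lambda>i. jacobian
       (\<lambda>t. net_from L lay \<phi> l (\<chi> j. if lay j = l then t $ j else \<theta> $ j) (u $ i)) (at \<theta>))"

text \<open>The null set lives in the space of \<open>\<theta>\<^sub>l, \<dots>, \<theta>\<^sub>L\<close> (the product measure below); the parameters of
  earlier layers are irrelevant and set to 0.
  The tuple \<open>u\<close> is required in every product of connected components of the set of admissible
  states. For \<open>l \<ge> 1\<close> that set is the whole space, and for \<open>l = 0\<close> with connected \<open>U\<close> it is \<open>U\<close>,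
  so that the requirement is just the existence of one tuple. Analyticity of \<open>\<phi> 0\<close> on \<open>U\<close> does not
  relate its behaviour on different components of \<open>U\<close>, nor that outside \<open>U\<close> to that in \<open>U\<close>.\<close>

definition nonlinear_architecture ::
  "'n::finite itself \<Rightarrow> nat \<Rightarrow> ('p::finite \<Rightarrow> nat) \<Rightarrow> ('p::finite, 'd::finite) layer_maps \<Rightarrow> (real^'d) set \<Rightarrow> bool" where
  "nonlinear_architecture (_ :: 'n itself) L lay \<phi> U \<longleftrightarrow>
     (\<exists>l<L. card {j. lay j = l} > CARD('n) * CARD('d) \<and>
        (AE \<omega> in (\<Pi>\<^sub>M j\<in>{j. l \<le> lay j}. lborel).
           \<forall>C :: 'n \<Rightarrow> (real^'d) set. (\<forall>i. C i \<in> components (state_dom U l)) \<longrightarrow>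
             (\<exists>u :: (real^'d)^'n. (\<forall>i. u $ i \<in> C i) \<and>
                rank (tail_jacobian L lay \<phi> l (\<chi> j. if l \<le> lay j then \<omega> j else 0) u)
                  = CARD('n) * CARD('d))))"

section \<open>Data and dissipativity\<close>

definition data_condition :: "(real^'d) set \<Rightarrow> ((real^'d)^'n \<Rightarrow> real) \<Rightarrow> bool" where
  "data_condition \<Omega> \<pi> \<longleftrightarrow>
     open \<Omega> \<and> emeasure lebesgue \<Omega> < \<infinity> \<and>
     \<pi> \<in> borel_measurable borel \<and>
     (\<exists>K. AE X in lborel. 0 \<le> \<pi> X \<and> \<pi> X \<le> K) \<and>
     (AE X in lborel. (\<exists>i. X $ i \<notin> \<Omega>) \<longrightarrow> \<pi> X = 0) \<and>
     prob_space (density lborel (\<lambda>X. ennreal (\<pi> X)))"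

definition dissipative ::
  "(real^'p \<Rightarrow> real) \<Rightarrow> real^'p \<Rightarrow> real^'p \<Rightarrow> real \<Rightarrow> real \<Rightarrow> real \<Rightarrow> bool" where
  "dissipative \<psi> w ws r \<rho> \<epsilon> \<longleftrightarrow>
     (\<forall>v. \<psi> differentiable (at v)) \<and> continuous_on UNIV (gradient \<psi>) \<and>
     gradient \<psi> ws = 0 \<and> r > norm (w - ws) \<and>
     (\<forall>v \<in> ball ws r - {v. norm (gradient \<psi> v) \<le> \<epsilon>}.
        gradient \<psi> v \<bullet> (v - ws) \<ge> - \<rho> * (norm (gradient \<psi> v))\<^sup>2)"

text \<open>The radius \<open>R\<close> and the constant that bounds the learning rate. The maximum over the open
  ball is rendered as a supremum; it is the maximum over the closed ball when the
  gradient is continuous.\<close>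

definition radius :: "(real^'p \<Rightarrow> real) \<Rightarrow> real^'p \<Rightarrow> real^'p \<Rightarrow> real \<Rightarrow> real \<Rightarrow> real" where
  "radius F \<theta>0 \<theta>s \<delta> \<rho> = sqrt ((norm (\<theta>0 - \<theta>s))\<^sup>2 + max ((4 * \<rho> + 2) / \<delta>) 0 * F \<theta>0)"

definition lip_const ::
  "(real^'k \<Rightarrow> real) \<Rightarrow> ('p \<Rightarrow> 'k::finite) \<Rightarrow> (real^'p \<Rightarrow> real) \<Rightarrow> real^'p \<Rightarrow> real \<Rightarrow> real" where
  "lip_const S blk F \<theta>s R =
     S (\<chi> k. norm (block blk k \<theta>s) + R + (SUP \<theta>\<in>ball \<theta>s R. norm (block blk k (gradient F \<theta>))))"

end

theory Submission
  imports Defs "HOL-Complex_Analysis.Conformal_Mappings"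
begin

text \<open> Choose the layer \<open>l\<close> of the nonlinear architecture condition and rescale only the layers
  below it, all by the same factor \<open>s\<close>. The Gram determinant \<open>H (s, \<theta>, X)\<close> of the derivative
  with respect to \<open>\<theta>\<^sub>l\<close> is real-analytic in \<open>(s, \<theta>, X)\<close> jointly. For \<open>s = 0\<close> the layers below
  \<open>l\<close> act as the identity, so \<open>H (0, \<theta>, X) \<noteq> 0\<close> for some \<open>\<theta>\<close> and some \<open>X\<close> in every product of
  components of \<open>U\<close>. Hence for all but countably many \<open>s\<close> the function \<open>H (s, -, -)\<close> vanishes
  identically on none of these products, its zero set is null, and Fubini gives the
  almost-everywhere statements in both orders.

  For gradient descent, \<open>\<eta> \<mapsto> det (I - \<eta> Hess)\<close> at one point has finitely many zeros in \<open>[0, 1]\<close>.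
  For every other \<open>\<eta>\<close> the analytic function \<open>\<theta> \<mapsto> det (I - \<eta> Hess)\<close> is nonzero almost
  everywhere, so by the inverse function theorem preimages of null sets under a gradient step
  are null. The bad initial values are the preimages under all iterates of the null set where
  \<open>\<mu> > 0\<close> fails.

  Real-analytic functions of several variables are handled through one complex variable: a
  function is called arc-analytic if it maps analytic curves to analytic curves. This notion is
  obviously stable under composition, and together with \<open>n\<close>-fold differentiability it is strong
  enough for everything needed here. \<close>

section \<open>Analyticity along arcs\<close>

text \<open>Real analyticity in one variable is encoded by a holomorphic extension to a complex disc
  instead of a power series. Sums, products, substitution and the identity theorem are then
  inherited from complex analysis.\<close>

definition ranalytic_at :: "(real \<Rightarrow> real) \<Rightarrow> real \<Rightarrow> bool" where
  "ranalytic_at g t \<longleftrightarrow> (\<exists>e>0. \<exists>G. G holomorphic_on ball (complex_of_real t) e \<and>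
     (\<forall>s. \<bar>s - t\<bar> < e \<longrightarrow> G (complex_of_real s) = complex_of_real (g s)))"

text \<open>Extensions can only be combined on one disc; for finitely many functions the smallest
  radius serves.\<close>

lemma ranalytic_at_common:
  assumes "finite I" "\<And>i. i \<in> I \<Longrightarrow> ranalytic_at (g i) t"
  obtains e G where "e > 0" "\<And>i. i \<in> I \<Longrightarrow> G i holomorphic_on ball (complex_of_real t) e"
    "\<And>i s. i \<in> I \<Longrightarrow> \<bar>s - t\<bar> < e \<Longrightarrow> G i (complex_of_real s) = complex_of_real (g i s)"
proof -
  have "\<exists>e>0. \<exists>G. \<forall>i\<in>I. G i holomorphic_on ball (complex_of_real t) e \<and>
     (\<forall>s. \<bar>s - t\<bar> < e \<longrightarrow> G i (complex_of_real s) = complex_of_real (g i s))"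
    using assms
  proof (induction I rule: finite_induct)
    case empty
    show ?case by (auto intro: exI[of _ 1])
  next
    case (insert i I)
    obtain e G where e: "e > 0" "\<forall>i\<in>I. G i holomorphic_on ball (complex_of_real t) e \<and>
       (\<forall>s. \<bar>s - t\<bar> < e \<longrightarrow> G i (complex_of_real s) = complex_of_real (g i s))"
      using insert by auto
    obtain e' G' where e': "e' > 0" "G' holomorphic_on ball (complex_of_real t) e'"
       "\<forall>s. \<bar>s - t\<bar> < e' \<longrightarrow> G' (complex_of_real s) = complex_of_real (g i s)"
      using insert.prems[of i] unfolding ranalytic_at_def by auto
    have sub: "ball (complex_of_real t) (min e e') \<subseteq> ball (complex_of_real t) e"
      "ball (complex_of_real t) (min e e') \<subseteq> ball (complex_of_real t) e'" by auto
    show ?case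
      using e e' insert.hyps sub
      by (intro exI[of _ "min e e'"] conjI exI[of _ "G(i := G')"])
        (auto intro: holomorphic_on_subset)
  qed
  then show thesis using that by blast
qed

lemma ranalytic_at_const [simp]: "ranalytic_at (\<lambda>_. c) t"
  unfolding ranalytic_at_def
  by (intro exI[of _ 1] conjI exI[of _ "\<lambda>_. complex_of_real c"]) auto

lemma ranalytic_at_ident: "ranalytic_at (\<lambda>s. s) t"
  unfolding ranalytic_at_def
  by (intro exI[of _ 1] conjI exI[of _ "\<lambda>z. z"]) auto

text \<open>One argument for sums and products: \<open>h'\<close> is the complex counterpart of the
  real operation \<open>h\<close>, and applying it to extensions on a common disc gives an
  extension.\<close>

lemma ranalytic_at_binop:
  assumes "ranalytic_at f t" "ranalytic_at g t"
    and "\<And>F G S. F holomorphic_on S \<Longrightarrow> G holomorphic_on S \<Longrightarrow> (\<lambda>z. h' (F z) (G z)) holomorphic_on S"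
    and "\<And>a b. h' (complex_of_real a) (complex_of_real b) = complex_of_real (h a b)"
  shows "ranalytic_at (\<lambda>s. h (f s) (g s)) t"
proof -
  obtain e G where e: "e > 0" "\<And>i. i \<in> UNIV \<Longrightarrow> G i holomorphic_on ball (complex_of_real t) e"
    "\<And>i s. i \<in> UNIV \<Longrightarrow> \<bar>s - t\<bar> < e \<Longrightarrow> G i (complex_of_real s) = complex_of_real ((if i then f else g) s)"
    by (rule ranalytic_at_common[of "UNIV::bool set" "\<lambda>i. if i then f else g" t]) (use assms in auto)
  show ?thesis
    unfolding ranalytic_at_def
    using e(1) e(2)[of True] e(2)[of False] e(3)[of True] e(3)[of False] assms(3,4)
    by (intro exI[of _ e] conjI exI[of _ "\<lambda>z. h' (G True z) (G False z)"]) auto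
qed

lemma ranalytic_at_add: "ranalytic_at f t \<Longrightarrow> ranalytic_at g t \<Longrightarrow> ranalytic_at (\<lambda>s. f s + g s) t"
  by (rule ranalytic_at_binop[where h'="(+)"]) (auto intro: holomorphic_intros)

lemma ranalytic_at_mult: "ranalytic_at f t \<Longrightarrow> ranalytic_at g t \<Longrightarrow> ranalytic_at (\<lambda>s. f s * g s) t"
  by (rule ranalytic_at_binop[where h'="(*)"]) (auto intro: holomorphic_intros)

lemma ranalytic_at_sum: "(\<And>i. i \<in> I \<Longrightarrow> ranalytic_at (f i) t) \<Longrightarrow> ranalytic_at (\<lambda>s. \<Sum>i\<in>I. f i s) t"
  by (induction I rule: infinite_finite_induct) (auto intro: ranalytic_at_add)

lemma ranalytic_at_isCont: 
  assumes "ranalytic_at g t" shows "isCont g t"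
proof -
  obtain e G where e: "e > 0" "G holomorphic_on ball (complex_of_real t) e"
     "\<And>s. \<bar>s - t\<bar> < e \<Longrightarrow> G (complex_of_real s) = complex_of_real (g s)"
    using assms unfolding ranalytic_at_def by auto
  have "isCont G (complex_of_real t)"
    using e holomorphic_on_imp_continuous_on[OF e(2)] continuous_on_interior by force
  then have "isCont (\<lambda>s. Re (G (complex_of_real s))) t"
    by (intro isCont_Re isCont_o2[where g=G and f=complex_of_real]) (auto intro!: continuous_intros)
  moreover have "eventually (\<lambda>s. Re (G (complex_of_real s)) = g s) (nhds t)"
    using eventually_nhds_ball[OF e(1), of t] 
    by eventually_elim (use e(3) in \<open>auto simp: dist_real_def abs_minus_commute\<close>)
  ultimately show ?thesis using isCont_cong[of "\<lambda>s. Re (G (complex_of_real s))" g t] by blast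
qed

lemma ranalytic_at_cong:
  assumes "eventually (\<lambda>s. f s = g s) (nhds t)" "ranalytic_at f t" shows "ranalytic_at g t"
proof -
  obtain e G where e: "e > 0" "G holomorphic_on ball (complex_of_real t) e"
     "\<And>s. \<bar>s - t\<bar> < e \<Longrightarrow> G (complex_of_real s) = complex_of_real (f s)"
    using assms unfolding ranalytic_at_def by auto
  obtain d where d: "d > 0" "\<And>s. dist s t < d \<Longrightarrow> f s = g s"
    using assms(1) unfolding eventually_nhds_metric by auto
  have "G holomorphic_on ball (complex_of_real t) (min d e)"
    by (rule holomorphic_on_subset[OF e(2)]) auto
  then show ?thesis unfolding ranalytic_at_def
    using d e by (intro exI[of _ "min d e"] conjI exI[of _ G]) (auto simp: dist_real_def)
qed

section \<open>Analytic curves and maps that preserve them\<close>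

definition analytic_curve_at :: "(real \<Rightarrow> 'a::euclidean_space) \<Rightarrow> real \<Rightarrow> bool" where
  "analytic_curve_at \<gamma> t \<longleftrightarrow> (\<forall>b\<in>Basis. ranalytic_at (\<lambda>s. \<gamma> s \<bullet> b) t)"

lemma analytic_curve_at_inner: "analytic_curve_at \<gamma> t \<Longrightarrow> ranalytic_at (\<lambda>s. \<gamma> s \<bullet> v) t"
  unfolding euclidean_inner[of _ v] analytic_curve_at_def
  by (intro ranalytic_at_sum ranalytic_at_mult) auto

lemma analytic_curve_at_isCont: 
  assumes "analytic_curve_at \<gamma> t" shows "isCont \<gamma> t"
  using assms unfolding analytic_curve_at_def isCont_def
  by (subst tendsto_componentwise_iff) (use ranalytic_at_isCont isCont_def in blast)

lemma analytic_curve_at_cong: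
  assumes "eventually (\<lambda>s. f s = g s) (nhds t)" "analytic_curve_at f t" shows "analytic_curve_at g t"
  using assms unfolding analytic_curve_at_def 
  by (intro ballI ranalytic_at_cong[where f="\<lambda>s. f s \<bullet> _" and g="\<lambda>s. g s \<bullet> _"]) (auto elim: eventually_mono)

lemma analytic_curve_at_real [simp]: "analytic_curve_at (\<gamma>::real \<Rightarrow> real) t \<longleftrightarrow> ranalytic_at \<gamma> t"
  by (simp add: analytic_curve_at_def)

text \<open>Only the point \<open>\<gamma> t\<close> has to lie in \<open>D\<close>; for open
  \<open>D\<close> continuity keeps the curve in \<open>D\<close> nearby. The notion alone is weak:
  x^3/(x^2+y^2), extended by 0, is arc-analytic but not differentiable at the origin.
  Differentiability is therefore demanded separately below.\<close>

definition arc_analytic :: "('a::euclidean_space \<Rightarrow> 'b::euclidean_space) \<Rightarrow> 'a set \<Rightarrow> bool" where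
  "arc_analytic f D \<longleftrightarrow> (\<forall>\<gamma> t. analytic_curve_at \<gamma> t \<longrightarrow> \<gamma> t \<in> D \<longrightarrow> analytic_curve_at (\<lambda>s. f (\<gamma> s)) t)"

lemma arc_analytic_cong:
  assumes "open D" "\<And>x. x \<in> D \<Longrightarrow> f x = g x" "arc_analytic f D" shows "arc_analytic g D"
  unfolding arc_analytic_def
proof (intro allI impI)
  fix \<gamma> :: "real \<Rightarrow> _" and t assume g: "analytic_curve_at \<gamma> t" "\<gamma> t \<in> D"
  have "eventually (\<lambda>s. \<gamma> s \<in> D) (at t)"
    using analytic_curve_at_isCont[OF g(1)] assms(1) g(2) unfolding isCont_def by (rule topological_tendstoD)
  then have "eventually (\<lambda>s. f (\<gamma> s) = g (\<gamma> s)) (nhds t)"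
    using g(2) assms(2) unfolding eventually_nhds_conv_at by (auto elim: eventually_mono)
  then show "analytic_curve_at (\<lambda>s. g (\<gamma> s)) t"
    by (rule analytic_curve_at_cong) (use assms(3) g in \<open>auto simp: arc_analytic_def\<close>)
qed

text \<open>Derivatives enter only through their values in fixed directions \<open>v\<close>, so
  that every level of the recursion has the same type as \<open>f\<close>, and closure properties
  become inductions on \<open>n\<close> without spaces of linear maps.\<close>

primrec C_arc_analytic :: "nat \<Rightarrow> ('a::euclidean_space \<Rightarrow> 'b::euclidean_space) \<Rightarrow> 'a set \<Rightarrow> bool" where
  "C_arc_analytic 0 f D \<longleftrightarrow> arc_analytic f D"
| "C_arc_analytic (Suc n) f D \<longleftrightarrow> arc_analytic f D \<and> (\<forall>x\<in>D. f differentiable (at x)) \<and>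
     (\<forall>v. C_arc_analytic n (\<lambda>x. frechet_derivative f (at x) v) D)"

declare C_arc_analytic.simps(2) [simp del]

lemma C_arc_analytic_arc: "C_arc_analytic n f D \<Longrightarrow> arc_analytic f D"
  by (cases n) (auto simp: C_arc_analytic.simps)

lemma C_arc_analytic_Suc_D: "C_arc_analytic (Suc n) f D \<Longrightarrow> C_arc_analytic n f D"
proof (induction n arbitrary: f)
  case 0 then show ?case by (simp add: C_arc_analytic.simps)
next
  case (Suc n)
  have "C_arc_analytic n (\<lambda>x. frechet_derivative f (at x) v) D" for v
    using Suc.prems unfolding C_arc_analytic.simps(2)[of "Suc n"] by (intro Suc.IH) blast
  then show ?case using Suc.prems unfolding C_arc_analytic.simps(2) by blast
qed

lemma C_arc_analytic_Suc_derivative: "C_arc_analytic (Suc n) f D \<Longrightarrow> C_arc_analytic n (\<lambda>x. frechet_derivative f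
    (at x) v) D"
  by (simp add: C_arc_analytic.simps)

lemma C_arc_analytic_Suc_has_derivative:
  "C_arc_analytic (Suc n) f D \<Longrightarrow> x \<in> D \<Longrightarrow> (f has_derivative frechet_derivative f (at x)) (at x)"
  using frechet_derivative_works by (auto simp: C_arc_analytic.simps)

lemma C_arc_analytic_continuous_on: "C_arc_analytic (Suc n) f D \<Longrightarrow> continuous_on D f"
  by (meson C_arc_analytic_Suc_has_derivative continuous_at_imp_continuous_on has_derivative_continuous)

lemma C_arc_analytic_cong:
  assumes "open D" "\<And>x. x \<in> D \<Longrightarrow> f x = g x" "C_arc_analytic n f D" shows "C_arc_analytic n g D"
  using assms(2,3)
proof (induction n arbitrary: f g)
  case 0 then show ?case using arc_analytic_cong[OF assms(1)] by auto
next
  case (Suc n)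
  have d: "(g has_derivative frechet_derivative f (at x)) (at x)" if "x \<in> D" for x
    by (rule has_derivative_transform_within_open[OF C_arc_analytic_Suc_has_derivative[OF Suc.prems(2) that]
        assms(1) that])
      (rule Suc.prems(1))
  then have fg: "frechet_derivative g (at x) = frechet_derivative f (at x)" if "x \<in> D" for x
    using frechet_derivative_at that by fastforce
  have "C_arc_analytic n (\<lambda>x. frechet_derivative g (at x) v) D" for v
    by (rule Suc.IH[OF _ C_arc_analytic_Suc_derivative[OF Suc.prems(2), of v]]) (simp add: fg)
  then show ?case
    using d arc_analytic_cong[OF assms(1) Suc.prems(1) C_arc_analytic_arc[OF Suc.prems(2)]]
    unfolding C_arc_analytic.simps(2) differentiable_def by blast
qed

text \<open>Makes the derivative found by differentiation rules usable in place of
  \<open>frechet_derivative\<close>: the two agree on \<open>D\<close>, and for open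
  \<open>D\<close> the property depends only on the values there.\<close>

lemma C_arc_analytic_SucI:
  assumes "open D" "arc_analytic f D" "\<And>x. x \<in> D \<Longrightarrow> (f has_derivative f' x) (at x)"
    "\<And>v. C_arc_analytic n (\<lambda>x. f' x v) D"
  shows "C_arc_analytic (Suc n) f D"
proof -
  have "C_arc_analytic n (\<lambda>x. frechet_derivative f (at x) v) D" for v
    by (rule C_arc_analytic_cong[OF assms(1) _ assms(4)[of v]]) (simp add: frechet_derivative_at[OF assms(3),
        symmetric])
  then show ?thesis using assms unfolding differentiable_def C_arc_analytic.simps by blast
qed

lemma C_arc_analytic_subset: "C_arc_analytic n f D \<Longrightarrow> E \<subseteq> D \<Longrightarrow> C_arc_analytic n f E"
proof (induction n arbitrary: f)
  case 0 then show ?case by (auto simp: arc_analytic_def)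
next
  case (Suc n)
  then show ?case unfolding C_arc_analytic.simps(2) arc_analytic_def by blast
qed

section \<open>Closure under sums, products, composition and determinants\<close>

lemma C_arc_analytic_const [simp]: "C_arc_analytic n (\<lambda>_. c) D"
  by (induction n arbitrary: c) (auto simp: C_arc_analytic.simps arc_analytic_def analytic_curve_at_def)

lemma C_arc_analytic_linear:
  assumes "linear f" "open D" shows "C_arc_analytic n f D"
proof -
  have "arc_analytic f D"
    unfolding arc_analytic_def
  proof (intro allI impI)
    fix \<gamma> :: "real \<Rightarrow> _" and t assume g: "analytic_curve_at \<gamma> t" "\<gamma> t \<in> D"
    show "analytic_curve_at (\<lambda>s. f (\<gamma> s)) t"
      unfolding analytic_curve_at_def
    proof
      fix b :: 'b assume "b \<in> Basis"
      have "f (\<gamma> s) \<bullet> b = \<gamma> s \<bullet> adjoint f b" for s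
        by (simp add: adjoint_works[OF assms(1)])
      then show "ranalytic_at (\<lambda>s. f (\<gamma> s) \<bullet> b) t" using analytic_curve_at_inner[OF g(1)] by simp
    qed
  qed
  then show ?thesis
    by (cases n) (auto intro!: C_arc_analytic_SucI[where f'="\<lambda>_. f"] assms linear_imp_has_derivative)
qed

lemma C_arc_analytic_add:
  assumes "open D" "C_arc_analytic n f D" "C_arc_analytic n g D" shows "C_arc_analytic n (\<lambda>x. f x + g x) D"
  using assms(2,3)
proof (induction n arbitrary: f g)
  case 0
  then show ?case by (auto simp: arc_analytic_def analytic_curve_at_def inner_add_left intro: ranalytic_at_add)
next
  case (Suc n)
  show ?case
    by (rule C_arc_analytic_SucI[where f' = "\<lambda>x h. frechet_derivative f (at x) h + frechet_derivative g (at x)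
        h", OF assms(1)])
      (use Suc C_arc_analytic_Suc_has_derivative[OF Suc.prems(1)] C_arc_analytic_Suc_has_derivative[OF
          Suc.prems(2)]
         C_arc_analytic_arc[OF Suc.prems(1)] C_arc_analytic_arc[OF Suc.prems(2)] in
        \<open>auto intro!: has_derivative_add C_arc_analytic_Suc_derivative simp: arc_analytic_def
            analytic_curve_at_def inner_add_left intro: ranalytic_at_add\<close>)
qed

lemma C_arc_analytic_sum: "open D \<Longrightarrow> (\<And>i. i \<in> I \<Longrightarrow> C_arc_analytic n (f i) D) \<Longrightarrow> C_arc_analytic n (\<lambda>x. \<Sum>i\<in>I. f i
    x) D"
  by (induction I rule: infinite_finite_induct) (auto intro: C_arc_analytic_add)

lemma C_arc_analytic_scaleR:
  assumes "open D" "C_arc_analytic n f D" "C_arc_analytic n g D" shows "C_arc_analytic n (\<lambda>x. f x *\<^sub>R g x) D"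
  using assms(2,3)
proof (induction n arbitrary: f g)
  case 0
  then show ?case by (auto simp: arc_analytic_def analytic_curve_at_def intro: ranalytic_at_mult)
next
  case (Suc n)
  have "C_arc_analytic n (\<lambda>x. f x *\<^sub>R frechet_derivative g (at x) v + frechet_derivative f (at x) v *\<^sub>R g x)
      D" for v
    by (intro C_arc_analytic_add assms(1) Suc.IH) (use Suc.prems C_arc_analytic_Suc_D
        C_arc_analytic_Suc_derivative in blast)+
  then show ?case
    using C_arc_analytic_arc[OF Suc.prems(1)] C_arc_analytic_arc[OF Suc.prems(2)]
        C_arc_analytic_Suc_has_derivative[OF Suc.prems(1)] C_arc_analytic_Suc_has_derivative[OF Suc.prems(2)]
    by (intro C_arc_analytic_SucI[where f' = "\<lambda>x h. f x *\<^sub>R frechet_derivative g (at x) h + frechet_derivative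
        f (at x) h *\<^sub>R g x", OF assms(1)]
       has_derivative_scaleR) (auto simp: arc_analytic_def analytic_curve_at_def intro: ranalytic_at_mult)
qed

lemma C_arc_analytic_mult:
  fixes f g :: "'a::euclidean_space \<Rightarrow> real"
  shows "open D \<Longrightarrow> C_arc_analytic n f D \<Longrightarrow> C_arc_analytic n g D \<Longrightarrow> C_arc_analytic n (\<lambda>x. f x * g x) D"
  using C_arc_analytic_scaleR[of D n f g] by simp

lemma C_arc_analytic_prod:
  fixes f :: "'i \<Rightarrow> 'a::euclidean_space \<Rightarrow> real"
  shows "open D \<Longrightarrow> (\<And>i. i \<in> I \<Longrightarrow> C_arc_analytic n (f i) D) \<Longrightarrow> C_arc_analytic n (\<lambda>x. \<Prod>i\<in>I. f i x) D"
  by (induction I rule: infinite_finite_induct) (auto intro: C_arc_analytic_mult)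

lemma C_arc_analytic_linear_compose:
  assumes "open D" "linear h" "C_arc_analytic n f D" shows "C_arc_analytic n (\<lambda>x. h (f x)) D"
  using assms(3)
proof (induction n arbitrary: f)
  case 0
  then show ?case
    using C_arc_analytic_arc[OF C_arc_analytic_linear[OF assms(2) open_UNIV, of 0]] by (auto simp:
        arc_analytic_def)
next
  case (Suc n)
  have "arc_analytic (\<lambda>x. h (f x)) D"
    using C_arc_analytic_arc[OF Suc.prems] C_arc_analytic_arc[OF C_arc_analytic_linear[OF assms(2) open_UNIV,
        of 0]]
    unfolding arc_analytic_def by blast
  moreover have "((\<lambda>x. h (f x)) has_derivative (\<lambda>v. h (frechet_derivative f (at x) v))) (at x)" if "x \<in> D" for x
    using has_derivative_compose[OF C_arc_analytic_Suc_has_derivative[OF Suc.prems that]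
        linear_imp_has_derivative[OF assms(2)]] .
  moreover have "C_arc_analytic n (\<lambda>x. h (frechet_derivative f (at x) v)) D" for v
    using C_arc_analytic_Suc_derivative[OF Suc.prems] by (rule Suc.IH)
  ultimately show ?case by (rule C_arc_analytic_SucI[OF assms(1)])
qed

text \<open>In the chain rule both the base point \<open>g x\<close> and the direction
  \<open>?g x v\<close> vary with \<open>x\<close>, whereas the definition controls fixed directions
  only. Expanding the direction in the basis gives a finite sum of products of a coordinate of
  \<open>?g x v\<close> with \<open>?f (g x) b\<close>, and the induction hypothesis covers the
  latter.\<close>

lemma C_arc_analytic_compose:
  assumes "open D" "open E" "C_arc_analytic n f E" "C_arc_analytic n g D" "\<And>x. x \<in> D \<Longrightarrow> g x \<in> E"
  shows "C_arc_analytic n (\<lambda>x. f (g x)) D"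
  using assms(3,4)
proof (induction n arbitrary: f)
  case 0
  then show ?case using assms(5) by (auto simp: arc_analytic_def)
next
  case (Suc n)
  let ?g = "\<lambda>x. frechet_derivative g (at x)" and ?f = "\<lambda>y. frechet_derivative f (at y)"
  have d: "((\<lambda>x. f (g x)) has_derivative (\<lambda>v. \<Sum>b\<in>Basis. (?g x v \<bullet> b) *\<^sub>R ?f (g x) b)) (at x)" if "x \<in> D" for x
  proof -
    have df: "(f has_derivative ?f (g x)) (at (g x))" and dg: "(g has_derivative ?g x) (at x)"
      using C_arc_analytic_Suc_has_derivative[OF Suc.prems(1)] C_arc_analytic_Suc_has_derivative[OF
          Suc.prems(2)] that assms(5) by auto
    have eq: "?f (g x) w = (\<Sum>b\<in>Basis. (w \<bullet> b) *\<^sub>R ?f (g x) b)" for w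
    proof -
      have "linear (?f (g x))" using df has_derivative_linear by blast
      then have "?f (g x) (\<Sum>b\<in>Basis. (w \<bullet> b) *\<^sub>R b) = (\<Sum>b\<in>Basis. (w \<bullet> b) *\<^sub>R ?f (g x) b)"
        by (simp add: linear_sum linear_scale)
      then show ?thesis by (simp add: euclidean_representation)
    qed
    show ?thesis using has_derivative_compose[OF dg df] unfolding eq[of "?g x _"] .
  qed
  have f: "C_arc_analytic n (\<lambda>x. ?f (g x) b) D" for b
    using C_arc_analytic_Suc_derivative[OF Suc.prems(1)] C_arc_analytic_Suc_D[OF Suc.prems(2)] by (rule Suc.IH)
  have g: "C_arc_analytic n (\<lambda>x. ?g x v \<bullet> b) D" for v b
  proof (rule C_arc_analytic_linear_compose[OF assms(1), where h="\<lambda>y. y \<bullet> b"])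
    show "linear (\<lambda>y. y \<bullet> b)" by (simp add: linear_iff inner_add_left)
    show "C_arc_analytic n (\<lambda>x. ?g x v) D" using Suc.prems(2) by (rule C_arc_analytic_Suc_derivative)
  qed
  have "arc_analytic (\<lambda>x. f (g x)) D"
    using C_arc_analytic_arc[OF Suc.prems(1)] C_arc_analytic_arc[OF Suc.prems(2)] assms(5)
    unfolding arc_analytic_def by blast
  moreover have "C_arc_analytic n (\<lambda>x. \<Sum>b\<in>Basis. (?g x v \<bullet> b) *\<^sub>R ?f (g x) b) D" for v
    by (intro C_arc_analytic_sum C_arc_analytic_scaleR assms(1) f g)
  ultimately show ?case using d by (intro C_arc_analytic_SucI[OF assms(1)])
qed

lemma C_arc_analytic_Pair:
  assumes "open D" "C_arc_analytic n f D" "C_arc_analytic n g D" shows "C_arc_analytic n (\<lambda>x. (f x, g x)) D"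
proof -
  have "C_arc_analytic n (\<lambda>x. (f x, 0) + (0, g x)) D"
    by (intro C_arc_analytic_add assms C_arc_analytic_linear_compose[OF assms(1), where h="\<lambda>y. (y, 0)"]
      C_arc_analytic_linear_compose[OF assms(1), where h="\<lambda>y. (0, y)"]) (auto simp: linear_iff)
  then show ?thesis by simp
qed

lemma C_arc_analytic_vec:
  fixes f :: "'i::finite \<Rightarrow> 'a::euclidean_space \<Rightarrow> 'b::euclidean_space"
  assumes "open D" "\<And>i. C_arc_analytic n (f i) D" shows "C_arc_analytic n (\<lambda>x. \<chi> i. f i x) D"
proof -
  have "C_arc_analytic n (\<lambda>x. \<Sum>i\<in>UNIV. axis i (f i x)) D"
    by (intro C_arc_analytic_sum assms C_arc_analytic_linear_compose[OF assms(1), where h="axis _"])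
      (auto simp: linear_iff vec_eq_iff axis_def)
  moreover have "(\<Sum>i\<in>UNIV. axis i (f i x)) = (\<chi> i. f i x)" for x
    by (simp add: vec_eq_iff axis_def)
  ultimately show ?thesis by simp
qed

lemma C_arc_analytic_nth:
  assumes "open D" "C_arc_analytic n f D" shows "C_arc_analytic n (\<lambda>x. f x $ i) D"
  by (rule C_arc_analytic_linear_compose[OF assms(1) _ assms(2), where h="\<lambda>y. y $ i"]) (auto simp: linear_iff)

lemma C_arc_analytic_det:
  fixes f :: "'a::euclidean_space \<Rightarrow> real^'n^'n"
  assumes "open D" "C_arc_analytic n f D" shows "C_arc_analytic n (\<lambda>x. det (f x)) D"
  unfolding det_def by (intro C_arc_analytic_sum C_arc_analytic_mult[OF assms(1)] C_arc_analytic_prod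
      C_arc_analytic_nth assms C_arc_analytic_const)

section \<open>Power series\<close>

lemma norm_monomial_le:
  fixes w :: "'m::finite \<Rightarrow> 'c::real_normed_field"
  assumes "\<And>j. norm (w j) \<le> s"
  shows "norm (\<Prod>j\<in>UNIV. w j ^ \<alpha> j) \<le> (\<Prod>j\<in>(UNIV::'m set). s ^ \<alpha> j)"
  unfolding prod_norm[symmetric] norm_power
  by (intro prod_mono) (auto intro!: power_mono assms)

text \<open>Unordered summation of reals is automatically absolute. Evaluating the series at the
  corner \<open>x + (\<chi> j. s)\<close> therefore yields a convergent majorant for the closed cube
  of half-width \<open>s\<close> around \<open>x\<close>.\<close>

lemma power_series_abs_summable:
  fixes f :: "real^'m \<Rightarrow> real^'r"
  assumes "r > 0"
    and "\<And>z. z \<in> ball x r \<Longrightarrow>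
      ((\<lambda>\<alpha>. (\<Prod>j\<in>UNIV. (z $ j - x $ j) ^ \<alpha> j) *\<^sub>R a \<alpha>) has_sum f z) UNIV"
  obtains s where "s > 0" "\<And>z. (\<And>j. \<bar>z $ j - x $ j\<bar> \<le> s) \<Longrightarrow> z \<in> ball x r"
    "\<And>k. (\<lambda>\<alpha>. \<bar>a \<alpha> $ k\<bar> * (\<Prod>j\<in>(UNIV::'m set). s ^ \<alpha> j)) summable_on UNIV"
    "\<And>z k. (\<And>j. \<bar>z $ j - x $ j\<bar> \<le> s) \<Longrightarrow>
      ((\<lambda>\<alpha>. a \<alpha> $ k * (\<Prod>j\<in>UNIV. (z $ j - x $ j) ^ \<alpha> j)) has_sum f z $ k) UNIV"
proof
  \<comment> \<open>The l1 norm bounds the l2 norm, so a point of the cube has distance at most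
    \<open>CARD('m) * s = r / 2\<close> from \<open>x\<close>.\<close>
  define s where "s = r / (2 * real CARD('m))"
  show s: "s > 0" using assms(1) by (simp add: s_def)
  show ball: "z \<in> ball x r" if "\<And>j. \<bar>z $ j - x $ j\<bar> \<le> s" for z
  proof -
    have "norm (z - x) \<le> (\<Sum>j\<in>(UNIV::'m set). s)"
      by (rule order_trans[OF norm_le_l1_cart sum_mono]) (use that in auto)
    also have "\<dots> < r" using assms(1) by (simp add: s_def)
    finally show ?thesis by (simp add: dist_norm norm_minus_commute)
  qed
  show sums: "((\<lambda>\<alpha>. a \<alpha> $ k * (\<Prod>j\<in>UNIV. (z $ j - x $ j) ^ \<alpha> j)) has_sum f z $ k) UNIV"
    if "\<And>j. \<bar>z $ j - x $ j\<bar> \<le> s" for z k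
    using has_sum_bounded_linear[OF bounded_linear_vec_nth assms(2)[OF ball[OF that]], of k]
    by (simp add: mult.commute)
  show "(\<lambda>\<alpha>. \<bar>a \<alpha> $ k\<bar> * (\<Prod>j\<in>(UNIV::'m set). s ^ \<alpha> j)) summable_on UNIV" for k
  proof -
    have "((\<lambda>\<alpha>. a \<alpha> $ k * (\<Prod>j\<in>(UNIV::'m set). s ^ \<alpha> j)) has_sum f (x + (\<chi> j. s)) $ k) UNIV"
      using sums[of "x + (\<chi> j. s)" k] s by simp
    then have "(\<lambda>\<alpha>. a \<alpha> $ k * (\<Prod>j\<in>(UNIV::'m set). s ^ \<alpha> j)) summable_on UNIV"
      by (rule has_sum_imp_summable)
    from summable_on_iff_abs_summable_on_real[THEN iffD1, OF this] show ?thesis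
      using s by (simp add: abs_mult abs_prod)
  qed
qed

lemma power_series_uniform_limit:
  fixes b :: "('m::finite \<Rightarrow> nat) \<Rightarrow> real" and W :: "'m \<Rightarrow> complex \<Rightarrow> complex"
  assumes "(\<lambda>\<alpha>. \<bar>b \<alpha>\<bar> * (\<Prod>j\<in>(UNIV::'m set). s ^ \<alpha> j)) summable_on UNIV"
    and "\<And>j z. z \<in> Y \<Longrightarrow> norm (W j z) \<le> s"
  shows "uniform_limit Y (\<lambda>A z. \<Sum>\<alpha>\<in>A. of_real (b \<alpha>) * (\<Prod>j\<in>UNIV. W j z ^ \<alpha> j))
     (\<lambda>z. \<Sum>\<^sub>\<infinity>\<alpha>. of_real (b \<alpha>) * (\<Prod>j\<in>UNIV. W j z ^ \<alpha> j)) (finite_subsets_at_top UNIV)"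
proof (rule Weierstrass_m_test_general[OF _ assms(1)])
  fix \<alpha> :: "'m \<Rightarrow> nat" and z assume "z \<in> Y"
  then show "norm (of_real (b \<alpha>) * (\<Prod>j\<in>UNIV. W j z ^ \<alpha> j)) \<le> \<bar>b \<alpha>\<bar> * (\<Prod>j\<in>(UNIV::'m set). s ^ \<alpha> j)"
    unfolding norm_mult norm_of_real by (intro mult_left_mono norm_monomial_le assms(2)) auto
qed

text \<open>Holomorphic functions \<open>W j\<close> of a single variable are substituted into the
  series, so the one-variable theorem on locally uniform limits of holomorphic functions suffices.
  The limit is taken along finite sets of multi-indices.\<close>

lemma power_series_holomorphic:
  fixes b :: "('m::finite \<Rightarrow> nat) \<Rightarrow> real" and W :: "'m \<Rightarrow> complex \<Rightarrow> complex"
  assumes "(\<lambda>\<alpha>. \<bar>b \<alpha>\<bar> * (\<Prod>j\<in>(UNIV::'m set). s ^ \<alpha> j)) summable_on UNIV"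
    and "open Y" "\<And>j z. z \<in> Y \<Longrightarrow> norm (W j z) \<le> s" "\<And>j. W j holomorphic_on Y"
  shows "(\<lambda>z. \<Sum>\<^sub>\<infinity>\<alpha>. of_real (b \<alpha>) * (\<Prod>j\<in>UNIV. W j z ^ \<alpha> j)) holomorphic_on Y"
proof -
  have "\<exists>d>0. (\<lambda>z. \<Sum>\<^sub>\<infinity>\<alpha>. of_real (b \<alpha>) * (\<Prod>j\<in>UNIV. W j z ^ \<alpha> j)) holomorphic_on ball z0 d"
    if z0: "z0 \<in> Y" for z0
  proof -
    obtain d where d: "d > 0" "cball z0 d \<subseteq> Y"
      using assms(2) z0 open_contains_cball by blast
    have hol: "(\<lambda>z. \<Sum>\<alpha>\<in>A. of_real (b \<alpha>) * (\<Prod>j\<in>UNIV. W j z ^ \<alpha> j)) holomorphic_on Y" for A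
      by (intro holomorphic_intros assms(4))
    show ?thesis
    proof (rule holomorphic_uniform_limit[where z=z0 and r=d and F="finite_subsets_at_top (UNIV::('m \<Rightarrow> nat)
        set)"
           and f="\<lambda>A z. \<Sum>\<alpha>\<in>A. of_real (b \<alpha>) * (\<Prod>j\<in>UNIV. W j z ^ \<alpha> j)"])
      show "\<forall>\<^sub>F A in finite_subsets_at_top UNIV.
        continuous_on (cball z0 d) (\<lambda>z. \<Sum>\<alpha>\<in>A. of_real (b \<alpha>) * (\<Prod>j\<in>UNIV. W j z ^ \<alpha> j)) \<and>
        (\<lambda>z. \<Sum>\<alpha>\<in>A. of_real (b \<alpha>) * (\<Prod>j\<in>UNIV. W j z ^ \<alpha> j)) holomorphic_on ball z0 d"
        using hol d by (intro always_eventually allI conjI)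
          (meson holomorphic_on_imp_continuous_on holomorphic_on_subset ball_subset_cball order_trans)+
      show "uniform_limit (cball z0 d) (\<lambda>A z. \<Sum>\<alpha>\<in>A. of_real (b \<alpha>) * (\<Prod>j\<in>UNIV. W j z ^ \<alpha> j))
         (\<lambda>z. \<Sum>\<^sub>\<infinity>\<alpha>. of_real (b \<alpha>) * (\<Prod>j\<in>UNIV. W j z ^ \<alpha> j)) (finite_subsets_at_top UNIV)"
        using power_series_uniform_limit[OF assms(1,3)] by (rule uniform_limit_on_subset) (use d in auto)
    qed (use d in auto)
  qed
  then show ?thesis
    by (meson at_within_open_subset centre_in_ball holomorphic_on_def holomorphic_on_imp_differentiable_at
        field_differentiable_at_within open_ball)
qed

text \<open>The coordinates of \<open>\<gamma> u - x\<close> extend to holomorphic functions that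
  vanish at \<open>t\<close>. On a small disc they stay within the cube of convergence, and
  substituting them into the power series extends \<open>f (\<gamma> u)\<close>.\<close>

lemma real_analytic_on_arc_analytic:
  fixes f :: "real^'m \<Rightarrow> real^'r"
  assumes "real_analytic_on f D" shows "arc_analytic f D"
  unfolding arc_analytic_def
proof (intro allI impI)
  fix \<gamma> :: "real \<Rightarrow> real^'m" and t assume g: "analytic_curve_at \<gamma> t" "\<gamma> t \<in> D"
  define x where "x = \<gamma> t"
  obtain r and a :: "('m \<Rightarrow> nat) \<Rightarrow> real^'r" where r: "r > 0" "\<And>z. z \<in> ball x r \<Longrightarrow>
      ((\<lambda>\<alpha>. (\<Prod>j\<in>UNIV. (z $ j - x $ j) ^ \<alpha> j) *\<^sub>R a \<alpha>) has_sum f z) UNIV"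
    using assms g(2) unfolding real_analytic_on_def x_def by blast
  obtain s where s: "s > 0"
    "\<And>k. (\<lambda>\<alpha>. \<bar>a \<alpha> $ k\<bar> * (\<Prod>j\<in>(UNIV::'m set). s ^ \<alpha> j)) summable_on UNIV"
    "\<And>z k. (\<And>j. \<bar>z $ j - x $ j\<bar> \<le> s) \<Longrightarrow>
      ((\<lambda>\<alpha>. a \<alpha> $ k * (\<Prod>j\<in>UNIV. (z $ j - x $ j) ^ \<alpha> j)) has_sum f z $ k) UNIV"
    by (rule power_series_abs_summable[OF r]) auto
  have "ranalytic_at (\<lambda>u. \<gamma> u $ j - x $ j) t" for j
    using ranalytic_at_add[OF analytic_curve_at_inner[OF g(1), of "axis j 1"] ranalytic_at_const[of "- x $
        j"]] by (simp add: inner_axis)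
  then obtain e W where e: "e > 0" "\<And>j. W j holomorphic_on ball (complex_of_real t) e"
    "\<And>j u. \<bar>u - t\<bar> < e \<Longrightarrow> W j (complex_of_real u) = complex_of_real (\<gamma> u $ j - x $ j)"
    using ranalytic_at_common[of "UNIV::'m set" "\<lambda>j u. \<gamma> u $ j - x $ j" t] by auto
  have "eventually (\<lambda>z. \<forall>j\<in>UNIV. norm (W j z) < s) (nhds (of_real t))"
  proof (rule eventually_ball_finite)
    show "\<forall>j\<in>UNIV. eventually (\<lambda>z. norm (W j z) < s) (nhds (of_real t))"
    proof
      fix j
      have "isCont (W j) (of_real t)"
        using holomorphic_on_imp_continuous_on[OF e(2)[of j]] e(1) by (auto simp:
            continuous_on_eq_continuous_at)
      moreover have "W j (of_real t) = 0" using e(1,3) by (simp add: x_def)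
      ultimately have "filterlim (\<lambda>z. norm (W j z)) (nhds 0) (nhds (of_real t))"
        by (metis isContD norm_zero tendsto_norm tendsto_nhds_iff)
      then show "eventually (\<lambda>z. norm (W j z) < s) (nhds (of_real t))"
        using s(1) by (rule order_tendstoD(2))
    qed
  qed auto
  then obtain e' where e': "e' > 0" "\<And>z j. dist z (of_real t) < e' \<Longrightarrow> norm (W j z) < s"
    unfolding eventually_nhds_metric by blast
  define d where "d = min e e'"
  have d: "d > 0" "d \<le> e" using e(1) e'(1) by (auto simp: d_def)
  show "analytic_curve_at (\<lambda>u. f (\<gamma> u)) t"
    unfolding analytic_curve_at_def
  proof
    fix bb :: "real^'r" assume "bb \<in> Basis"
    then obtain k where bb: "bb = axis k 1" by (auto simp: Basis_vec_def)
    let ?G = "\<lambda>z. \<Sum>\<^sub>\<infinity>\<alpha>. of_real (a \<alpha> $ k) * (\<Prod>j\<in>UNIV. W j z ^ \<alpha> j)"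
    have "?G holomorphic_on ball (of_real t) d"
    proof (rule power_series_holomorphic[OF s(2) open_ball])
      fix j z assume "z \<in> ball (complex_of_real t) d"
      then have "dist z (of_real t) < e'" by (simp add: d_def dist_commute)
      then show "norm (W j z) \<le> s" using e'(2) less_imp_le by blast
    next
      show "W j holomorphic_on ball (complex_of_real t) d" for j
        by (rule holomorphic_on_subset[OF e(2)]) (use d in auto)
    qed
    moreover have "?G (of_real u) = of_real (f (\<gamma> u) $ k)" if u: "\<bar>u - t\<bar> < d" for u
    proof -
      have W: "W j (of_real u) = of_real (\<gamma> u $ j - x $ j)" for j
        using u d e(3) by auto
      have "\<bar>\<gamma> u $ j - x $ j\<bar> \<le> s" for j
        using e'(2)[of "of_real u" j] u unfolding W norm_of_real by (simp add: d_def dist_of_real dist_real_def)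
      then have "((\<lambda>\<alpha>. complex_of_real (a \<alpha> $ k * (\<Prod>j\<in>UNIV. (\<gamma> u $ j - x $ j) ^ \<alpha> j))) has_sum of_real (f (\<gamma>
          u) $ k)) UNIV"
        by (intro has_sum_of_real s(3))
      then show ?thesis unfolding W by (intro infsumI) simp
    qed
    ultimately show "ranalytic_at (\<lambda>u. f (\<gamma> u) \<bullet> bb) t"
      unfolding ranalytic_at_def bb inner_axis using d(1) by (intro exI[of _ d] conjI exI[of _ ?G]) auto
  qed
qed

text \<open>Termwise differentiation: complexified in the direction \<open>j\<close>, the finite partial sums are
  holomorphic and converge uniformly, so their derivatives converge too; convergence is along
  the filter that defines \<open>has_sum\<close>.\<close>

lemma power_series_directional_derivative:
  fixes F :: "real^'m \<Rightarrow> real" and b :: "('m \<Rightarrow> nat) \<Rightarrow> real"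
  assumes s: "s > 0" and summ: "(\<lambda>\<alpha>. \<bar>b \<alpha>\<bar> * (\<Prod>j\<in>(UNIV::'m set). s ^ \<alpha> j)) summable_on UNIV"
    and sums: "\<And>z. (\<And>j. \<bar>z $ j - x $ j\<bar> \<le> s) \<Longrightarrow>
      ((\<lambda>\<alpha>. b \<alpha> * (\<Prod>j\<in>UNIV. (z $ j - x $ j) ^ \<alpha> j)) has_sum F z) UNIV"
    and z: "\<And>j. \<bar>z $ j - x $ j\<bar> \<le> s / 2"
  obtains d where "((\<lambda>t. F (z + t *\<^sub>R axis j 1)) has_real_derivative d) (at 0)"
    "((\<lambda>\<beta>. real (Suc (\<beta> j)) * b (\<beta>(j := Suc (\<beta> j))) * (\<Prod>i\<in>UNIV. (z $ i - x $ i) ^ \<beta> i)) has_sum d) UNIV"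
proof -
  define c where "c i = complex_of_real (z $ i - x $ i)" for i
  \<comment> \<open>\<open>W\<close> is the complexified offset from \<open>x\<close>, moved by
    \<open>\<zeta>\<close> in coordinate \<open>j\<close>; \<open>Q\<close> collects the factors of
    a monomial that do not depend on \<open>\<zeta>\<close>.\<close>
  define W where "W i \<zeta> = c i + (if i = j then \<zeta> else 0)" for i \<zeta>
  define Q where "Q \<alpha> = (\<Prod>i\<in>UNIV - {j}. c i ^ \<alpha> i)" for \<alpha>
  let ?f = "\<lambda>A \<zeta>. \<Sum>\<alpha>\<in>A. of_real (b \<alpha>) * (\<Prod>i\<in>UNIV. W i \<zeta> ^ \<alpha> i)"
  let ?f' = "\<lambda>A \<zeta>. \<Sum>\<alpha>\<in>A. of_real (b \<alpha>) * ((of_nat (\<alpha> j) * W j \<zeta> ^ (\<alpha> j - 1)) * Q \<alpha>)"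
  define G where "G \<zeta> = (\<Sum>\<^sub>\<infinity>\<alpha>. of_real (b \<alpha>) * (\<Prod>i\<in>UNIV. W i \<zeta> ^ \<alpha> i))" for \<zeta>
  have prodW: "(\<Prod>i\<in>UNIV. W i \<zeta> ^ \<alpha> i) = (c j + \<zeta>) ^ \<alpha> j * Q \<alpha>" for \<alpha> \<zeta>
    by (subst prod.remove[of _ j]) (auto simp: W_def Q_def intro!: prod.cong)
  have Wle: "norm (W i \<zeta>) \<le> s" if "norm \<zeta> \<le> s / 2" for i \<zeta>
  proof -
    have "norm (W i \<zeta>) \<le> norm (c i) + norm (if i = j then \<zeta> else 0)"
      unfolding W_def by (rule norm_triangle_ineq)
    also have "\<dots> \<le> s / 2 + s / 2"
      using z[of i] that s by (intro add_mono) (auto simp: c_def simp del: of_real_diff)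
    finally show ?thesis by simp
  qed
  have der: "(?f A has_field_derivative ?f' A \<zeta>) (at \<zeta>)" for A \<zeta>
    unfolding prodW by (auto intro!: derivative_eq_intros sum.cong simp: W_def mult_ac)
  have ul: "uniform_limit (cball 0 (s/2)) ?f G (finite_subsets_at_top UNIV)"
    unfolding G_def by (rule power_series_uniform_limit[OF summ]) (auto intro!: Wle)
  obtain G' where G': "\<And>\<zeta>. \<zeta> \<in> ball 0 (s/2) \<Longrightarrow> (G has_field_derivative G' \<zeta>) (at \<zeta>) \<and>
      ((\<lambda>A. ?f' A \<zeta>) \<longlongrightarrow> G' \<zeta>) (finite_subsets_at_top UNIV)"
  proof (rule has_complex_derivative_uniform_limit[of 0 "s/2" ?f ?f' "finite_subsets_at_top UNIV" G])
    show "\<forall>\<^sub>F A in finite_subsets_at_top UNIV. continuous_on (cball 0 (s/2)) (?f A) \<and>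
       (\<forall>w\<in>ball 0 (s/2). (?f A has_field_derivative ?f' A w) (at w))"
      using der by (auto intro!: always_eventually continuous_at_imp_continuous_on DERIV_isCont)
  qed (use s ul in auto)
  have 0: "0 \<in> ball (0::complex) (s/2)" using s by simp
  have 1: "((\<lambda>\<alpha>. of_real (b \<alpha>) * ((of_nat (\<alpha> j) * W j 0 ^ (\<alpha> j - 1)) * Q \<alpha>)) has_sum G' 0) UNIV"
    using G'[OF 0] unfolding has_sum_def by auto
  have "of_real (b \<alpha>) * ((of_nat (\<alpha> j) * W j 0 ^ (\<alpha> j - 1)) * Q \<alpha>)
     = complex_of_real (b \<alpha> * (real (\<alpha> j) * (z $ j - x $ j) ^ (\<alpha> j - 1) * (\<Prod>i\<in>UNIV - {j}. (z $ i - x $ i) ^ \<alpha>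
         i)))" for \<alpha>
    by (simp add: W_def c_def Q_def)
  then have 2: "((\<lambda>\<alpha>. b \<alpha> * (real (\<alpha> j) * (z $ j - x $ j) ^ (\<alpha> j - 1) * (\<Prod>i\<in>UNIV - {j}. (z $ i - x $ i) ^ \<alpha>
      i))) has_sum Re (G' 0)) UNIV"
    using has_sum_Re[OF 1] by (simp only: Re_complex_of_real)
  \<comment> \<open>Terms with exponent 0 in coordinate \<open>j\<close> vanish under
    differentiation. The others are exactly the range of the injection \<open>h\<close>, along which
    the sum is reindexed.\<close>
  define h where "h \<beta> = \<beta>(j := Suc (\<beta> j))" for \<beta> :: "'m \<Rightarrow> nat"
  have "inj h"
  proof (rule injI)
    fix p q assume "h p = h q"
    then show "p = q" unfolding h_def fun_eq_iff by (metis fun_upd_apply old.nat.inject)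
  qed
  have rng: "\<alpha> \<in> range h" if "\<alpha> j \<noteq> 0" for \<alpha>
    using that by (intro image_eqI[of _ _ "\<alpha>(j := \<alpha> j - 1)"]) (auto simp: h_def)
  have "((\<lambda>\<alpha>. b \<alpha> * (real (\<alpha> j) * (z $ j - x $ j) ^ (\<alpha> j - 1) * (\<Prod>i\<in>UNIV - {j}. (z $ i - x $ i) ^ \<alpha> i)))
      has_sum Re (G' 0)) (range h)"
    by (subst has_sum_cong_neutral[THEN iffD1, OF _ _ _ 2]) (use rng in auto)
  then have "((\<lambda>\<beta>. b (h \<beta>) * (real (h \<beta> j) * (z $ j - x $ j) ^ (h \<beta> j - 1) * (\<Prod>i\<in>UNIV - {j}. (z $ i - x $ i) ^
      h \<beta> i))) has_sum Re (G' 0)) UNIV"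
    unfolding has_sum_reindex[OF \<open>inj h\<close>] by (simp only: o_def)
  moreover have "b (h \<beta>) * (real (h \<beta> j) * (z $ j - x $ j) ^ (h \<beta> j - 1) * (\<Prod>i\<in>UNIV - {j}. (z $ i - x $ i) ^ h
      \<beta> i))
    = real (Suc (\<beta> j)) * b (\<beta>(j := Suc (\<beta> j))) * (\<Prod>i\<in>UNIV. (z $ i - x $ i) ^ \<beta> i)" for \<beta>
    by (subst prod.remove[of UNIV j]) (auto simp: h_def intro!: prod.cong)
  ultimately have 3: "((\<lambda>\<beta>. real (Suc (\<beta> j)) * b (\<beta>(j := Suc (\<beta> j))) * (\<Prod>i\<in>UNIV. (z $ i - x $ i) ^ \<beta> i))
      has_sum Re (G' 0)) UNIV"
    by simp
  have "((\<lambda>t. Re (G (of_real t))) has_real_derivative Re (G' 0)) (at 0)"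
    using bounded_linear.has_vector_derivative[OF bounded_linear_Re has_vector_derivative_real_field[of G "G'
        0" 0 UNIV]] G'[OF 0]
    by (simp add: has_real_derivative_iff_has_vector_derivative)
  moreover have eq: "Re (G (of_real t)) = F (z + t *\<^sub>R axis j 1)" if t: "t \<in> ball 0 (s/2)" for t
  proof -
    have W: "W i (of_real t) = of_real ((z + t *\<^sub>R axis j 1) $ i - x $ i)" for i
      by (simp add: W_def c_def axis_def)
    have "\<bar>(z + t *\<^sub>R axis j 1) $ i - x $ i\<bar> \<le> s" for i
      using Wle[of "of_real t" i] t unfolding W norm_of_real by (simp add: dist_real_def)
    from has_sum_of_real[OF sums[OF this], where 'a=complex]
    have "G (of_real t) = of_real (F (z + t *\<^sub>R axis j 1))"
      unfolding G_def W by (intro infsumI) simp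
    then show ?thesis by simp
  qed
  ultimately have "((\<lambda>t. F (z + t *\<^sub>R axis j 1)) has_real_derivative Re (G' 0)) (at 0)"
    using s by (elim has_field_derivative_transform_within_open[where S="ball 0 (s/2)"]) auto
  then show thesis using 3 that by blast
qed

text \<open>A polynomial \<open>p\<close> with finitely many terms is split off so that all
  remaining monomials have degree at least 2. The remainder is then at most
  \<open>(norm (z - x) / s)\<^sup>2 * C\<close> and has derivative 0 at \<open>x\<close>.\<close>

lemma power_series_differentiable:
  fixes F :: "real^'m \<Rightarrow> real" and b :: "('m \<Rightarrow> nat) \<Rightarrow> real"
  assumes s: "s > 0" and summ: "(\<lambda>\<alpha>. \<bar>b \<alpha>\<bar> * (\<Prod>j\<in>(UNIV::'m set). s ^ \<alpha> j)) summable_on UNIV"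
    and sums: "\<And>z. (\<And>j. \<bar>z $ j - x $ j\<bar> \<le> s) \<Longrightarrow>
      ((\<lambda>\<alpha>. b \<alpha> * (\<Prod>j\<in>UNIV. (z $ j - x $ j) ^ \<alpha> j)) has_sum F z) UNIV"
  shows "F differentiable (at x)"
proof -
  \<comment> \<open>All multi-indices of degree 0 or 1 belong to \<open>A\<close>. It also contains
    mixed ones of higher degree, which is harmless, and as a product of finite sets it is clearly
    finite.\<close>
  define A where "A = {\<alpha> :: 'm \<Rightarrow> nat. \<forall>i. \<alpha> i \<le> 1}"
  have "A = (\<Pi>\<^sub>E i\<in>UNIV. {..1})" by (auto simp: A_def PiE_def)
  then have finA: "finite A" by (auto intro: finite_PiE)
  let ?t = "\<lambda>z \<alpha>. b \<alpha> * (\<Prod>j\<in>UNIV. (z $ j - x $ j) ^ \<alpha> j)"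
  define p where "p z = (\<Sum>\<alpha>\<in>A. ?t z \<alpha>)" for z
  define C where "C = (\<Sum>\<^sub>\<infinity>\<alpha>. \<bar>b \<alpha>\<bar> * (\<Prod>j\<in>(UNIV::'m set). s ^ \<alpha> j))"
  have C: "((\<lambda>\<alpha>. \<bar>b \<alpha>\<bar> * (\<Prod>j\<in>(UNIV::'m set). s ^ \<alpha> j)) has_sum C) UNIV"
    unfolding C_def using summ by (rule has_sum_infsum)
  have C0: "C \<ge> 0" unfolding C_def using s by (intro infsum_nonneg) (auto intro!: mult_nonneg_nonneg
      prod_nonneg)
  have rem: "\<bar>F z - p z\<bar> \<le> (norm (z - x) / s)\<^sup>2 * C" if zs: "norm (z - x) \<le> s" for z
  proof -
    let ?q = "norm (z - x) / s"
    have q: "0 \<le> ?q" "?q \<le> 1" using zs s by auto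
    have comp: "\<bar>z $ j - x $ j\<bar> \<le> norm (z - x)" for j
      using component_le_norm_cart[of "z - x" j] by simp
    have "((\<lambda>\<alpha>. if \<alpha> \<in> A then - ?t z \<alpha> else 0) has_sum (- p z)) UNIV"
      unfolding p_def using finA by (intro has_sum_finite_neutralI[of A]) (auto simp: sum_negf)
    moreover have "\<bar>z $ j - x $ j\<bar> \<le> s" for j using comp zs order_trans by blast
    ultimately have "((\<lambda>\<alpha>. ?t z \<alpha> + (if \<alpha> \<in> A then - ?t z \<alpha> else 0)) has_sum (F z + - p z)) UNIV"
      by (intro has_sum_add sums)
    moreover have "((\<lambda>\<alpha>. ?q\<^sup>2 * (\<bar>b \<alpha>\<bar> * (\<Prod>j\<in>(UNIV::'m set). s ^ \<alpha> j))) has_sum ?q\<^sup>2 * C) UNIV"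
      by (intro has_sum_cmult_right C)
    moreover have "norm (?t z \<alpha> + (if \<alpha> \<in> A then - ?t z \<alpha> else 0)) \<le> ?q\<^sup>2 * (\<bar>b \<alpha>\<bar> * (\<Prod>j\<in>(UNIV::'m set). s ^ \<alpha>
        j))" for \<alpha>
    proof (cases "\<alpha> \<in> A")
      case True
      then show ?thesis using s by (auto intro!: mult_nonneg_nonneg prod_nonneg)
    next
      case False
      then obtain i where "\<not> \<alpha> i \<le> 1" unfolding A_def by blast
      then have "\<alpha> i \<ge> 2" by simp
      moreover have "\<alpha> i \<le> (\<Sum>j\<in>UNIV. \<alpha> j)" by (rule member_le_sum) auto
      ultimately have n: "2 \<le> (\<Sum>j\<in>UNIV. \<alpha> j)" by linarith
      have "\<bar>\<Prod>j\<in>UNIV. (z $ j - x $ j) ^ \<alpha> j\<bar> \<le> (\<Prod>j\<in>(UNIV::'m set). norm (z - x) ^ \<alpha> j)"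
        using norm_monomial_le[of "\<lambda>j. z $ j - x $ j" "norm (z - x)" \<alpha>] comp by auto
      also have "\<dots> = (\<Prod>j\<in>(UNIV::'m set). ?q ^ \<alpha> j * s ^ \<alpha> j)"
        using s by (intro prod.cong) (auto simp: power_divide)
      also have "\<dots> = ?q ^ (\<Sum>j\<in>UNIV. \<alpha> j) * (\<Prod>j\<in>(UNIV::'m set). s ^ \<alpha> j)"
        by (simp add: prod.distrib power_sum)
      also have "\<dots> \<le> ?q\<^sup>2 * (\<Prod>j\<in>(UNIV::'m set). s ^ \<alpha> j)"
        using q n s by (intro mult_right_mono power_decreasing) (auto intro!: prod_nonneg)
      finally have "\<bar>b \<alpha>\<bar> * \<bar>\<Prod>j\<in>UNIV. (z $ j - x $ j) ^ \<alpha> j\<bar> \<le> \<bar>b \<alpha>\<bar> * (?q\<^sup>2 * (\<Prod>j\<in>(UNIV::'m set). s ^ \<alpha> j))"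
        by (rule mult_left_mono) simp
      then show ?thesis using False by (simp only: if_False add_0_right real_norm_def abs_mult
          mult.left_commute)
    qed
    ultimately have "norm (F z + - p z) \<le> ?q\<^sup>2 * C" by (rule norm_infsum_le)
    then show ?thesis by simp
  qed
  have "F x = p x" using rem[of x] s by simp
  have "((\<lambda>z. F z - p z) has_derivative (\<lambda>_. 0)) (at x)"
    unfolding has_derivative_at_alt
  proof (intro conjI allI impI)
    fix e :: real assume e: "e > 0"
    \<comment> \<open>Chosen so that the quadratic bound is at most \<open>e * norm (z - x)\<close>;
      \<open>C + 1\<close> replaces \<open>C\<close>, which may be 0, in the denominator.\<close>
    define d where "d = min s (e * s\<^sup>2 / (C + 1))"
    have "d > 0" using e s C0 by (auto simp: d_def intro!: divide_pos_pos)
    moreover have "norm (F z - p z - (F x - p x) - 0) \<le> e * norm (z - x)" if zd: "norm (z - x) < d" for z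
    proof -
      have zs: "norm (z - x) \<le> s" and ze: "norm (z - x) \<le> e * s\<^sup>2 / (C + 1)" using zd by (auto simp: d_def)
      have "norm (F z - p z - (F x - p x) - 0) \<le> (norm (z - x) / s)\<^sup>2 * C"
        using rem[OF zs] \<open>F x = p x\<close> by simp
      also have "\<dots> \<le> (norm (z - x) / s)\<^sup>2 * (C + 1)" by (intro mult_left_mono) auto
      also have "\<dots> = norm (z - x) * (norm (z - x) * ((C + 1) / s\<^sup>2))"
        by (simp add: power2_eq_square)
      also have "\<dots> \<le> norm (z - x) * ((e * s\<^sup>2 / (C + 1)) * ((C + 1) / s\<^sup>2))"
        using ze C0 s by (intro mult_left_mono mult_right_mono) auto
      also have "\<dots> = e * norm (z - x)"
      proof -
        have "C + 1 \<noteq> 0" using C0 by simp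
        then have "(e * s\<^sup>2 / (C + 1)) * ((C + 1) / s\<^sup>2) = e" using s by simp
        then show ?thesis by simp
      qed
      finally show ?thesis .
    qed
    ultimately show "\<exists>d>0. \<forall>z. norm (z - x) < d \<longrightarrow> norm (F z - p z - (F x - p x) - 0) \<le> e * norm (z - x)"
      by blast
  qed auto
  then have "(\<lambda>z. F z - p z) differentiable (at x)" by (auto simp: differentiable_def)
  moreover have "p differentiable (at x)"
  proof -
    have "(\<lambda>z. z $ j) differentiable (at x)" for j
      by (intro bounded_linear_imp_differentiable bounded_linear_vec_nth)
    then have "(\<lambda>z. (z $ j - x $ j) ^ n) differentiable (at x)" for j n
      by (intro differentiable_power differentiable_diff) auto
    then have "(\<lambda>z. \<Prod>j\<in>J. (z $ j - x $ j) ^ \<alpha> j) differentiable (at x)" for \<alpha> :: "'m \<Rightarrow> nat" and J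
      by (induction J rule: infinite_finite_induct) (auto intro: differentiable_mult)
    then show ?thesis unfolding p_def by (intro differentiable_sum finA differentiable_mult) auto
  qed
  ultimately have "(\<lambda>z. (F z - p z) + p z) differentiable (at x)" by (rule differentiable_add)
  then show ?thesis by simp
qed

lemma has_derivative_line:
  assumes "(f has_derivative f') (at x)"
  shows "((\<lambda>t. f (x + t *\<^sub>R v)) has_vector_derivative f' v) (at 0)"
proof -
  have "((\<lambda>t. x + t *\<^sub>R v) has_derivative (\<lambda>t. t *\<^sub>R v)) (at 0)"
    by (auto intro!: derivative_eq_intros)
  from has_derivative_compose[OF this, of f f'] assms
  show ?thesis
    unfolding has_vector_derivative_def
    by (simp add: linear_scale[OF has_derivative_linear[OF assms]])
qed

lemma real_analytic_on_differentiable: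
  fixes f :: "real^'m \<Rightarrow> real^'r"
  assumes "real_analytic_on f D" "x \<in> D" shows "f differentiable (at x)"
proof -
  obtain r and a :: "('m \<Rightarrow> nat) \<Rightarrow> real^'r" where r: "r > 0" "\<And>z. z \<in> ball x r \<Longrightarrow>
      ((\<lambda>\<alpha>. (\<Prod>j\<in>UNIV. (z $ j - x $ j) ^ \<alpha> j) *\<^sub>R a \<alpha>) has_sum f z) UNIV"
    using assms unfolding real_analytic_on_def by blast
  obtain s where s: "s > 0"
    "\<And>k. (\<lambda>\<alpha>. \<bar>a \<alpha> $ k\<bar> * (\<Prod>j\<in>(UNIV::'m set). s ^ \<alpha> j)) summable_on UNIV"
    "\<And>z k. (\<And>j. \<bar>z $ j - x $ j\<bar> \<le> s) \<Longrightarrow>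
      ((\<lambda>\<alpha>. a \<alpha> $ k * (\<Prod>j\<in>UNIV. (z $ j - x $ j) ^ \<alpha> j)) has_sum f z $ k) UNIV"
    by (rule power_series_abs_summable[OF r]) auto
  have "(\<lambda>z. f z $ k) differentiable (at x)" for k
    by (rule power_series_differentiable[OF s(1) s(2)[of k]]) (rule s(3))
  then show ?thesis
    by (intro differentiable_componentwise_within[THEN iffD2]) (auto simp: Basis_vec_def inner_axis)
qed

text \<open>The candidate coefficients are those of the formal derivative. Restricted to the line in
  direction \<open>j\<close>, the termwise derivative and the Frechet derivative are both the
  one-variable derivative, hence equal. The radius \<open>s / 2\<close> is the one on which termwise
  differentiation is available.\<close>

lemma real_analytic_on_partial_derivative:
  fixes f :: "real^'m \<Rightarrow> real^'r"
  assumes "real_analytic_on f D" "open D"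
  shows "real_analytic_on (\<lambda>x. frechet_derivative f (at x) (axis j 1)) D"
  unfolding real_analytic_on_def
proof
  fix x assume x: "x \<in> D"
  obtain r and a :: "('m \<Rightarrow> nat) \<Rightarrow> real^'r" where r: "r > 0" "\<And>z. z \<in> ball x r \<Longrightarrow>
      ((\<lambda>\<alpha>. (\<Prod>j\<in>UNIV. (z $ j - x $ j) ^ \<alpha> j) *\<^sub>R a \<alpha>) has_sum f z) UNIV"
    using assms(1) x unfolding real_analytic_on_def by blast
  obtain s where s: "s > 0"
    "\<And>k. (\<lambda>\<alpha>. \<bar>a \<alpha> $ k\<bar> * (\<Prod>j\<in>(UNIV::'m set). s ^ \<alpha> j)) summable_on UNIV"
    "\<And>z k. (\<And>j. \<bar>z $ j - x $ j\<bar> \<le> s) \<Longrightarrow>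
      ((\<lambda>\<alpha>. a \<alpha> $ k * (\<Prod>j\<in>UNIV. (z $ j - x $ j) ^ \<alpha> j)) has_sum f z $ k) UNIV"
    by (rule power_series_abs_summable[OF r]) auto
  obtain e where e: "e > 0" "ball x e \<subseteq> D" using assms(2) x open_contains_ball by blast
  define a' where "a' \<beta> = real (Suc (\<beta> j)) *\<^sub>R a (\<beta>(j := Suc (\<beta> j)))" for \<beta>
  have "((\<lambda>\<beta>. (\<Prod>i\<in>UNIV. (z $ i - x $ i) ^ \<beta> i) *\<^sub>R a' \<beta>) has_sum frechet_derivative f (at z) (axis j 1)) UNIV"
    if z: "z \<in> ball x (min e (s/2))" for z
  proof -
    have comp: "\<bar>z $ i - x $ i\<bar> \<le> s / 2" for i
      using component_le_norm_cart[of "z - x" i] z by (simp add: dist_norm norm_minus_commute)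
    have "(f has_derivative frechet_derivative f (at z)) (at z)"
      using real_analytic_on_differentiable[OF assms(1), of z] e(2) z
      by (auto simp: frechet_derivative_works[symmetric])
    then have "((\<lambda>t. f (z + t *\<^sub>R axis j 1)) has_vector_derivative frechet_derivative f (at z) (axis j 1)) (at
        0)"
      by (rule has_derivative_line)
    then have fd: "((\<lambda>t. f (z + t *\<^sub>R axis j 1) $ k) has_real_derivative frechet_derivative f (at z) (axis j
        1) $ k) (at 0)" for k
      unfolding has_real_derivative_iff_has_vector_derivative
      by (rule bounded_linear.has_vector_derivative[OF bounded_linear_vec_nth])
    have "((\<lambda>\<beta>. ((\<Prod>i\<in>UNIV. (z $ i - x $ i) ^ \<beta> i) *\<^sub>R a' \<beta>) $ k) has_sum frechet_derivative f (at z) (axis j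
        1) $ k) UNIV" for k
    proof -
      obtain d where d: "((\<lambda>t. f (z + t *\<^sub>R axis j 1) $ k) has_real_derivative d) (at 0)"
        "((\<lambda>\<beta>. real (Suc (\<beta> j)) * a (\<beta>(j := Suc (\<beta> j))) $ k * (\<Prod>i\<in>UNIV. (z $ i - x $ i) ^ \<beta> i)) has_sum d) UNIV"
        by (rule power_series_directional_derivative[OF s(1) s(2)[of k] s(3) comp, of j]) auto
      have "d = frechet_derivative f (at z) (axis j 1) $ k" using DERIV_unique[OF d(1) fd] .
      then show ?thesis using d(2) by (simp add: a'_def mult_ac)
    qed
    then show ?thesis unfolding has_sum_def by (intro vec_tendstoI) (simp only: sum_component)
  qed
  then show "\<exists>r>0. \<exists>a. \<forall>z\<in>ball x r. ((\<lambda>\<alpha>. (\<Prod>j\<in>UNIV. (z $ j - x $ j) ^ \<alpha> j) *\<^sub>R a \<alpha>) has_sum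
       frechet_derivative f (at z) (axis j 1)) UNIV"
    using e s(1) by (intro exI[of _ "min e (s/2)"] conjI exI[of _ a']) auto
qed

text \<open>The derivative in direction \<open>v\<close> is a combination of partial derivatives
  with constant coefficients, and partial derivatives are again real-analytic, so the induction
  closes.\<close>

lemma real_analytic_on_C_arc_analytic:
  fixes f :: "real^'m \<Rightarrow> real^'r"
  assumes "open D" "real_analytic_on f D" shows "C_arc_analytic n f D"
  using assms(2)
proof (induction n arbitrary: f)
  case 0 then show ?case by (simp add: real_analytic_on_arc_analytic)
next
  case (Suc n)
  have d: "(f has_derivative frechet_derivative f (at x)) (at x)" if "x \<in> D" for x
    using real_analytic_on_differentiable[OF Suc.prems that] by (simp add: frechet_derivative_works)
  have "C_arc_analytic n (\<lambda>x. \<Sum>j\<in>UNIV. v $ j *\<^sub>R frechet_derivative f (at x) (axis j 1)) D" for v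
    by (intro C_arc_analytic_sum assms(1) C_arc_analytic_scaleR C_arc_analytic_const Suc.IH
        real_analytic_on_partial_derivative Suc.prems)
  moreover have "(\<Sum>j\<in>UNIV. v $ j *\<^sub>R frechet_derivative f (at x) (axis j 1)) = frechet_derivative f (at x) v"
      if "x \<in> D" for x v
  proof -
    have "v = (\<Sum>j\<in>UNIV. v $ j *\<^sub>R axis j 1)"
      by (simp add: vec_eq_iff axis_def if_distrib cong: if_cong)
    then have "frechet_derivative f (at x) v = frechet_derivative f (at x) (\<Sum>j\<in>UNIV. v $ j *\<^sub>R axis j 1)" by
        simp
    then show ?thesis using has_derivative_linear[OF d[OF that]] by (simp add: linear_sum linear_scale)
  qed
  ultimately have "C_arc_analytic n (\<lambda>x. frechet_derivative f (at x) v) D" for v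
    using C_arc_analytic_cong[OF assms(1), of "\<lambda>x. \<Sum>j\<in>UNIV. v $ j *\<^sub>R frechet_derivative f (at x) (axis j 1)"]
        by auto
  then show ?case
    by (intro C_arc_analytic_SucI[OF assms(1) real_analytic_on_arc_analytic[OF Suc.prems] d])
qed

section \<open>Zero sets and preimages of null sets\<close>

text \<open>At a limit point of zeros the identity theorem, applied to the extension on a disc,
  makes \<open>g\<close> vanish nearby. The limit points in \<open>T\<close> thus form a relatively
  open and closed set \<open>L\<close> missing \<open>t0\<close>, which is empty because
  \<open>T\<close> is connected.\<close>

lemma ranalytic_at_zeros_sparse:
  assumes "open T" "connected T" "\<And>t. t \<in> T \<Longrightarrow> ranalytic_at g t" "t0 \<in> T" "g t0 \<noteq> 0"
  shows "{t. g t = 0} sparse_in T"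
proof -
  have loc: "\<exists>e>0. \<forall>s. \<bar>s - t\<bar> < e \<longrightarrow> g s = 0" if t: "t \<in> T" "t islimpt {t. g t = 0}" for t
  proof -
    obtain e G where e: "e > 0" "G holomorphic_on ball (complex_of_real t) e"
       "\<And>s. \<bar>s - t\<bar> < e \<Longrightarrow> G (complex_of_real s) = complex_of_real (g s)"
      using assms(3)[OF t(1)] unfolding ranalytic_at_def by auto
    let ?Z = "complex_of_real ` ({s. g s = 0} \<inter> ball t e)"
    have "t islimpt ({s. g s = 0} \<inter> ball t e)"
      by (rule islimpt_Int_eventually[OF t(2)]) (rule eventually_at_in_open', use e(1) in auto)
    then have lim: "of_real t islimpt ?Z"
      by (intro islimpt_isCont_image) (auto simp: eventually_at_filter)
    have "G z = 0" if "z \<in> ball (of_real t) e" for z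
      by (rule analytic_continuation[OF e(2) open_ball connected_ball _ _ lim _ that])
        (use e in \<open>auto simp: dist_real_def abs_minus_commute dist_of_real\<close>)
    then have "g s = 0" if "\<bar>s - t\<bar> < e" for s
      using e(3)[OF that] that by (auto simp: dist_of_real dist_real_def abs_minus_commute)
    then show ?thesis using e(1) by blast
  qed
  define L where "L = {t \<in> T. t islimpt {t. g t = 0}}"
  have "closedin (top_of_set T) L"
    using closedin_closed_Int[OF closed_limpts, of T "{t. g t = 0}"] by (simp add: L_def Collect_conj_eq
        Int_commute)
  moreover have "open L"
  proof (rule openI)
    fix t assume "t \<in> L"
    then obtain e where e: "e > 0" "\<And>s. \<bar>s - t\<bar> < e \<Longrightarrow> g s = 0" and t: "t \<in> T" using loc unfolding L_def by blast
    obtain d where d: "d > 0" "ball t d \<subseteq> T" using assms(1) t open_contains_ball by blast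
    have "ball t (min d e) \<subseteq> L"
    proof
      fix s assume s: "s \<in> ball t (min d e)"
      have "s islimpt ball t (min d e)" using s d(1) e(1) by (simp add: islimpt_ball less_imp_le)
      then have "s islimpt {t. g t = 0}"
        by (rule islimpt_subset) (use e in \<open>auto simp: dist_real_def abs_minus_commute\<close>)
      then show "s \<in> L" using s d by (auto simp: L_def)
    qed
    then show "\<exists>d>0. ball t d \<subseteq> L" using d e by (intro exI[of _ "min d e"]) auto
  qed
  then have "openin (top_of_set T) L"
    using assms(1) by (auto simp: openin_open_eq L_def)
  ultimately have "L = {} \<or> L = T"
    using assms(2) connected_clopen by blast
  moreover have "t0 \<notin> L"
  proof
    assume "t0 \<in> L"
    then obtain e where e: "e > 0" "\<And>s. \<bar>s - t0\<bar> < e \<Longrightarrow> g s = 0" using loc unfolding L_def by blast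
    then show False using e(2)[of t0] assms(5) by auto
  qed
  ultimately have "L = {}" using assms(4) by auto
  then show ?thesis unfolding sparse_in_open[OF assms(1)] L_def by auto
qed

lemma null_sets_lborel_scale:
  fixes Z :: "'a::euclidean_space set"
  assumes "Z \<in> sets borel" "c \<noteq> 0" "AE x in lborel. q + c *\<^sub>R x \<notin> Z"
  shows "Z \<in> null_sets lborel"
proof -
  have "AE x in density (distr lborel borel (\<lambda>x. q + c *\<^sub>R x)) (\<lambda>_. ennreal (\<bar>c\<bar>^DIM('a))). x \<notin> Z"
    using assms by (subst AE_density, simp, subst AE_distr_iff) auto
  then have "AE x in lborel. x \<notin> Z"
    unfolding lborel_affine[OF assms(2), of q, symmetric] .
  then show ?thesis using assms(1) by (subst (asm) AE_iff_null_sets[symmetric]) auto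
qed

text \<open>Every line through \<open>q\<close> meets the zero set \<open>Z\<close> in a countable set, so by Fubini \<open>(Z - q) /
  t\<close> is null for some \<open>t \<noteq> 0\<close>. A single application of Fubini replaces the usual induction on
  the dimension.\<close>

lemma arc_analytic_convex_zeros_negligible:
  fixes g :: "'a::euclidean_space \<Rightarrow> real"
  assumes "open B" "convex B" "continuous_on B g" "arc_analytic g B" "q \<in> B" "g q \<noteq> 0"
  shows "negligible {p \<in> B. g p = 0}"
proof -
  define Z where "Z = {p \<in> B. g p = 0}"
  have "closedin (top_of_set B) Z"
    unfolding Z_def using continuous_closedin_preimage_constant[OF assms(3)] .
  then have Z: "Z \<in> sets borel"
    using assms(1) unfolding closedin_closed by auto
  have line: "AE t in lborel. q + t *\<^sub>R x \<notin> Z" for x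
  proof -
    define T where "T = (\<lambda>t. q + t *\<^sub>R x) -` B"
    have T: "open T" "0 \<in> T" "connected T"
    proof -
      show "open T" unfolding T_def by (intro open_vimage assms(1) continuous_intros)
      show "0 \<in> T" using assms(5) by (simp add: T_def)
      have "T = (\<lambda>t. t *\<^sub>R x) -` ((\<lambda>y. y - q) ` B)"
        unfolding T_def by (auto simp: image_iff algebra_simps)
      moreover have "linear (\<lambda>t. t *\<^sub>R x)" by (simp add: linear_iff algebra_simps)
      ultimately have "convex T"
        using assms(2) by (simp add: convex_linear_vimage convex_translation_subtract)
      then show "connected T" by (rule convex_connected)
    qed
    have "analytic_curve_at (\<lambda>t. q + t *\<^sub>R x) t" for t
      unfolding analytic_curve_at_def by (auto simp: inner_add_left intro!: ranalytic_at_add ranalytic_at_mult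
          ranalytic_at_ident)
    then have an: "ranalytic_at (\<lambda>t. g (q + t *\<^sub>R x)) t" if "t \<in> T" for t
      using assms(4) that unfolding arc_analytic_def T_def by force
    have "{t. g (q + t *\<^sub>R x) = 0} sparse_in T"
      by (rule ranalytic_at_zeros_sparse[OF T(1,3) an T(2)]) (use assms in auto)
    then have "countable (T \<inter> {t. g (q + t *\<^sub>R x) = 0})"
      using T(1) by (intro sparse_imp_countable)
    moreover have "{t. q + t *\<^sub>R x \<in> Z} = T \<inter> {t. g (q + t *\<^sub>R x) = 0}"
      by (auto simp: T_def Z_def)
    ultimately have "{t. q + t *\<^sub>R x \<in> Z} \<in> null_sets lborel"
      by (simp add: countable_imp_null_set_lborel)
    then show ?thesis by (intro AE_I'[of "{t. q + t *\<^sub>R x \<in> Z}"]) auto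
  qed
  have "AE x in lborel. AE t in (lborel :: real measure). q + t *\<^sub>R x \<notin> Z" using line by simp
  moreover have "{p \<in> space (lborel \<Otimes>\<^sub>M lborel). q + snd p *\<^sub>R fst p \<notin> Z} \<in> sets (lborel \<Otimes>\<^sub>M (lborel :: real
      measure))"
  proof -
    have "(\<lambda>p :: 'a \<times> real. q + snd p *\<^sub>R fst p) \<in> borel_measurable (lborel \<Otimes>\<^sub>M lborel)"
      by simp
    then show ?thesis using Z by measurable
  qed
  ultimately have "AE t in (lborel :: real measure). AE x in lborel. q + t *\<^sub>R x \<notin> Z"
    using lborel_pair.AE_commute[of "\<lambda>x t. q + t *\<^sub>R x \<notin> Z"] by simp
  \<comment> \<open>The slice at \<open>t = 0\<close> consists of the point \<open>q\<close> alone
    and cannot be rescaled; being a single value of \<open>t\<close>, it may be discarded.\<close>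
  then have ev: "AE t in (lborel :: real measure). t \<noteq> 0 \<and> (AE x in lborel. q + t *\<^sub>R x \<notin> Z)"
    using AE_lborel_singleton[of "0::real"] by eventually_elim auto
  have "ae_filter (lborel :: real measure) \<noteq> bot" by (simp add: ae_filter_eq_bot_iff)
  then obtain t :: real where "t \<noteq> 0" "AE x in lborel. q + t *\<^sub>R x \<notin> Z"
    using eventually_happens[OF ev] by auto
  then have "Z \<in> null_sets lborel" using null_sets_lborel_scale Z by blast
  then show ?thesis unfolding Z_def negligible_iff_null_sets by (rule null_sets_completionI)
qed

text \<open>From balls to connected domains: on a ball inside \<open>D\<close> the function either
  vanishes identically or has a negligible zero set. A ball of the second kind cannot meet the
  interior \<open>W\<close> of the zero set, since that would produce a nonempty open negligible
  set. Hence \<open>W\<close> and \<open>D - W\<close> are both open, and \<open>p0\<close> excludes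
  \<open>W = D\<close>.\<close>

lemma arc_analytic_zeros_negligible:
  fixes g :: "'a::euclidean_space \<Rightarrow> real"
  assumes D: "open D" "connected D" and g: "continuous_on D g" "arc_analytic g D" and p0: "p0 \<in> D" "g p0 \<noteq> 0"
  shows "negligible {p \<in> D. g p = 0}"
proof -
  have ballneg: "negligible {p \<in> ball x e. g p = 0}" if "ball x e \<subseteq> D" "q \<in> ball x e" "g q \<noteq> 0" for x e q
    using that g by (intro arc_analytic_convex_zeros_negligible[of _ _ q])
      (auto intro: continuous_on_subset simp: arc_analytic_def)
  define W where "W = {p \<in> D. \<exists>e>0. ball p e \<subseteq> D \<and> (\<forall>x\<in>ball p e. g x = 0)}"
  have "open W"
  proof (rule openI)
    fix p assume "p \<in> W"
    then obtain e where e: "e > 0" "ball p e \<subseteq> D" "\<forall>x\<in>ball p e. g x = 0" unfolding W_def by blast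
    have "ball p e \<subseteq> W"
    proof
      fix x assume x: "x \<in> ball p e"
      then obtain d where "d > 0" "ball x d \<subseteq> ball p e" using openE[OF open_ball] by blast
      then show "x \<in> W" using e x unfolding W_def by blast
    qed
    then show "\<exists>e>0. ball p e \<subseteq> W" using e by blast
  qed
  moreover have good: "\<exists>e>0. ball p e \<subseteq> D - W \<and> negligible {x \<in> ball p e. g x = 0}" if p: "p \<in> D - W" for p
  proof -
    obtain e where e: "e > 0" "ball p e \<subseteq> D" using D(1) p openE by blast
    then obtain q where q: "q \<in> ball p e" "g q \<noteq> 0" using p unfolding W_def by blast
    have neg: "negligible {x \<in> ball p e. g x = 0}" by (rule ballneg[OF e(2) q])
    have "x \<notin> W" if x: "x \<in> ball p e" for x
    proof
      assume "x \<in> W"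
      then obtain d where d: "d > 0" "\<forall>y\<in>ball x d. g y = 0" unfolding W_def by blast
      have "ball x d \<inter> ball p e \<subseteq> {x \<in> ball p e. g x = 0}" using d by auto
      then have "negligible (ball x d \<inter> ball p e)" using neg negligible_subset by blast
      moreover have "x \<in> ball x d \<inter> ball p e" using x d by auto
      ultimately show False using open_not_negligible[of "ball x d \<inter> ball p e"]
        by (metis empty_iff open_Int open_ball)
    qed
    then show ?thesis using e neg by blast
  qed
  then have "open (D - W)" by (intro openI) blast
  ultimately have "W = {} \<or> D - W = {}"
    using connectedD[OF D(2), of W "D - W"] unfolding W_def by blast
  moreover have "p0 \<notin> W" using p0 unfolding W_def by auto
  ultimately have "W = {}" using p0 by blast
  show ?thesis
  proof (rule locally_negligible_alt[THEN iffD2], rule ballI)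
    fix x assume x: "x \<in> {p \<in> D. g p = 0}"
    then obtain e where e: "e > 0" "negligible {y \<in> ball x e. g y = 0}" using good[of x] \<open>W = {}\<close> by auto
    have "openin (top_of_set {p \<in> D. g p = 0}) ({p \<in> D. g p = 0} \<inter> ball x e)"
      by (simp add: openin_open_Int)
    moreover have "negligible ({p \<in> D. g p = 0} \<inter> ball x e)"
      using e(2) by (rule negligible_subset) auto
    ultimately show "\<exists>U. openin (top_of_set {p \<in> D. g p = 0}) U \<and> x \<in> U \<and> negligible U"
      using x e by (intro exI[of _ "{p \<in> D. g p = 0} \<inter> ball x e"]) auto
  qed
qed

text \<open>Negligibility is a local property. Near a point with invertible derivative the preimage
  of \<open>N\<close> lies in the image of part of \<open>N\<close> under the differentiable local
  inverse, and differentiable maps between spaces of equal dimension preserve negligible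
  sets.\<close>

lemma negligible_preimage_regular:
  fixes G :: "real^'m \<Rightarrow> real^'m"
  assumes "\<And>x. (G has_derivative G' x) (at x)" "\<And>v. continuous_on UNIV (\<lambda>x. G' x v)" "negligible N"
  shows "negligible {x. G x \<in> N \<and> det (matrix (G' x)) \<noteq> 0}" (is "negligible ?S")
proof (rule locally_negligible_alt[THEN iffD2], rule ballI)
  fix x assume x: "x \<in> ?S"
  have bl: "bounded_linear (G' x)" for x using assms(1) has_derivative_bounded_linear by blast
  \<comment> \<open>The inverse function theorem wants the derivative as a continuous map into the
    space of bounded linear maps; in finite dimension continuity in each direction is
    enough.\<close>
  define G'' where "G'' x = Blinfun (G' x)" for x
  have app: "blinfun_apply (G'' x) = G' x" for x unfolding G''_def by (rule bounded_linear_Blinfun_apply[OF bl])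
  have cont: "continuous_on UNIV G''"
    by (rule continuous_on_blinfun_componentwise) (simp add: app assms(2))
  have "inj (G' x)" using x bl det_nz_iff_inj[of "G' x"] by (auto dest: bounded_linear.linear)
  then obtain h where h: "linear h" "h \<circ> G' x = id"
    using linear_injective_left_inverse bl bounded_linear.linear by blast
  have happ: "blinfun_apply (Blinfun h) = h"
    using h(1) by (intro bounded_linear_Blinfun_apply) (simp add: linear_conv_bounded_linear)
  have inv: "Blinfun h o\<^sub>L G'' x = id_blinfun"
    by (rule blinfun_eqI) (use h(2) in \<open>simp add: happ app fun_eq_iff\<close>)
  have der: "(G has_derivative blinfun_apply (G'' z)) (at z)" for z using assms(1) by (simp add: app)
  obtain U V g g' where U: "open U" "x \<in> U" "homeomorphism U V G g"
    "\<And>y. y \<in> V \<Longrightarrow> (g has_derivative (g' y)) (at y)"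
    by (rule inverse_function_theorem[OF open_UNIV der cont UNIV_I inv]) (rule that; assumption)
  have "?S \<inter> U \<subseteq> g ` (N \<inter> V)"
  proof
    fix y assume y: "y \<in> ?S \<inter> U"
    then have "y = g (G y)" "G y \<in> N \<inter> V"
      using homeomorphism_apply1[OF U(3)] homeomorphism_image1[OF U(3)] by auto
    then show "y \<in> g ` (N \<inter> V)" by (rule image_eqI)
  qed
  moreover have "negligible (g ` (N \<inter> V))"
  proof (rule negligible_differentiable_image_negligible)
    show "g differentiable_on N \<inter> V"
      using U(4) unfolding differentiable_on_def differentiable_def by (auto intro: has_derivative_at_withinI)
    show "negligible (N \<inter> V)" using assms(3) by (rule negligible_subset) auto
  qed simp
  ultimately have "negligible (?S \<inter> U)" using negligible_subset by blast
  then show "\<exists>U. openin (top_of_set ?S) U \<and> x \<in> U \<and> negligible U"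
    using x U(1,2) by (intro exI[of _ "?S \<inter> U"]) (auto simp: openin_open_Int)
qed

section \<open>Gram matrices\<close>

declare transpose_matrix_vector [simp del]

section \<open>The smallest eigenvalue of a symmetric matrix\<close>

lemma inner_matrix_vector_transpose:
  fixes A :: "real^'m^'r"
  shows "(A *v x) \<bullet> y = x \<bullet> (transpose A *v y)"
  by (metis dot_lmul_matrix inner_commute transpose_matrix_vector)

text \<open>A minimiser \<open>v\<close> of the quadratic form on the unit sphere is an eigenvector.
  Perturbing \<open>v\<close> along the defect \<open>w = A *v v - l *\<^sub>R v\<close> gives
  \<open>2 * t * b + t\<^sup>2 * g \<ge> 0\<close> for every \<open>t\<close>, and the linear term
  forces \<open>b = w \<bullet> w\<close> to vanish.\<close>

lemma symmetric_rayleigh_minimum: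
  fixes A :: "real^'m^'m"
  assumes sym: "transpose A = A"
  obtains v l where "norm v = 1" "A *v v = l *\<^sub>R v" "\<And>w. l * (norm w)\<^sup>2 \<le> w \<bullet> (A *v w)"
proof -
  let ?q = "\<lambda>w. w \<bullet> (A *v w)"
  have "continuous_on (sphere 0 1) ?q"
    by (intro continuous_intros matrix_vector_mult_linear_continuous_on)
  moreover have "sphere (0::real^'m) 1 \<noteq> {}" by simp
  ultimately obtain v where v: "v \<in> sphere 0 1" "\<And>w. w \<in> sphere 0 1 \<Longrightarrow> ?q v \<le> ?q w"
    using continuous_attains_inf[OF compact_sphere, of 0 1 ?q] by blast
  define l where "l = ?q v"
  have ge: "l * (norm w)\<^sup>2 \<le> ?q w" for w
  proof (cases "w = 0")
    case False
    have "l \<le> ?q ((1 / norm w) *\<^sub>R w)"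
      unfolding l_def using False by (intro v(2)) simp
    also have "\<dots> = ?q w / (norm w)\<^sup>2"
      by (simp add: matrix_vector_mult_scaleR power2_eq_square)
    finally show ?thesis using False by (simp add: field_simps)
  qed simp
  have n1: "norm v = 1" using v(1) by simp
  define w where "w = A *v v - l *\<^sub>R v"
  define b where "b = w \<bullet> w"
  define g where "g = ?q w - l * (norm w)\<^sup>2"
  have g0: "g \<ge> 0" unfolding g_def using ge[of w] by simp
  have quad: "2 * t * b + t\<^sup>2 * g \<ge> 0" for t
  proof -
    have s: "v \<bullet> (A *v w) = w \<bullet> (A *v v)"
      using inner_matrix_vector_transpose[of A v w] sym by (simp add: inner_commute)
    have "?q (v + t *\<^sub>R w) - l * (norm (v + t *\<^sub>R w))\<^sup>2
       = (?q v - l * (norm v)\<^sup>2) + 2 * t * (w \<bullet> (A *v v) - l * (w \<bullet> v)) + t\<^sup>2 * g"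
      unfolding g_def power2_norm_eq_inner
      by (simp add: matrix_vector_right_distrib matrix_vector_mult_scaleR inner_add_left inner_add_right s
          inner_commute[of v w] algebra_simps power2_eq_square)
    moreover have "w \<bullet> (A *v v) - l * (w \<bullet> v) = b"
      unfolding b_def by (subst (3) w_def) (simp add: inner_diff_right)
    ultimately show ?thesis using ge[of "v + t *\<^sub>R w"] n1 by (simp add: l_def)
  qed
  have "b = 0"
  proof (rule ccontr)
    assume "b \<noteq> 0"
    \<comment> \<open>A negative multiple of \<open>b\<close>, small enough for the linear term to
      win; \<open>g + 1\<close> avoids division by 0. Multiplied by \<open>(g + 1)\<^sup>2\<close>
      the quadratic becomes \<open>- (b\<^sup>2 * (g + 2))\<close>.\<close>
    define t where "t = - b / (g + 1)"
    have t: "t * (g + 1) = - b" using g0 by (simp add: t_def)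
    have "(2 * t * b + t\<^sup>2 * g) * (g + 1)\<^sup>2 = 2 * (t * (g + 1)) * b * (g + 1) + (t * (g + 1))\<^sup>2 * g"
      by (simp add: power2_eq_square algebra_simps)
    also have "\<dots> = - (b\<^sup>2 * (g + 2))" unfolding t by (simp add: power2_eq_square algebra_simps)
    finally have "(2 * t * b + t\<^sup>2 * g) * (g + 1)\<^sup>2 = - (b\<^sup>2 * (g + 2))" .
    moreover have "b\<^sup>2 * (g + 2) > 0" using g0 \<open>b \<noteq> 0\<close> by (intro mult_pos_pos) auto
    moreover have "(2 * t * b + t\<^sup>2 * g) * (g + 1)\<^sup>2 \<ge> 0" by (intro mult_nonneg_nonneg quad) simp
    ultimately show False by linarith
  qed
  then have "A *v v = l *\<^sub>R v" unfolding b_def w_def by simp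
  then show thesis using that n1 ge by blast
qed

text \<open>The \<open>Min\<close> in \<open>lambda_min\<close> is meaningful only on a finite set.
  Eigenvectors for distinct eigenvalues are orthogonal, and an orthogonal family in finite dimension
  is finite.\<close>

lemma finite_eigenvalues_symmetric:
  fixes A :: "real^'m^'m"
  assumes sym: "transpose A = A"
  shows "finite {l. \<exists>v. v \<noteq> 0 \<and> A *v v = l *\<^sub>R v}" (is "finite ?S")
proof -
  obtain f where f: "\<And>l. l \<in> ?S \<Longrightarrow> f l \<noteq> 0 \<and> A *v f l = l *\<^sub>R f l"
    using bchoice[of ?S "\<lambda>l v. v \<noteq> 0 \<and> A *v v = l *\<^sub>R v"] by auto
  have orth: "f l \<bullet> f m = 0" if "l \<in> ?S" "m \<in> ?S" "l \<noteq> m" for l m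
  proof -
    have "l * (f l \<bullet> f m) = m * (f l \<bullet> f m)"
      using inner_matrix_vector_transpose[of A "f l" "f m"] sym f[OF that(1)] f[OF that(2)] by simp
    then show ?thesis using that(3) by simp
  qed
  have "inj_on f ?S"
    by (rule inj_onI) (metis (no_types, lifting) f inner_eq_zero_iff orth)
  moreover have "finite (f ` ?S)"
    by (rule pairwise_orthogonal_imp_finite)
      (use orth in \<open>auto simp: pairwise_def orthogonal_def image_iff\<close>)
  ultimately show ?thesis using finite_imageD by blast
qed

lemma lambda_min_symmetric:
  fixes A :: "real^'m^'m"
  assumes sym: "transpose A = A"
  obtains v where "norm v = 1" "A *v v = lambda_min A *\<^sub>R v"
    "\<And>w. lambda_min A * (norm w)\<^sup>2 \<le> w \<bullet> (A *v w)"
proof -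
  obtain v l where v: "norm v = 1" "A *v v = l *\<^sub>R v" "\<And>w. l * (norm w)\<^sup>2 \<le> w \<bullet> (A *v w)"
    by (rule symmetric_rayleigh_minimum[OF sym]) (rule that; assumption)
  have "lambda_min A = l"
    unfolding lambda_min_def
  proof (rule Min_eqI[OF finite_eigenvalues_symmetric[OF sym]])
    fix m assume "m \<in> {l. \<exists>v. v \<noteq> 0 \<and> A *v v = l *\<^sub>R v}"
    then obtain w where w: "w \<noteq> 0" "A *v w = m *\<^sub>R w" by auto
    have "l * (norm w)\<^sup>2 \<le> m * (norm w)\<^sup>2" using v(3)[of w] w by (simp add: power2_norm_eq_inner)
    then show "l \<le> m" using w(1) by simp
  next
    show "l \<in> {l. \<exists>v. v \<noteq> 0 \<and> A *v v = l *\<^sub>R v}" using v by (auto intro!: exI[of _ v])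
  qed
  then show thesis using that v by blast
qed

section \<open>Gram matrices and full row rank\<close>

lemma inner_gram_matrix:
  fixes J :: "real^'m^'r"
  shows "w \<bullet> ((J ** transpose J) *v w) = (norm (transpose J *v w))\<^sup>2"
  using inner_matrix_vector_transpose[of "transpose J" w "transpose J *v w"]
  by (simp add: matrix_vector_mul_assoc power2_norm_eq_inner transpose_transpose)

lemma lambda_min_gram_le:
  fixes J :: "real^'m^'r"
  shows "lambda_min (J ** transpose J) * (norm w)\<^sup>2 \<le> (norm (transpose J *v w))\<^sup>2"
proof -
  have "transpose (J ** transpose J) = J ** transpose J" by (simp add: matrix_transpose_mul)
  then have "lambda_min (J ** transpose J) * (norm w)\<^sup>2 \<le> w \<bullet> ((J ** transpose J) *v w)"
    by (rule lambda_min_symmetric)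
  then show ?thesis by (simp only: inner_gram_matrix)
qed

lemma lambda_min_gram_pos:
  fixes J :: "real^'m^'r"
  assumes "\<And>w. transpose J *v w = 0 \<Longrightarrow> w = 0"
  shows "lambda_min (J ** transpose J) > 0"
proof -
  have "transpose (J ** transpose J) = J ** transpose J" by (simp add: matrix_transpose_mul)
  then obtain v where v: "norm v = 1" "(J ** transpose J) *v v = lambda_min (J ** transpose J) *\<^sub>R v"
    by (rule lambda_min_symmetric)
  have "lambda_min (J ** transpose J) = (norm (transpose J *v v))\<^sup>2"
    using inner_gram_matrix[of v J] v by (simp flip: power2_norm_eq_inner)
  moreover have "transpose J *v v \<noteq> 0" using assms[of v] v(1) by auto
  ultimately show ?thesis by simp
qed

text \<open>By \<open>inner_gram_matrix\<close> the Gram matrix has the same kernel as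
  \<open>transpose T\<close>.\<close>

lemma det_gram_nz_iff:
  fixes T :: "real^'m^'r"
  shows "det (T ** transpose T) \<noteq> 0 \<longleftrightarrow> (\<forall>w. transpose T *v w = 0 \<longrightarrow> w = 0)"
proof -
  have "(T ** transpose T) *v w = 0 \<longleftrightarrow> transpose T *v w = 0" for w
    using inner_gram_matrix[of w T]
    by (metis inner_zero_right matrix_vector_mul_assoc matrix_vector_mult_0_right norm_eq_zero zero_eq_power2)
  then show ?thesis
    unfolding invertible_det_nz[symmetric] invertible_left_inverse matrix_left_invertible_ker by blast
qed

text \<open>Expresses full row rank by the nonvanishing of a single polynomial in the entries, to
  which the results on zero sets apply.\<close>

lemma det_gram_nz_iff_rank:
  fixes T :: "real^'m^'r"
  shows "det (T ** transpose T) \<noteq> 0 \<longleftrightarrow> rank T = CARD('r)"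
proof -
  have "rank T = CARD('r) \<longleftrightarrow> inj ((*v) (transpose T))"
    using full_rank_injective[of "transpose T"] by (simp add: rank_transpose)
  also have "\<dots> \<longleftrightarrow> (\<forall>w. transpose T *v w = 0 \<longrightarrow> w = 0)"
    by (simp add: matrix_left_invertible_injective[symmetric] matrix_left_invertible_ker)
  finally show ?thesis by (simp add: det_gram_nz_iff)
qed

section \<open>The network\<close>

lemma open_vec_pi: "(\<And>i. open (C i)) \<Longrightarrow> open {X :: ('a::euclidean_space)^'n. \<forall>i. X $ i \<in> C i}"
proof -
  assume "\<And>i. open (C i)"
  then have "open (\<Inter>i\<in>(UNIV::'n set). (\<lambda>X. X $ i) -` C i)"
    by (intro open_INT) (auto intro!: open_vimage continuous_intros)
  moreover have "(\<Inter>i\<in>(UNIV::'n set). (\<lambda>X. X $ i) -` C i) = {X. \<forall>i. X $ i \<in> C i}" by auto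
  ultimately show ?thesis by simp
qed

text \<open>Open connected sets are path-connected, and paths can be chosen entry by entry.\<close>

lemma connected_vec_pi:
  fixes C :: "'n::finite \<Rightarrow> ('a::euclidean_space) set"
  assumes "\<And>i. open (C i)" "\<And>i. connected (C i)"
  shows "connected {X :: 'a^'n. \<forall>i. X $ i \<in> C i}"
proof (rule path_connected_imp_connected, unfold path_connected_def, intro ballI)
  fix X Y :: "'a^'n" assume XY: "X \<in> {X. \<forall>i. X $ i \<in> C i}" "Y \<in> {X. \<forall>i. X $ i \<in> C i}"
  have "\<exists>g. path g \<and> path_image g \<subseteq> C i \<and> pathstart g = X $ i \<and> pathfinish g = Y $ i" for i
    using connected_open_path_connected[OF assms] XY unfolding path_connected_def by blast
  then obtain g where g: "\<And>i. path (g i) \<and> path_image (g i) \<subseteq> C i \<and> pathstart (g i) = X $ i \<and> pathfinish (g i)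
      = Y $ i"
    by metis
  show "\<exists>g. path g \<and> path_image g \<subseteq> {X. \<forall>i. X $ i \<in> C i} \<and> pathstart g = X \<and> pathfinish g = Y"
  proof (intro exI[of _ "\<lambda>t. \<chi> i. g i t"] conjI)
    show "path (\<lambda>t. \<chi> i. g i t)" using g unfolding path_def by (intro continuous_on_vec_lambda) auto
    have "g i t \<in> C i" if "t \<in> {0..1}" for i t using g[of i] that unfolding path_image_def by blast
    then show "path_image (\<lambda>t. \<chi> i. g i t) \<subseteq> {X. \<forall>i. X $ i \<in> C i}" unfolding path_image_def by auto
  qed (use g in \<open>auto simp: pathstart_def pathfinish_def vec_eq_iff\<close>)
qed

section \<open>Joint analyticity of the network in scale, parameter and input\<close>

lemma C_arc_analytic_fst: "open D \<Longrightarrow> C_arc_analytic n fst D" by (rule C_arc_analytic_linear) (auto simp: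
    linear_iff)
lemma C_arc_analytic_snd: "open D \<Longrightarrow> C_arc_analytic n snd D" by (rule C_arc_analytic_linear) (auto simp:
    linear_iff)

lemma open_state_dom: "open U \<Longrightarrow> open (state_dom U l)"
  by (simp add: state_dom_def)

text \<open>Passes from vectors indexed by \<open>'p + 'd\<close> to pairs
  \<open>(\<theta>, u)\<close> by means of the linear map \<open>j\<close>.\<close>

lemma layer_C_arc_analytic:
  fixes \<phi> :: "('p::finite, 'd::finite) layer_maps"
  assumes "real_analyticity L lay \<phi> U" "open U" "m \<le> L"
  shows "C_arc_analytic n (\<lambda>p. \<phi> m (block lay m (fst p)) (snd p)) (UNIV \<times> state_dom U m)"
proof -
  define j :: "(real^'p) \<times> (real^'d) \<Rightarrow> real^('p + 'd)"
    where "j p = (\<chi> i. case i of Inl a \<Rightarrow> fst p $ a | Inr b \<Rightarrow> snd p $ b)" for p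
  have lin: "linear j" by (auto simp: linear_iff j_def vec_eq_iff split: sum.split)
  have [simp]: "par (j p) = fst p" "hid (j p) = snd p" for p
    by (auto simp: par_def hid_def j_def vec_eq_iff)
  have "linear (hid :: real^('p + 'd) \<Rightarrow> real^'d)" by (auto simp: linear_iff hid_def vec_eq_iff)
  then have "continuous_on UNIV (hid :: real^('p + 'd) \<Rightarrow> real^'d)"
    by (simp add: linear_continuous_on linear_conv_bounded_linear)
  then have op: "open {w :: real^('p + 'd). hid w \<in> state_dom U m}"
    using open_vimage[OF open_state_dom[OF assms(2)]] by (simp add: vimage_def)
  have "C_arc_analytic n (\<lambda>p. layer_fun lay \<phi> m (j p)) (UNIV \<times> state_dom U m)"
  proof (rule C_arc_analytic_compose[OF _ op])
    show "C_arc_analytic n (layer_fun lay \<phi> m) {w. hid w \<in> state_dom U m}"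
      using assms(1,3) op by (intro real_analytic_on_C_arc_analytic) (auto simp: real_analyticity_def)
    show "C_arc_analytic n j (UNIV \<times> state_dom U m)"
      using lin by (rule C_arc_analytic_linear) (simp add: open_Times open_state_dom assms(2))
  qed (auto simp: open_Times open_state_dom assms(2))
  then show ?thesis by (simp add: layer_fun_def)
qed

text \<open>The layer maps carry a real parameter, the first component of \<open>p\<close>, because
  the scale factor has to be an analytic variable on the same footing as \<open>\<theta>\<close> and
  the input.\<close>

lemma propagate_C_arc_analytic:
  fixes \<Phi> :: "real \<Rightarrow> ('p::finite, 'd::finite) layer_maps"
  assumes "open U" "\<And>m. m < l + k \<Longrightarrow>
    C_arc_analytic n (\<lambda>p. \<Phi> (fst p) m (block lay m (fst (snd p))) (snd (snd p))) (UNIV \<times> UNIV \<times> state_dom U m)"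
  shows "C_arc_analytic n (\<lambda>p. propagate lay (\<Phi> (fst p)) (fst (snd p)) l (snd (snd p)) k) (UNIV \<times> UNIV \<times>
      state_dom U l)"
  using assms(2)
proof (induction k)
  case 0
  have "linear (\<lambda>p :: real \<times> (real^'p) \<times> (real^'d). snd (snd p))" by (auto simp: linear_iff)
  then show ?case by (simp add: C_arc_analytic_linear open_Times open_state_dom assms(1))
next
  case (Suc k)
  let ?D = "UNIV \<times> UNIV \<times> state_dom U l :: (real \<times> (real^'p) \<times> (real^'d)) set"
  have op: "open ?D" "open (UNIV \<times> UNIV \<times> state_dom U (l + k) :: (real \<times> (real^'p) \<times> (real^'d)) set)"
    by (simp_all add: open_Times open_state_dom assms(1))
  have IH: "C_arc_analytic n (\<lambda>p. propagate lay (\<Phi> (fst p)) (fst (snd p)) l (snd (snd p)) k) ?D"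
    using Suc by auto
  have fs: "C_arc_analytic n (\<lambda>p. fst (snd p)) ?D"
    by (rule C_arc_analytic_linear[OF _ op(1)]) (auto simp: linear_iff)
  have "C_arc_analytic n (\<lambda>p. (fst p, fst (snd p), propagate lay (\<Phi> (fst p)) (fst (snd p)) l (snd (snd p)) k))
      ?D"
    by (intro C_arc_analytic_Pair C_arc_analytic_fst IH op fs)
  \<comment> \<open>The domain of layer \<open>l + k\<close> matters only for \<open>k = 0\<close>,
    where the state is the given \<open>u\<close>; for positive \<open>k\<close> the layer index is
    positive and every state is admissible.\<close>
  then have "C_arc_analytic n (\<lambda>p. \<Phi> (fst p) (l + k) (block lay (l + k) (fst (snd p)))
      (propagate lay (\<Phi> (fst p)) (fst (snd p)) l (snd (snd p)) k)) ?D"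
    using C_arc_analytic_compose[OF op Suc.prems[of "l + k"], of "\<lambda>p. (fst p, fst (snd p), propagate lay (\<Phi>
        (fst p)) (fst (snd p)) l (snd (snd p)) k)"]
    by (cases k) (auto simp: state_dom_def)
  then show ?case using IH by (simp add: C_arc_analytic_add[OF op(1)])
qed

lemma net_from_C_arc_analytic:
  fixes \<Phi> :: "real \<Rightarrow> ('p::finite, 'd::finite) layer_maps"
  assumes "open U" "l \<le> L" "\<And>m. m \<le> L \<Longrightarrow>
    C_arc_analytic n (\<lambda>p. \<Phi> (fst p) m (block lay m (fst (snd p))) (snd (snd p))) (UNIV \<times> UNIV \<times> state_dom U m)"
  shows "C_arc_analytic n (\<lambda>p. net_from L lay (\<Phi> (fst p)) l (fst (snd p)) (snd (snd p))) (UNIV \<times> UNIV \<times>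
      state_dom U l)"
proof -
  let ?D = "UNIV \<times> UNIV \<times> state_dom U l :: (real \<times> (real^'p) \<times> (real^'d)) set"
  have op: "open ?D" "open (UNIV \<times> UNIV \<times> state_dom U L :: (real \<times> (real^'p) \<times> (real^'d)) set)"
    by (simp_all add: open_Times open_state_dom assms(1))
  let ?P = "\<lambda>p. propagate lay (\<Phi> (fst p)) (fst (snd p)) l (snd (snd p)) (L - l)"
  have P: "C_arc_analytic n ?P ?D"
    using assms by (intro propagate_C_arc_analytic) auto
  have fs: "C_arc_analytic n (\<lambda>p. fst (snd p)) ?D"
    by (rule C_arc_analytic_linear[OF _ op(1)]) (auto simp: linear_iff)
  have "C_arc_analytic n (\<lambda>p. (fst p, fst (snd p), ?P p)) ?D"
    by (intro C_arc_analytic_Pair C_arc_analytic_fst P op fs)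
  moreover have "(fst p, fst (snd p), ?P p) \<in> UNIV \<times> UNIV \<times> state_dom U L" if "p \<in> ?D" for p
    using that assms(2) by (cases "l = L") (auto simp: state_dom_def)
  ultimately show ?thesis
    unfolding net_from_def using C_arc_analytic_compose[OF op assms(3)[OF order_refl], of "\<lambda>p. (fst p, fst
        (snd p), ?P p)"] by simp
qed

lemma rescale_C_arc_analytic:
  fixes \<phi> :: "('p::finite, 'd::finite) layer_maps"
  assumes "real_analyticity L lay \<phi> U" "open U" "m \<le> L"
  shows "C_arc_analytic n (\<lambda>p. rescale L (\<lambda>m. if m < l then fst p else 1) \<phi> m (block lay m (fst (snd p))) (snd
      (snd p)))
    (UNIV \<times> UNIV \<times> state_dom U m)"
proof -
  let ?D = "UNIV \<times> UNIV \<times> state_dom U m :: (real \<times> (real^'p) \<times> (real^'d)) set"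
  have op: "open ?D" by (simp add: open_Times open_state_dom assms(2))
  have "C_arc_analytic n (\<lambda>p. \<phi> m (block lay m (fst (snd p))) (snd (snd p))) ?D"
    using C_arc_analytic_compose[OF op _ layer_C_arc_analytic[OF assms] C_arc_analytic_snd[OF op]]
    by (auto simp: open_Times open_state_dom assms(2))
  moreover from this have "C_arc_analytic n (\<lambda>p. fst p *\<^sub>R \<phi> m (block lay m (fst (snd p))) (snd (snd p))) ?D"
    by (intro C_arc_analytic_scaleR C_arc_analytic_fst op)
  ultimately show ?thesis by (cases "m < l"; cases "m < L") (auto simp: rescale_def)
qed

lemma net_from_layers_C_arc_analytic:
  fixes \<phi> :: "('p::finite, 'd::finite) layer_maps"
  assumes "real_analyticity L lay \<phi> U" "open U" "l \<le> L"
  shows "C_arc_analytic n (\<lambda>p. net_from L lay \<phi> l (fst p) (snd p)) (UNIV \<times> state_dom U l)"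
proof -
  let ?D = "UNIV \<times> state_dom U l :: ((real^'p) \<times> (real^'d)) set"
  have op: "open ?D" by (simp add: open_Times open_state_dom assms(2))
  \<comment> \<open>With threshold 0 no layer is scaled, so the rescaled maps coincide with
    \<open>\<phi>\<close>.\<close>
  have *: "C_arc_analytic n (\<lambda>p. \<phi> m (block lay m (fst (snd p))) (snd (snd p)))
      (UNIV \<times> UNIV \<times> state_dom U m :: (real \<times> (real^'p) \<times> (real^'d)) set)" if "m \<le> L" for m
    using rescale_C_arc_analytic[OF assms(1,2) that, of n 0] by (simp add: rescale_def cong: if_cong)
  have "C_arc_analytic n (\<lambda>p. (0::real, p)) ?D" by (rule C_arc_analytic_linear[OF _ op]) (auto simp: linear_iff)
  then show ?thesis
    using C_arc_analytic_compose[OF op _ net_from_C_arc_analytic[of U l L n "\<lambda>_. \<phi>" lay, OF assms(2,3) *], of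
        "\<lambda>p. (0, p)"]
    by (auto simp: open_Times open_state_dom assms(2))
qed

section \<open>The derivative with respect to the parameters of one layer\<close>

text \<open>\<open>tail_jacobian\<close> in a form whose analyticity in \<open>\<theta>\<close> and
  \<open>u\<close> together is visible: its entries are directional derivatives of one map of the
  pair \<open>(\<theta>, u)\<close>. The two matrices agree on admissible states.\<close>

definition tail_matrix ::
  "nat \<Rightarrow> ('p \<Rightarrow> nat) \<Rightarrow> ('p::finite, 'd::finite) layer_maps \<Rightarrow> nat \<Rightarrow> real^'p \<Rightarrow> (real^'d)^'n \<Rightarrow>
     real^'p^('n::finite \<times> 'd::finite)" where
  "tail_matrix L lay \<phi> l \<theta> u = (\<chi> r j. if lay j = l then
     frechet_derivative (\<lambda>p. net_from L lay \<phi> l (fst p) (snd p)) (at (\<theta>, u $ fst r)) (axis j 1, 0) $ snd r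
         else 0)"

lemma tail_matrix_C_arc_analytic:
  fixes \<phi> :: "('p::finite, 'd::finite) layer_maps"
  assumes "real_analyticity L lay \<phi> U" "open U" "l \<le> L"
  shows "C_arc_analytic n (\<lambda>p. tail_matrix L lay \<phi> l (fst p) (snd p) :: real^'p^('n::finite \<times> 'd))
     (UNIV \<times> {u. \<forall>i. u $ i \<in> state_dom U l})"
  unfolding tail_matrix_def
proof (intro C_arc_analytic_vec)
  let ?D = "UNIV \<times> {u. \<forall>i. u $ i \<in> state_dom U l} :: ((real^'p) \<times> ((real^'d)^'n)) set"
  show op: "open ?D"
    by (intro open_Times open_vec_pi open_state_dom assms(2) open_UNIV)
  then show "open ?D" .
  fix r :: "'n \<times> 'd" and j :: 'p
  have d: "C_arc_analytic n (\<lambda>q. frechet_derivative (\<lambda>p. net_from L lay \<phi> l (fst p) (snd p)) (at q) (axis j 1,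
      0))
     (UNIV \<times> state_dom U l)"
    using net_from_layers_C_arc_analytic[OF assms, of "Suc n"] by (rule C_arc_analytic_Suc_derivative)
  have g: "C_arc_analytic n (\<lambda>p. (fst p, snd p $ fst r)) ?D"
    by (rule C_arc_analytic_linear[OF _ op]) (auto simp: linear_iff)
  have "C_arc_analytic n (\<lambda>p. frechet_derivative (\<lambda>p. net_from L lay \<phi> l (fst p) (snd p))
      (at (fst p, snd p $ fst r)) (axis j 1, 0)) ?D"
    by (rule C_arc_analytic_compose[OF op _ d g]) (auto simp: open_Times open_state_dom assms(2))
  then show "C_arc_analytic n (\<lambda>p. if lay j = l then frechet_derivative (\<lambda>p. net_from L lay \<phi> l (fst p) (snd p))
      (at (fst p, snd p $ fst r)) (axis j 1, 0) $ snd r else 0) ?D"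
    by (cases "lay j = l") (simp_all add: C_arc_analytic_nth[OF op])
qed

text \<open>Chain rule for the affine map \<open>mix\<close>, whose derivative \<open>pr\<close>
  keeps the coordinates of layer \<open>l\<close> and kills all others.\<close>

lemma tail_jacobian_eq:
  fixes \<phi> :: "('p::finite, 'd::finite) layer_maps"
  assumes "real_analyticity L lay \<phi> U" "open U" "l \<le> L" "\<And>i. u $ i \<in> state_dom U l"
  shows "tail_jacobian L lay \<phi> l \<theta> u = tail_matrix L lay \<phi> l \<theta> u"
proof -
  let ?N = "\<lambda>p. net_from L lay \<phi> l (fst p) (snd p)"
  define mix where "mix t = (\<chi> j. if lay j = l then t $ j else \<theta> $ j)" for t :: "real^'p"
  define pr where "pr t = (\<chi> j. if lay j = l then t $ j else 0)" for t :: "real^'p"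
  have "linear pr" by (auto simp: linear_iff pr_def vec_eq_iff)
  then have dpr: "(pr has_derivative pr) (at \<theta>)" by (rule linear_imp_has_derivative)
  have mix: "mix = (\<lambda>t. mix 0 + pr t)" by (auto simp: mix_def pr_def vec_eq_iff)
  have "(mix has_derivative pr) (at \<theta>)"
    by (subst mix) (use has_derivative_add[OF has_derivative_const[of "mix 0"] dpr] in simp)
  then have dm: "((\<lambda>t. (mix t, u $ i)) has_derivative (\<lambda>h. (pr h, 0))) (at \<theta>)" for i
    by (intro has_derivative_Pair has_derivative_const)
  have "mix \<theta> = \<theta>" by (simp add: mix_def vec_eq_iff)
  then have "(?N has_derivative frechet_derivative ?N (at (\<theta>, u $ i))) (at (mix \<theta>, u $ i))" for i
    using C_arc_analytic_Suc_has_derivative[OF net_from_layers_C_arc_analytic[OF assms(1-3), of "Suc 0"], of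
        "(\<theta>, u $ i)"] assms(4) by simp
  from has_derivative_compose[OF dm this]
  have d: "((\<lambda>t. net_from L lay \<phi> l (mix t) (u $ i)) has_derivative
     (\<lambda>h. frechet_derivative ?N (at (\<theta>, u $ i)) (pr h, 0))) (at \<theta>)" for i by simp
  have "frechet_derivative ?N (at (\<theta>, u $ i)) (pr (axis j 1), 0) = (if lay j = l then frechet_derivative ?N
      (at (\<theta>, u $ i)) (axis j 1, 0) else 0)" for i j
  proof (cases "lay j = l")
    case True
    then have "pr (axis j 1) = axis j 1" by (auto simp: pr_def axis_def vec_eq_iff)
    with True show ?thesis by simp
  next
    case False
    then have "pr (axis j 1) = 0" by (auto simp: pr_def axis_def vec_eq_iff)
    moreover have "frechet_derivative ?N (at (\<theta>, u $ i)) (0, 0) = 0"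
      using C_arc_analytic_Suc_has_derivative[OF net_from_layers_C_arc_analytic[OF assms(1-3), of "Suc 0"], of
          "(\<theta>, u $ i)"] assms(4)
      by (simp add: has_derivative_linear linear_0 flip: zero_prod_def)
    ultimately show ?thesis using False by simp
  qed
  then show ?thesis
    unfolding tail_jacobian_def vstack_def tail_matrix_def jacobian_def mix_def[symmetric]
      frechet_derivative_at[OF d, symmetric]
    by (simp add: matrix_def vec_eq_iff)
qed

lemma propagate_add:
  "propagate lay \<phi> \<theta> l x (a + b) = propagate lay \<phi> \<theta> (l + a) (propagate lay \<phi> \<theta> l x a) b"
  by (induction b) (auto simp: add.assoc)

lemma propagate_cong:
  assumes "\<And>m v. l \<le> m \<Longrightarrow> m < l + k \<Longrightarrow> \<phi> m (block lay m \<theta>) v = \<phi>' m (block lay m \<theta>') v"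
  shows "propagate lay \<phi> \<theta> l x k = propagate lay \<phi>' \<theta>' l x k"
  using assms by (induction k) auto

lemma net_from_cong:
  assumes "\<And>m v. l \<le> m \<Longrightarrow> m \<le> L \<Longrightarrow> \<phi> m (block lay m \<theta>) v = \<phi>' m (block lay m \<theta>') v" "l \<le> L"
  shows "net_from L lay \<phi> l \<theta> u = net_from L lay \<phi>' l \<theta>' u"
proof -
  have "propagate lay \<phi> \<theta> l u (L - l) = propagate lay \<phi>' \<theta>' l u (L - l)"
    using assms by (intro propagate_cong) auto
  then show ?thesis unfolding net_from_def using assms by simp
qed

text \<open>Varying a parameter of layer \<open>l\<close> leaves the hidden state at layer
  \<open>l\<close> unchanged, so the derivative of the whole network is that of its tail, taken at
  this state. From layer \<open>l\<close> on, \<open>\<psi>\<close> and \<open>\<phi>\<close> have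
  the same layer maps.\<close>

lemma net_jacobian_column:
  fixes \<phi> \<psi> :: "('p::finite, 'd::finite) layer_maps"
  assumes an: "real_analyticity L lay \<phi> U" "open U" "l \<le> L" and lj: "lay j = l"
    and eq: "\<And>m. l \<le> m \<Longrightarrow> \<psi> m = \<phi> m"
    and diff: "\<And>i. (\<lambda>t. net L lay \<psi> t (X $ i)) differentiable (at \<theta>)"
    and dom: "\<And>i. propagate lay \<psi> \<theta> 0 (X $ i) l \<in> state_dom U l"
  shows "net_jacobian L lay \<psi> X \<theta> $ r $ j =
    tail_matrix L lay \<phi> l \<theta> (\<chi> i. propagate lay \<psi> \<theta> 0 (X $ i) l) $ r $ j"
proof -
  let ?N = "\<lambda>p. net_from L lay \<phi> l (fst p) (snd p)"
  obtain i k where r: "r = (i, k)" by fastforce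
  let ?u = "propagate lay \<psi> \<theta> 0 (X $ i) l" and ?f = "\<lambda>t. net L lay \<psi> t (X $ i)"
  have "(?f has_derivative frechet_derivative ?f (at \<theta>)) (at \<theta>)"
    using diff by (simp add: frechet_derivative_works)
  then have 1: "((\<lambda>t. ?f (\<theta> + t *\<^sub>R axis j 1)) has_vector_derivative frechet_derivative ?f (at \<theta>) (axis j 1))
      (at 0)"
    by (rule has_derivative_line)
  have "(?N has_derivative frechet_derivative ?N (at (\<theta>, ?u))) (at (\<theta>, ?u))"
    using C_arc_analytic_Suc_has_derivative[OF net_from_layers_C_arc_analytic[OF an, of "Suc 0"]] dom by auto
  from has_derivative_line[OF this, of "(axis j 1, 0)"]
  have 2: "((\<lambda>t. net_from L lay \<phi> l (\<theta> + t *\<^sub>R axis j 1) ?u) has_vector_derivative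
     frechet_derivative ?N (at (\<theta>, ?u)) (axis j 1, 0)) (at 0)" by simp
  have "?f (\<theta> + t *\<^sub>R axis j 1) = net_from L lay \<phi> l (\<theta> + t *\<^sub>R axis j 1) ?u" for t
  proof -
    have "?u = propagate lay \<psi> (\<theta> + t *\<^sub>R axis j 1) 0 (X $ i) l"
      using lj by (intro propagate_cong arg_cong2[where f="\<psi> _"]) (auto simp: block_def vec_eq_iff axis_def)
    then have "?f (\<theta> + t *\<^sub>R axis j 1) = net_from L lay \<psi> l (\<theta> + t *\<^sub>R axis j 1) ?u"
      unfolding net_def net_from_def
      using propagate_add[of lay \<psi> "\<theta> + t *\<^sub>R axis j 1" 0 "X $ i" l "L - l"] an(3) by simp
    also have "\<dots> = net_from L lay \<phi> l (\<theta> + t *\<^sub>R axis j 1) ?u"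
      using an(3) eq by (intro net_from_cong) auto
    finally show ?thesis .
  qed
  then have "frechet_derivative ?f (at \<theta>) (axis j 1) = frechet_derivative ?N (at (\<theta>, ?u)) (axis j 1, 0)"
    using 1 2 vector_derivative_unique_at by auto
  then show ?thesis
    by (simp add: net_jacobian_def vstack_def jacobian_def matrix_def tail_matrix_def r lj)
qed

text \<open>The columns of layer \<open>l\<close> already suffice: a vector killed by the transposed
  full Jacobian is killed by \<open>transpose T\<close>, hence is zero.\<close>

lemma mu_low_pos:
  fixes \<phi> \<psi> :: "('p::finite, 'd::finite) layer_maps"
  assumes "real_analyticity L lay \<phi> U" "open U" "l \<le> L"
    and "\<And>m. l \<le> m \<Longrightarrow> \<psi> m = \<phi> m"
    and "\<And>i. (\<lambda>t. net L lay \<psi> t (X $ i)) differentiable (at \<theta>)"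
    and "\<And>i. propagate lay \<psi> \<theta> 0 (X $ i) l \<in> state_dom U l"
    and "det (T ** transpose T) \<noteq> 0" "T = tail_matrix L lay \<phi> l \<theta> (\<chi> i. propagate lay \<psi> \<theta> 0 (X $ i) l)"
  shows "mu_low L lay \<psi> X \<theta> > 0"
  unfolding mu_low_def
proof (rule lambda_min_gram_pos)
  fix w assume w: "transpose (net_jacobian L lay \<psi> X \<theta>) *v w = 0"
  have "(transpose T *v w) $ j = 0" for j
  proof (cases "lay j = l")
    case True
    have "(transpose T *v w) $ j = (transpose (net_jacobian L lay \<psi> X \<theta>) *v w) $ j"
      using net_jacobian_column[OF assms(1-3) True assms(4-6)] assms(8)
      by (simp add: matrix_vector_mult_def transpose_def)
    then show ?thesis using w by simp
  next
    case False
    then show ?thesis by (simp add: assms(8) tail_matrix_def matrix_vector_mult_def transpose_def)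
  qed
  then have "transpose T *v w = 0" by (simp add: vec_eq_iff)
  then show "w = 0" using assms(7) unfolding det_gram_nz_iff by blast
qed

lemma C_arc_analytic_gram:
  fixes f :: "'a::euclidean_space \<Rightarrow> real^'m^'r"
  assumes "open D" "C_arc_analytic n f D"
  shows "C_arc_analytic n (\<lambda>x. det (f x ** transpose (f x))) D"
  unfolding matrix_matrix_mult_def transpose_def
  by (intro C_arc_analytic_det assms C_arc_analytic_vec C_arc_analytic_sum) (simp, intro C_arc_analytic_mult
      C_arc_analytic_nth assms)

text \<open>A product of Lebesgue measures is not the zero measure, so the almost-everywhere
  condition holds for at least one \<open>\<omega>\<close>. One parameter is enough, since
  analyticity spreads nonvanishing from a point to almost everywhere.\<close>

lemma nonlinear_architectureE:
  fixes \<phi> :: "('p::finite, 'd::finite) layer_maps"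
  assumes "nonlinear_architecture TYPE('n::finite) L lay \<phi> U" "real_analyticity L lay \<phi> U" "open U"
  obtains l \<theta> where "l < L"
    "\<And>C :: 'n \<Rightarrow> (real^'d) set. (\<And>i. C i \<in> components (state_dom U l)) \<Longrightarrow>
      \<exists>u :: (real^'d)^'n. (\<forall>i. u $ i \<in> C i) \<and>
        det (tail_matrix L lay \<phi> l \<theta> u ** transpose (tail_matrix L lay \<phi> l \<theta> u)) \<noteq> 0"
proof -
  obtain l where l: "l < L" "AE \<omega> in (\<Pi>\<^sub>M j\<in>{j. l \<le> lay j}. lborel).
     \<forall>C :: 'n \<Rightarrow> (real^'d) set. (\<forall>i. C i \<in> components (state_dom U l)) \<longrightarrow>
       (\<exists>u :: (real^'d)^'n. (\<forall>i. u $ i \<in> C i) \<and>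
          rank (tail_jacobian L lay \<phi> l (\<chi> j. if l \<le> lay j then \<omega> j else 0) u)
            = CARD('n) * CARD('d))"
    using assms(1) unfolding nonlinear_architecture_def by blast
  let ?M = "\<Pi>\<^sub>M j\<in>{j. l \<le> lay j}. (lborel :: real measure)"
  interpret product_sigma_finite "\<lambda>_ :: 'p. lborel :: real measure" by standard
  have "emeasure ?M (space ?M) = (\<Prod>j\<in>{j. l \<le> lay j}. emeasure (lborel :: real measure) UNIV)"
    using emeasure_PiM[of "{j. l \<le> lay j}" "\<lambda>_. UNIV"] by (simp add: space_PiM)
  also have "\<dots> \<noteq> 0" by (simp add: prod_zero_iff)
  finally have "ae_filter ?M \<noteq> bot" by (simp add: ae_filter_eq_bot_iff)
  from eventually_happens'[OF this l(2)] obtain \<omega> where \<omega>: 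
    "\<And>C :: 'n \<Rightarrow> (real^'d) set. (\<forall>i. C i \<in> components (state_dom U l)) \<Longrightarrow>
       (\<exists>u :: (real^'d)^'n. (\<forall>i. u $ i \<in> C i) \<and>
          rank (tail_jacobian L lay \<phi> l (\<chi> j. if l \<le> lay j then \<omega> j else 0) u)
            = CARD('n) * CARD('d))"
    by blast
  let ?\<theta> = "\<chi> j. if l \<le> lay j then \<omega> j else 0"
  show thesis
  proof (rule that[OF l(1), of ?\<theta>])
    fix C :: "'n \<Rightarrow> (real^'d) set" assume C: "\<And>i. C i \<in> components (state_dom U l)"
    then obtain u :: "(real^'d)^'n" where u: "\<And>i. u $ i \<in> C i"
      "rank (tail_jacobian L lay \<phi> l ?\<theta> u) = CARD('n) * CARD('d)"
      using \<omega> by blast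
    have "u $ i \<in> state_dom U l" for i using u(1) C in_components_subset by blast
    then have "tail_jacobian L lay \<phi> l ?\<theta> u = tail_matrix L lay \<phi> l ?\<theta> u"
      using assms(2,3) l(1) by (intro tail_jacobian_eq) auto
    then have "det (tail_matrix L lay \<phi> l ?\<theta> u ** transpose (tail_matrix L lay \<phi> l ?\<theta> u)) \<noteq> 0"
      unfolding det_gram_nz_iff_rank using u(2) by simp
    then show "\<exists>u :: (real^'d)^'n. (\<forall>i. u $ i \<in> C i) \<and>
        det (tail_matrix L lay \<phi> l ?\<theta> u ** transpose (tail_matrix L lay \<phi> l ?\<theta> u)) \<noteq> 0"
      using u(1) by blast
  qed
qed

lemma C_arc_analytic_slice:
  assumes "open D" "C_arc_analytic n f D"
  shows "C_arc_analytic n (\<lambda>y. f (x, y)) {y. (x, y) \<in> D}"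
proof -
  have op: "open {y. (x, y) \<in> D}"
    using open_vimage[OF assms(1), of "\<lambda>y. (x, y)"] by (simp add: vimage_def continuous_intros)
  show ?thesis
    by (rule C_arc_analytic_compose[OF op assms C_arc_analytic_Pair[OF op C_arc_analytic_const
        C_arc_analytic_linear[OF _ op, of "\<lambda>y. y"]]]) (auto simp: linear_iff)
qed

lemma C_arc_analytic_slice':
  assumes "open D" "C_arc_analytic n f D"
  shows "C_arc_analytic n (\<lambda>x. f (x, y)) {x. (x, y) \<in> D}"
proof -
  have op: "open {x. (x, y) \<in> D}"
    using open_vimage[OF assms(1), of "\<lambda>x. (x, y)"] by (simp add: vimage_def continuous_intros)
  show ?thesis
    by (rule C_arc_analytic_compose[OF op assms C_arc_analytic_Pair[OF op C_arc_analytic_linear[OF _ op, of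
        "\<lambda>y. y"] C_arc_analytic_const]]) (auto simp: linear_iff)
qed

lemma net_C_arc_analytic:
  fixes \<phi> :: "('p::finite, 'd::finite) layer_maps"
  assumes "real_analyticity L lay \<phi> U" "open U" "x \<in> U"
  shows "C_arc_analytic n (\<lambda>\<theta>. net L lay (rescale L (\<lambda>m. if m < l then s else 1) \<phi>) \<theta> x) UNIV"
proof -
  let ?D = "UNIV \<times> UNIV \<times> state_dom U 0 :: (real \<times> (real^'p) \<times> (real^'d)) set"
  have op: "open ?D" by (simp add: open_Times open_state_dom assms(2))
  have 1: "C_arc_analytic n (\<lambda>p. net_from L lay (rescale L (\<lambda>m. if m < l then fst p else 1) \<phi>) 0 (fst (snd p))
      (snd (snd p))) ?D"
    using rescale_C_arc_analytic[OF assms(1,2)]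
    by (intro net_from_C_arc_analytic[of U 0 L n "\<lambda>s. rescale L (\<lambda>m. if m < l then s else 1) \<phi>"] assms(2)) auto
  have 2: "C_arc_analytic n (\<lambda>\<theta>. (s, \<theta>, x)) (UNIV :: (real^'p) set)"
    by (intro C_arc_analytic_Pair C_arc_analytic_const C_arc_analytic_linear) (auto simp: linear_iff)
  show ?thesis
    using C_arc_analytic_compose[OF open_UNIV op 1 2] assms(3)
    by (simp add: net_def state_dom_def cong: if_cong)
qed

section \<open>Choice of the scale factor and the exceptional null set\<close>

lemma C_arc_analytic_zeros_negligible:
  fixes g :: "'a::euclidean_space \<Rightarrow> real"
  assumes "open D" "connected D" "C_arc_analytic (Suc n) g D" "p0 \<in> D" "g p0 \<noteq> 0"
  shows "negligible {p \<in> D. g p = 0}"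
  using arc_analytic_zeros_negligible[OF assms(1,2) C_arc_analytic_continuous_on[OF assms(3)]
      C_arc_analytic_arc[OF assms(3)] assms(4,5)] .

lemma C_arc_analytic_real_zeros_sparse:
  fixes g :: "real \<Rightarrow> real"
  assumes "C_arc_analytic n g UNIV" "g t0 \<noteq> 0"
  shows "{t. g t = 0} sparse_in UNIV"
proof (rule ranalytic_at_zeros_sparse[where g=g, OF open_UNIV connected_UNIV _ UNIV_I assms(2)])
  fix t
  show "ranalytic_at g t" using C_arc_analytic_arc[OF assms(1)] ranalytic_at_ident[of t] unfolding
      arc_analytic_def by force
qed

text \<open>The exceptional set is formed in the product space of parameters and inputs, so that one
  null set can be sliced in either order.\<close>

lemma mu_low_null_set:
  fixes \<phi> :: "('p::finite, 'd::finite) layer_maps"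
  assumes U: "open U" and an: "real_analyticity L lay \<phi> U"
    and arch: "nonlinear_architecture TYPE('n::finite) L lay \<phi> U" and \<tau>: "\<tau> > 0"
  obtains l s where "\<bar>s - 1\<bar> < \<tau>"
    "negligible {p :: (real^'p) \<times> ((real^'d)^'n). (\<forall>i. snd p $ i \<in> U) \<and>
       \<not> mu_low L lay (rescale L (\<lambda>m. if m < l then s else 1) \<phi>) (snd p) (fst p) > 0}"
proof -
  obtain l \<theta>0 where l: "l < L" and full: 
    "\<And>C :: 'n \<Rightarrow> (real^'d) set. (\<And>i. C i \<in> components (state_dom U l)) \<Longrightarrow>
      \<exists>u :: (real^'d)^'n. (\<forall>i. u $ i \<in> C i) \<and>
        det (tail_matrix L lay \<phi> l \<theta>0 u ** transpose (tail_matrix L lay \<phi> l \<theta>0 u)) \<noteq> 0"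
    by (rule nonlinear_architectureE[OF arch an U]) blast
  define \<psi> where "\<psi> s = rescale L (\<lambda>m. if m < l then s else 1) \<phi>" for s
  \<comment> \<open>The hidden states that enter layer \<open>l\<close>, as a function of scale,
    parameter and inputs.\<close>
  define P where "P q = (\<chi> i. propagate lay (\<psi> (fst q)) (fst (snd q)) 0 (snd (snd q) $ i) l)"
    for q :: "real \<times> (real^'p) \<times> ((real^'d)^'n)"
  define h where "h p = det (tail_matrix L lay \<phi> l (fst p) (snd p) ** transpose (tail_matrix L lay \<phi> l (fst p)
      (snd p)))"
    for p :: "(real^'p) \<times> ((real^'d)^'n)"
  define H where "H q = h (fst (snd q), P q)" for q
  \<comment> \<open>\<open>U\<close> may be disconnected, so each data point gets its own component;
    the zero-set argument runs on each connected product \<open>Q C\<close>.\<close>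
  define K where "K = {C :: 'n \<Rightarrow> (real^'d) set. \<forall>i. C i \<in> components U}"
  define Q where "Q C = {X :: (real^'d)^'n. \<forall>i. X $ i \<in> C i}" for C
  have opU: "open (Q (\<lambda>_. state_dom U m))" for m
    unfolding Q_def by (intro open_vec_pi open_state_dom U)
  have opD: "open (UNIV \<times> UNIV \<times> Q (\<lambda>_. state_dom U 0) :: (real \<times> (real^'p) \<times> ((real^'d)^'n)) set)"
    by (intro open_Times open_UNIV opU)
  have Pdom: "P q $ i \<in> state_dom U l" if "q \<in> UNIV \<times> UNIV \<times> Q (\<lambda>_. state_dom U 0)" for q i
    using that by (cases "l = 0") (auto simp: P_def Q_def state_dom_def)
  have h_an: "C_arc_analytic n h (UNIV \<times> Q (\<lambda>_. state_dom U l))" for n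
    unfolding h_def Q_def
    using l by (intro C_arc_analytic_gram tail_matrix_C_arc_analytic an U open_Times open_UNIV opU[unfolded
        Q_def]) auto
  have H_an: "C_arc_analytic n H (UNIV \<times> UNIV \<times> Q (\<lambda>_. state_dom U 0))" for n
  proof -
    have "C_arc_analytic n (\<lambda>q. propagate lay (\<psi> (fst q)) (fst (snd q)) 0 (snd (snd q) $ i) l)
       (UNIV \<times> UNIV \<times> Q (\<lambda>_. state_dom U 0))" for i
    proof -
      have 1: "C_arc_analytic n (\<lambda>p. propagate lay (\<psi> (fst p)) (fst (snd p)) 0 (snd (snd p)) l) (UNIV \<times> UNIV \<times>
          state_dom U 0)"
        unfolding \<psi>_def using l
        by (intro propagate_C_arc_analytic[of U 0 l n "\<lambda>s. rescale L (\<lambda>m. if m < l then s else 1) \<phi>"] U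
            rescale_C_arc_analytic an) auto
      have 2: "C_arc_analytic n (\<lambda>q. (fst q, fst (snd q), snd (snd q) $ i)) (UNIV \<times> UNIV \<times> Q (\<lambda>_. state_dom U 0)
          :: (real \<times> (real^'p) \<times> ((real^'d)^'n)) set)"
        by (rule C_arc_analytic_linear[OF _ opD]) (auto simp: linear_iff)
      from C_arc_analytic_compose[OF opD _ 1 2] show ?thesis
        by (auto simp: Q_def open_Times open_state_dom U)
    qed
    then have "C_arc_analytic n P (UNIV \<times> UNIV \<times> Q (\<lambda>_. state_dom U 0))"
      unfolding P_def by (intro C_arc_analytic_vec opD)
    moreover have "C_arc_analytic n (\<lambda>q. fst (snd q)) (UNIV \<times> UNIV \<times> Q (\<lambda>_. state_dom U 0) :: (real \<times>
        (real^'p) \<times> ((real^'d)^'n)) set)"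
      by (rule C_arc_analytic_linear[OF _ opD]) (auto simp: linear_iff)
    ultimately have 1: "C_arc_analytic n (\<lambda>q. (fst (snd q), P q)) (UNIV \<times> UNIV \<times> Q (\<lambda>_. state_dom U 0))"
      by (intro C_arc_analytic_Pair opD)
    have op: "open (UNIV \<times> Q (\<lambda>_. state_dom U l) :: ((real^'p) \<times> ((real^'d)^'n)) set)"
      by (intro open_Times open_UNIV opU)
    show ?thesis
      unfolding H_def
      by (rule C_arc_analytic_compose[OF opD op h_an 1]) (use Pdom in \<open>auto simp: Q_def\<close>)
  qed
  have P0: "P (0, \<theta>, X) = X" for \<theta> X
  proof -
    have "propagate lay (\<psi> 0) \<theta> 0 x k = x" if "k \<le> l" for x k
      using that l by (induction k) (auto simp: \<psi>_def rescale_def)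
    then show ?thesis by (simp add: P_def vec_eq_iff)
  qed
  have opQ: "open (Q C)" and conQ: "connected (Q C)" and subQ: "Q C \<subseteq> Q (\<lambda>_. state_dom U 0)" if "C \<in> K" for C
  proof -
    have C: "open (C i)" "connected (C i)" "C i \<subseteq> U" for i
      using that open_components[OF U] in_components_connected in_components_subset unfolding K_def by blast+
    show "open (Q C)" "connected (Q C)"
      unfolding Q_def using C by (intro open_vec_pi connected_vec_pi; simp)+
    show "Q C \<subseteq> Q (\<lambda>_. state_dom U 0)"
      using C(3) by (auto simp: Q_def state_dom_def)
  qed
  \<comment> \<open>For \<open>l = 0\<close> the architecture condition supplies a tuple in each
    product of components of \<open>U\<close>. For \<open>l > 0\<close> it supplies one tuple
    somewhere in the whole space; the zeros of \<open>h (\<theta>0, -)\<close> are then negligible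
    there and cannot cover the nonempty open set \<open>Q C\<close>.\<close>
  have start: "\<exists>X\<in>Q C. H (0, \<theta>0, X) \<noteq> 0" if C: "C \<in> K" for C
  proof (cases "l = 0")
    case True
    then show ?thesis
      using full[of C] C by (auto simp: H_def P0 h_def Q_def K_def state_dom_def)
  next
    case False
    then obtain u where u: "h (\<theta>0, u) \<noteq> 0"
      using full[of "\<lambda>_. UNIV"] by (auto simp: h_def state_dom_def)
    have "C_arc_analytic (Suc 0) (\<lambda>u. h (\<theta>0, u)) UNIV"
      using C_arc_analytic_slice[OF _ h_an, of "Suc 0" \<theta>0] False by (simp add: Q_def state_dom_def)
    then have neg: "negligible {u \<in> UNIV. h (\<theta>0, u) = 0}"
      using u by (intro C_arc_analytic_zeros_negligible[of UNIV 0 _ u]) auto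
    have "C i \<noteq> {}" for i using C in_components_nonempty unfolding K_def by blast
    then have "(\<chi> i. SOME x. x \<in> C i) \<in> Q C" by (simp add: Q_def some_in_eq)
    then have "\<not> negligible (Q C)" using open_not_negligible[OF opQ[OF C]] by blast
    then have "\<not> Q C \<subseteq> {u \<in> UNIV. h (\<theta>0, u) = 0}" using neg negligible_subset by blast
    then show ?thesis by (auto simp: H_def P0)
  qed
  then obtain X0 where X0: "\<And>C. C \<in> K \<Longrightarrow> X0 C \<in> Q C \<and> H (0, \<theta>0, X0 C) \<noteq> 0" by metis
  have "countable (components U)"
  proof (rule countable_disjoint_open_subsets)
    show "pairwise disjnt (components U)"
      using pairwise_disjoint_components[of U] by (simp add: pairwise_def disjnt_def)
  qed (use open_components[OF U] in blast)
  then have K: "countable K"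
    using countable_PiE[of UNIV "\<lambda>_ :: 'n. components U"] by (simp add: K_def PiE_def Pi_def)
  have "countable {s. H (s, \<theta>0, X0 C) = 0}" if C: "C \<in> K" for C
  proof -
    have "C_arc_analytic 0 (\<lambda>s. H (s, \<theta>0, X0 C)) UNIV"
      using C_arc_analytic_slice'[OF opD H_an, of 0 "(\<theta>0, X0 C)"] X0[OF C] subQ[OF C] by auto
    then have "{s. H (s, \<theta>0, X0 C) = 0} sparse_in UNIV"
      by (rule C_arc_analytic_real_zeros_sparse) (use X0 C in blast)
    then show ?thesis using sparse_imp_countable[OF open_UNIV] by auto
  qed
  \<comment> \<open>Each family in \<open>K\<close> excludes countably many scales, and
    \<open>K\<close> is countable because disjoint open sets are; an open interval around 1 is
    uncountable, so some scale survives for all families at once.\<close>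
  then have "countable (\<Union>C\<in>K. {s. H (s, \<theta>0, X0 C) = 0})" using K by blast
  moreover have "uncountable {1 - \<tau><..<1 + \<tau>}" using \<tau> by (simp add: uncountable_open_interval)
  ultimately have "\<not> {1 - \<tau><..<1 + \<tau>} \<subseteq> (\<Union>C\<in>K. {s. H (s, \<theta>0, X0 C) = 0})"
    using countable_subset by metis
  then obtain s where s: "s \<in> {1 - \<tau><..<1 + \<tau>}" "\<And>C. C \<in> K \<Longrightarrow> H (s, \<theta>0, X0 C) \<noteq> 0"
    by blast
  have "negligible {p \<in> UNIV \<times> Q C. H (s, p) = 0}" if C: "C \<in> K" for C
  proof (rule C_arc_analytic_zeros_negligible[of _ 0 _ "(\<theta>0, X0 C)"])
    show "open (UNIV \<times> Q C :: ((real^'p) \<times> _) set)" using opQ[OF C] by (simp add: open_Times)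
    show "connected (UNIV \<times> Q C :: ((real^'p) \<times> _) set)" by (intro connected_Times connected_UNIV conQ C)
    show "C_arc_analytic (Suc 0) (\<lambda>p. H (s, p)) (UNIV \<times> Q C)"
      by (rule C_arc_analytic_subset[OF C_arc_analytic_slice[OF opD H_an]]) (use subQ[OF C] in auto)
  qed (use X0[OF C] s(2)[OF C] in auto)
  then have "negligible (\<Union>C\<in>K. {p \<in> UNIV \<times> Q C. H (s, p) = 0})"
    using K by (intro negligible_countable_Union) auto
  moreover have "{p :: (real^'p) \<times> ((real^'d)^'n). (\<forall>i. snd p $ i \<in> U) \<and> \<not> mu_low L lay (\<psi> s) (snd p) (fst p)
      > 0}
     \<subseteq> (\<Union>C\<in>K. {p \<in> UNIV \<times> Q C. H (s, p) = 0})"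
  proof
    fix p :: "(real^'p) \<times> ((real^'d)^'n)"
    assume "p \<in> {p. (\<forall>i. snd p $ i \<in> U) \<and> \<not> mu_low L lay (\<psi> s) (snd p) (fst p) > 0}"
    then have p: "\<And>i. snd p $ i \<in> U" "\<not> mu_low L lay (\<psi> s) (snd p) (fst p) > 0" by auto
    have "H (s, p) = 0"
    proof (rule ccontr)
      assume nz: "H (s, p) \<noteq> 0"
      have "mu_low L lay (\<psi> s) (snd p) (fst p) > 0"
      proof (rule mu_low_pos[OF an U less_imp_le[OF l]])
        show "\<psi> s m = \<phi> m" if "l \<le> m" for m using that by (simp add: \<psi>_def rescale_def fun_eq_iff)
        show "(\<lambda>t. net L lay (\<psi> s) t (snd p $ i)) differentiable (at (fst p))" for i
          using C_arc_analytic_Suc_has_derivative[OF net_C_arc_analytic[OF an U p(1)[of i], of "Suc 0" l s]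
              UNIV_I]
          unfolding \<psi>_def differentiable_def by blast
        show "propagate lay (\<psi> s) (fst p) 0 (snd p $ i) l \<in> state_dom U l" for i
          using Pdom[of "(s, p)" i] p(1) by (simp add: P_def Q_def state_dom_def mem_Times_iff)
      qed (use nz in \<open>auto simp: H_def h_def P_def\<close>)
      then show False using p(2) by blast
    qed
    \<comment> \<open>The products in \<open>K\<close> cover all admissible inputs: each data point
      lies in its own component.\<close>
    moreover have "(\<lambda>i. connected_component_set U (snd p $ i)) \<in> K"
      using p(1) by (auto simp: K_def components_def)
    moreover have "snd p \<in> Q (\<lambda>i. connected_component_set U (snd p $ i))"
      using p(1) by (simp add: Q_def)
    ultimately show "p \<in> (\<Union>C\<in>K. {p \<in> UNIV \<times> Q C. H (s, p) = 0})"
      by (auto simp: mem_Times_iff)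
  qed
  ultimately have "negligible {p :: (real^'p) \<times> ((real^'d)^'n). (\<forall>i. snd p $ i \<in> U) \<and>
      \<not> mu_low L lay (\<psi> s) (snd p) (fst p) > 0}"
    by (rule negligible_subset)
  moreover have "\<bar>s - 1\<bar> < \<tau>" using s(1) by (auto simp: abs_less_iff)
  ultimately show thesis unfolding \<psi>_def by (intro that[of s l])
qed

section \<open>Gradient descent\<close>

text \<open>Riesz representation in coordinates. Existence and uniqueness of the representing vector
  unlock the description operator in \<open>gradient\<close>.\<close>

lemma
  fixes f :: "real^'p \<Rightarrow> real"
  assumes "(f has_derivative f') (at x)"
  shows gradient_eq_sum: "gradient f x = (\<Sum>b\<in>Basis. f' b *\<^sub>R b)"
    and inner_gradient: "h \<bullet> gradient f x = f' h"
proof -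
  let ?D = "\<Sum>b\<in>Basis. f' b *\<^sub>R b"
  have lin: "linear f'" using assms has_derivative_linear by blast
  have inner: "h \<bullet> ?D = f' h" for h
  proof -
    have "f' (\<Sum>b\<in>Basis. (h \<bullet> b) *\<^sub>R b) = (\<Sum>b\<in>Basis. (h \<bullet> b) * f' b)"
      using lin by (simp add: linear_sum linear_scale)
    then show ?thesis by (simp add: euclidean_representation inner_sum_right mult.commute)
  qed
  then have D: "GDERIV f x :> ?D" using assms by (simp add: gderiv_def)
  have "D = ?D" if "GDERIV f x :> D" for D
  proof -
    have "(\<lambda>h. h \<bullet> D) = (\<lambda>h. h \<bullet> ?D)"
      using that D unfolding gderiv_def by (rule has_derivative_unique)
    then show ?thesis by (metis vector_eq_ldot)
  qed
  then show "gradient f x = ?D" unfolding gradient_def using D by blast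
  then show "h \<bullet> gradient f x = f' h" using inner by simp
qed

lemma C_arc_analytic_gradient:
  fixes f :: "real^'p \<Rightarrow> real"
  assumes "C_arc_analytic (Suc n) f UNIV"
  shows "C_arc_analytic n (gradient f) UNIV"
proof -
  have "gradient f = (\<lambda>x. \<Sum>b\<in>Basis. frechet_derivative f (at x) b *\<^sub>R b)"
    using gradient_eq_sum[OF C_arc_analytic_Suc_has_derivative[OF assms UNIV_I]] by blast
  then show ?thesis
    using assms by (auto intro!: C_arc_analytic_sum C_arc_analytic_scaleR C_arc_analytic_const
        C_arc_analytic_Suc_derivative)
qed

text \<open>One level of differentiability of \<open>g\<close> is spent on the derivative that
  enters \<open>M\<close>; the other makes this derivative, and with it
  \<open>det (M \<eta> \<theta>)\<close>, continuous.\<close>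

lemma negligible_preimage_gradient_step:
  fixes g :: "real^'p \<Rightarrow> real^'p"
  assumes g: "C_arc_analytic (Suc (Suc 0)) g UNIV"
  obtains E where "finite E"
    "\<And>\<eta> N. \<eta> \<in> {0<..1} - E \<Longrightarrow> negligible N \<Longrightarrow> negligible {\<theta>. \<theta> - \<eta> *\<^sub>R g \<theta> \<in> N}"
proof -
  \<comment> \<open>The matrix of I - \<open>\<eta>\<close> Dg(\<open>\<theta>\<close>), assembled
    from its columns by operations covered by the closure rules.\<close>
  define M where "M \<eta> \<theta> = (\<chi> i j. (axis j 1 + (- \<eta>) *\<^sub>R frechet_derivative g (at \<theta>) (axis j 1)) $ i)" for \<eta> \<theta>
  have dg: "C_arc_analytic (Suc 0) (\<lambda>\<theta>. frechet_derivative g (at \<theta>) v) UNIV" for v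
    using g by (rule C_arc_analytic_Suc_derivative)
  have "linear (\<lambda>\<eta>::real. - \<eta>)" by (auto simp: linear_iff)
  then have "C_arc_analytic 0 (\<lambda>\<eta>. det (M \<eta> 0)) UNIV"
    unfolding M_def by (intro C_arc_analytic_det C_arc_analytic_vec C_arc_analytic_nth C_arc_analytic_add
        C_arc_analytic_scaleR C_arc_analytic_const C_arc_analytic_linear open_UNIV)
  \<comment> \<open>At \<open>\<eta> = 0\<close> the matrix is the identity, so the determinant at
    the parameter 0 does not vanish identically in \<open>\<eta>\<close>.\<close>
  moreover have "det (M 0 0) \<noteq> 0"
  proof -
    have "M 0 0 = mat 1" by (auto simp: M_def vec_eq_iff mat_def axis_def)
    then show ?thesis by simp
  qed
  ultimately have "{\<eta>. det (M \<eta> 0) = 0} sparse_in UNIV" by (rule C_arc_analytic_real_zeros_sparse)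
  then have fin: "finite ({0..1} \<inter> {\<eta>. det (M \<eta> 0) = 0})"
    by (intro sparse_in_compact_finite) (auto intro: sparse_in_subset)
  show thesis
  proof (rule that[OF fin])
    fix \<eta> and N :: "(real^'p) set"
    assume \<eta>: "\<eta> \<in> {0<..1} - {0..1} \<inter> {\<eta>. det (M \<eta> 0) = 0}" and N: "negligible N"
    let ?G = "\<lambda>\<theta>. \<theta> - \<eta> *\<^sub>R g \<theta>" and ?G' = "\<lambda>\<theta> h. h - \<eta> *\<^sub>R frechet_derivative g (at \<theta>) h"
    have M: "matrix (?G' \<theta>) = M \<eta> \<theta>" for \<theta> by (simp add: matrix_def M_def)
    have "C_arc_analytic (Suc 0) (\<lambda>\<theta>. det (M \<eta> \<theta>)) UNIV"
      unfolding M_def by (intro C_arc_analytic_det C_arc_analytic_vec C_arc_analytic_nth C_arc_analytic_add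
          C_arc_analytic_scaleR C_arc_analytic_const open_UNIV dg)
    then have "negligible {\<theta> \<in> UNIV. det (M \<eta> \<theta>) = 0}"
      by (rule C_arc_analytic_zeros_negligible[OF open_UNIV connected_UNIV _ UNIV_I[of 0]]) (use \<eta> in auto)
    moreover have "negligible {\<theta>. ?G \<theta> \<in> N \<and> det (matrix (?G' \<theta>)) \<noteq> 0}"
    proof (rule negligible_preimage_regular[OF _ _ N])
      show "(?G has_derivative ?G' \<theta>) (at \<theta>)" for \<theta>
        using C_arc_analytic_Suc_has_derivative[OF g UNIV_I] by (auto intro!: derivative_eq_intros)
      show "continuous_on UNIV (\<lambda>\<theta>. ?G' \<theta> v)" for v
        by (intro continuous_intros C_arc_analytic_continuous_on[OF dg])
    qed
    ultimately have "negligible ({\<theta> \<in> UNIV. det (M \<eta> \<theta>) = 0} \<union> {\<theta>. ?G \<theta> \<in> N \<and> det (matrix (?G' \<theta>)) \<noteq> 0})"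
      by (rule negligible_Un)
    then show "negligible {\<theta>. ?G \<theta> \<in> N}"
      by (rule negligible_subset) (auto simp: M)
  qed
qed

text \<open>The first step is peeled off, not the last: the set from the induction hypothesis is
  then itself the null set to be pulled back by one step.\<close>

lemma negligible_gd_iterate_preimage:
  assumes "\<And>N. negligible N \<Longrightarrow> negligible {\<theta>. \<theta> - \<eta> *\<^sub>R gradient F \<theta> \<in> N}" "negligible N"
  shows "negligible {\<theta>. gd_iterate \<eta> F \<theta> s \<in> N}"
proof (induction s)
  case 0 then show ?case using assms(2) by (simp add: gd_iterate_def)
next
  case (Suc s)
  have "gd_iterate \<eta> F \<theta> (Suc s) = gd_iterate \<eta> F (\<theta> - \<eta> *\<^sub>R gradient F \<theta>) s" for \<theta>
    unfolding gd_iterate_def by (simp add: funpow_Suc_right del: funpow.simps)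
  then show ?case using assms(1)[OF Suc] by simp
qed

section \<open>The loss, its analyticity and its gradient bound\<close>

lemma loss_C_arc_analytic:
  fixes X y :: "(real^'d::finite)^'n::finite" and \<psi> :: "('p::finite, 'd) layer_maps"
  assumes "\<And>i. C_arc_analytic n (\<lambda>\<theta>. net L lay \<psi> \<theta> (X $ i)) UNIV"
  shows "C_arc_analytic n (loss L lay \<psi> y X) UNIV"
proof -
  have "loss L lay \<psi> y X = (\<lambda>\<theta>. 1 / real CARD('n) * (\<Sum>i\<in>(UNIV::'n set). 1/2 *
     (\<Sum>k\<in>UNIV. (y $ i + (-1) *\<^sub>R net L lay \<psi> \<theta> (X $ i)) $ k * (y $ i + (-1) *\<^sub>R net L lay \<psi> \<theta> (X $ i)) $ k)))"
    unfolding loss_def power2_norm_eq_inner by (simp add: inner_vec_def fun_eq_iff)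
  moreover have "C_arc_analytic n \<dots> UNIV"
    by (intro C_arc_analytic_mult C_arc_analytic_sum C_arc_analytic_nth C_arc_analytic_add
        C_arc_analytic_scaleR C_arc_analytic_const assms open_UNIV)
  ultimately show ?thesis by simp
qed

text \<open>With \<open>res\<close> the stacked residuals and n data points, the gradient is
  \<open>transpose J *v res\<close> divided by n and the loss is \<open>(norm res)\<^sup>2\<close>
  divided by 2n. The Rayleigh bound for \<open>J ** transpose J\<close> at \<open>res\<close> does
  the rest.\<close>

lemma loss_gradient_lower_bound:
  fixes X y :: "(real^'d::finite)^'n::finite" and \<psi> :: "('p::finite, 'd) layer_maps"
  assumes "\<And>i. (\<lambda>t. net L lay \<psi> t (X $ i)) differentiable (at \<theta>)"
  shows "2 * mu_low L lay \<psi> X \<theta> / real CARD('n) * loss L lay \<psi> y X \<theta>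
    \<le> (norm (gradient (loss L lay \<psi> y X) \<theta>))\<^sup>2"
proof -
  define f where "f i t = net L lay \<psi> t (X $ i)" for i t
  define Ji where "Ji i = jacobian (f i) (at \<theta>)" for i
  define J :: "real^'p^('n \<times> 'd)" where "J = net_jacobian L lay \<psi> X \<theta>"
  define res :: "real^('n \<times> 'd)" where "res = (\<chi> r. (f (fst r) \<theta> - y $ fst r) $ snd r)"
  let ?n = "real CARD('n)"
  have Jr: "J $ r = Ji (fst r) $ snd r" for r
    by (simp add: J_def Ji_def f_def[abs_def] net_jacobian_def vstack_def)
  have df: "(f i has_derivative (\<lambda>h. Ji i *v h)) (at \<theta>)" for i
    using assms[of i] unfolding jacobian_works Ji_def f_def[abs_def] .
  have prod: "(\<Sum>r\<in>UNIV. g (fst r) (snd r)) = (\<Sum>i\<in>UNIV. \<Sum>k\<in>UNIV. g i k)" for g :: "'n \<Rightarrow> 'd \<Rightarrow> real"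
    by (simp add: sum.cartesian_product case_prod_unfold)
  have loss: "loss L lay \<psi> y X = (\<lambda>t. 1 / ?n * (\<Sum>i\<in>UNIV. 1/2 * ((f i t - y $ i) \<bullet> (f i t - y $ i))))"
    by (simp add: loss_def f_def power2_norm_eq_inner[symmetric] norm_minus_commute fun_eq_iff)
  have res2: "(norm res)\<^sup>2 = (\<Sum>i\<in>UNIV. (f i \<theta> - y $ i) \<bullet> (f i \<theta> - y $ i))"
    unfolding power2_norm_eq_inner inner_vec_def res_def by (simp add: prod[symmetric])
  have "((\<lambda>t. 1 / ?n * (\<Sum>i\<in>UNIV. 1/2 * ((f i t - y $ i) \<bullet> (f i t - y $ i)))) has_derivative
     (\<lambda>h. 1 / ?n * (\<Sum>i\<in>UNIV. 1/2 * ((f i \<theta> - y $ i) \<bullet> (Ji i *v h) + (Ji i *v h) \<bullet> (f i \<theta> - y $ i))))) (at \<theta>)"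
    by (intro has_derivative_mult_right has_derivative_sum has_derivative_inner)
      (use df in \<open>auto intro!: derivative_eq_intros\<close>)
  then have dl: "(loss L lay \<psi> y X has_derivative
     (\<lambda>h. 1 / ?n * (\<Sum>i\<in>UNIV. 1/2 * ((f i \<theta> - y $ i) \<bullet> (Ji i *v h) + (Ji i *v h) \<bullet> (f i \<theta> - y $ i))))) (at \<theta>)"
    unfolding loss .
  \<comment> \<open>The gradient is identified by its inner products with all \<open>h\<close>; the
    sum over pairs of data point and output coordinate splits into the sum over data points of inner
    products.\<close>
  have "h \<bullet> gradient (loss L lay \<psi> y X) \<theta> = h \<bullet> ((1 / ?n) *\<^sub>R (transpose J *v res))" for h
  proof -
    have "h \<bullet> (transpose J *v res) = (\<Sum>r\<in>UNIV. (Ji (fst r) *v h) $ snd r * (f (fst r) \<theta> - y $ fst r) $ snd r)"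
      unfolding inner_matrix_vector_transpose[symmetric]
      by (simp add: inner_vec_def matrix_vector_mult_def Jr res_def)
    also have "\<dots> = (\<Sum>i\<in>UNIV. (Ji i *v h) \<bullet> (f i \<theta> - y $ i))"
      unfolding prod[of "\<lambda>i k. (Ji i *v h) $ k * (f i \<theta> - y $ i) $ k"] by (simp add: inner_vec_def)
    finally show ?thesis
      unfolding inner_gradient[OF dl] by (simp add: inner_commute)
  qed
  then have "gradient (loss L lay \<psi> y X) \<theta> = (1 / ?n) *\<^sub>R (transpose J *v res)"
    by (metis vector_eq_ldot)
  then have "(norm (gradient (loss L lay \<psi> y X) \<theta>))\<^sup>2 = (norm (transpose J *v res))\<^sup>2 / ?n\<^sup>2"
    by (simp add: power_divide)
  moreover have "mu_low L lay \<psi> X \<theta> * (norm res)\<^sup>2 \<le> (norm (transpose J *v res))\<^sup>2"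
    unfolding mu_low_def J_def[symmetric] by (rule lambda_min_gram_le)
  ultimately have "mu_low L lay \<psi> X \<theta> * (norm res)\<^sup>2 / ?n\<^sup>2 \<le> (norm (gradient (loss L lay \<psi> y X) \<theta>))\<^sup>2"
    by (simp add: divide_right_mono)
  moreover have "loss L lay \<psi> y X \<theta> = (norm res)\<^sup>2 / (2 * ?n)"
    unfolding loss res2 by (simp flip: sum_divide_distrib)
  ultimately show ?thesis by (simp add: power2_eq_square)
qed

text \<open>A negligible set need not be Borel, so it is enclosed in a Borel null set, for which
  Fubini holds on the uncompleted product.\<close>

lemma AE_lebesgue_pair_if_negligible:
  fixes N :: "('a::euclidean_space \<times> 'b::euclidean_space) set"
  assumes "negligible N"
  shows "AE x in lebesgue. AE y in lebesgue. (x, y) \<notin> N"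
    and "AE y in lebesgue. AE x in lebesgue. (x, y) \<notin> N"
proof -
  have "AE p in lebesgue. p \<notin> N"
    using assms by (auto simp: negligible_iff_null_sets intro: AE_not_in)
  then have "AE p in lborel. p \<notin> N" by (simp add: AE_completion_iff)
  then obtain N' where N'': "\<And>p. p \<in> space lborel - N' \<Longrightarrow> p \<notin> N" "N' \<in> null_sets lborel"
    using AE_E3 by blast
  have N': "N \<subseteq> N'" "N' \<in> null_sets lborel" using N'' by auto
  have m: "{p \<in> space (lborel \<Otimes>\<^sub>M lborel). (fst p, snd p) \<notin> N'} \<in> sets (lborel \<Otimes>\<^sub>M lborel)"
    unfolding lborel_prod using N'(2) borel_comp[of N'] by (simp add: null_sets_def Compl_eq)
  have "AE p in lborel \<Otimes>\<^sub>M lborel. p \<notin> N'"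
    unfolding lborel_prod using N'(2) by (rule AE_not_in)
  then have 1: "AE x in lborel. AE y in lborel. (x, y) \<notin> N'"
    by (rule lborel_pair.AE_pair)
  then have 2: "AE y in lborel. AE x in lborel. (x, y) \<notin> N'"
    using lborel_pair.AE_commute[OF m] by simp
  show "AE x in lebesgue. AE y in lebesgue. (x, y) \<notin> N"
    unfolding AE_completion_iff using 1 N'(1) by (auto elim!: eventually_mono)
  show "AE y in lebesgue. AE x in lebesgue. (x, y) \<notin> N"
    unfolding AE_completion_iff using 2 N'(1) by (auto elim!: eventually_mono)
qed

lemma gd_iterates_mu_low_pos:
  fixes \<phi> :: "('p::finite, 'd::finite) layer_maps" and X y :: "(real^'d)^'n::finite"
  assumes an: "real_analyticity L lay \<phi> U" "open U" and X: "\<And>i. X $ i \<in> U"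
    and \<psi>: "\<psi> = rescale L (\<lambda>m. if m < l then s else 1) \<phi>"
    and ae: "AE \<theta> in lebesgue. mu_low L lay \<psi> X \<theta> > 0"
    and F: "F = loss L lay \<psi> y X"
  shows "\<exists>E. finite E \<and> (\<forall>\<eta>\<in>{0<..1} - E. \<exists>B\<in>null_sets lebesgue. \<forall>\<theta>0. \<theta>0 \<notin> B \<longrightarrow>
    (\<forall>k. mu_low L lay \<psi> X (gd_iterate \<eta> F \<theta>0 k) > 0 \<and>
       (norm (gradient F (gd_iterate \<eta> F \<theta>0 k)))\<^sup>2
         \<ge> 2 * mu_low L lay \<psi> X (gd_iterate \<eta> F \<theta>0 k) / real CARD('n) * F (gd_iterate \<eta> F \<theta>0 k)))"
proof -
  let ?\<mu> = "mu_low L lay \<psi> X"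
  have net: "C_arc_analytic n (\<lambda>\<theta>. net L lay \<psi> \<theta> (X $ i)) UNIV" for n i
    unfolding \<psi> by (rule net_C_arc_analytic[OF an X])
  have N: "negligible {\<theta>. \<not> ?\<mu> \<theta> > 0}"
    using ae unfolding negligible_iff_null_sets completion.AE_iff_null_sets by simp
  have "C_arc_analytic (Suc (Suc 0)) (gradient F) UNIV"
    unfolding F by (intro C_arc_analytic_gradient loss_C_arc_analytic net)
  then obtain E where E: "finite E"
    "\<And>\<eta> N. \<eta> \<in> {0<..1} - E \<Longrightarrow> negligible N \<Longrightarrow> negligible {\<theta>. \<theta> - \<eta> *\<^sub>R gradient F \<theta> \<in> N}"
    by (rule negligible_preimage_gradient_step) blast
  have diff: "(\<lambda>\<theta>. net L lay \<psi> \<theta> (X $ i)) differentiable (at \<theta>)" for i \<theta>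
    using C_arc_analytic_Suc_has_derivative[OF net[of "Suc 0" i] UNIV_I] unfolding differentiable_def by blast
  show ?thesis
  proof (intro exI[of _ E] conjI ballI E(1))
    fix \<eta> assume \<eta>: "\<eta> \<in> {0<..1} - E"
    \<comment> \<open>All starting points from which some iterate, the zeroth included, hits the
      null set without positivity; a countable union of null sets.\<close>
    let ?B = "\<Union>k. {\<theta>. gd_iterate \<eta> F \<theta> k \<in> {\<theta>. \<not> ?\<mu> \<theta> > 0}}"
    show "\<exists>B\<in>null_sets lebesgue. \<forall>\<theta>0. \<theta>0 \<notin> B \<longrightarrow> (\<forall>k. ?\<mu> (gd_iterate \<eta> F \<theta>0 k) > 0 \<and>
       (norm (gradient F (gd_iterate \<eta> F \<theta>0 k)))\<^sup>2
         \<ge> 2 * ?\<mu> (gd_iterate \<eta> F \<theta>0 k) / real CARD('n) * F (gd_iterate \<eta> F \<theta>0 k))"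
    proof (rule bexI[of _ ?B])
      show "?B \<in> null_sets lebesgue"
        unfolding negligible_iff_null_sets[symmetric]
        by (intro negligible_Union_nat negligible_gd_iterate_preimage E(2) \<eta> N)
    qed (use loss_gradient_lower_bound[of L lay \<psi> X _ y, OF diff] in \<open>auto simp: F\<close>)
  qed
qed

theorem lemma7:
  fixes L :: nat
    and lay :: "'p::finite \<Rightarrow> nat"
    and blk :: "'p \<Rightarrow> 'k::finite"
    and \<phi> :: "nat \<Rightarrow> real^'p \<Rightarrow> real^'d::finite \<Rightarrow> real^'d"
    and \<Omega> U :: "(real^'d) set"
    and y :: "(real^'d)^'n::finite"
    and \<pi> :: "(real^'d)^'n \<Rightarrow> real"
  assumes "L \<ge> 1"
    and "\<And>j. lay j \<le> L"
    and "\<And>i j. blk i = blk j \<Longrightarrow> lay i = lay j"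
    and "open U" and "bounded U" and "closure \<Omega> \<subseteq> U"
    and "real_analyticity L lay \<phi> U"
    and "nonlinear_architecture TYPE('n) L lay \<phi> U"
  shows
    "(\<forall>\<tau>>0. \<exists>c :: nat \<Rightarrow> real. (\<forall>l<L. \<bar>c l - 1\<bar> < \<tau>) \<and>
        (AE \<theta> in lebesgue. AE X in lebesgue.
           (\<forall>i. (X :: (real^'d)^'n) $ i \<in> \<Omega>) \<longrightarrow> mu_low L lay (rescale L c \<phi>) X \<theta> > 0)) \<and>
     (data_condition \<Omega> \<pi> \<longrightarrow> poly_regularity L lay blk \<phi> U \<longrightarrow>
      (\<forall>\<tau>>0. \<exists>c :: nat \<Rightarrow> real. (\<forall>l<L. \<bar>c l - 1\<bar> < \<tau>) \<and>
        (AE \<theta> in lebesgue. AE X in lebesgue.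
           (\<forall>i. (X :: (real^'d)^'n) $ i \<in> \<Omega>) \<longrightarrow> mu_low L lay (rescale L c \<phi>) X \<theta> > 0) \<and>
        (AE X in density lborel (\<lambda>X. ennreal (\<pi> X)).
          let F = loss L lay (rescale L c \<phi>) y X;
              \<mu> = mu_low L lay (rescale L c \<phi>) X
          in \<exists>E. finite E \<and> (\<forall>\<eta>\<in>{0<..1} - E. \<exists>B\<in>null_sets lebesgue. \<forall>\<theta>0. \<theta>0 \<notin> B \<longrightarrow>
               (\<forall>S \<theta>s \<delta> \<rho> \<epsilon>.
                  positive_polynomial S \<and> gen_continuous_with S blk UNIV (gradient F) \<and>
                  0 < \<delta> \<and> \<delta> < 2 \<and> 0 \<le> \<epsilon> \<and>
                  dissipative F \<theta>0 \<theta>s (radius F \<theta>0 \<theta>s \<delta> \<rho>) \<rho> \<epsilon> \<and>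
                  \<eta> \<le> min ((2 - \<delta>) / lip_const S blk F \<theta>s (radius F \<theta>0 \<theta>s \<delta> \<rho>)) 1 \<longrightarrow>
                  (\<forall>s. \<mu> (gd_iterate \<eta> F \<theta>0 s) > 0 \<and>
                     (norm (gradient F (gd_iterate \<eta> F \<theta>0 s)))\<^sup>2
                       \<ge> 2 * \<mu> (gd_iterate \<eta> F \<theta>0 s) / real CARD('n) * F (gd_iterate \<eta> F \<theta>0 s)))))))"
proof -
  define c where "c l s = (\<lambda>m. if m < l then s else 1)" for l :: nat and s :: real
  \<comment> \<open>One scale factor serves both claims: with \<open>\<theta>\<close> outermost this
    is the statement of (a), with \<open>X\<close> outermost it is the input to gradient descent on
    almost every data set.\<close>
  have null: "\<exists>l s. (\<forall>m<L. \<bar>c l s m - 1\<bar> < \<tau>) \<and>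
      (AE \<theta> in lebesgue. AE X in lebesgue.
         (\<forall>i. (X :: (real^'d)^'n) $ i \<in> \<Omega>) \<longrightarrow> mu_low L lay (rescale L (c l s) \<phi>) X \<theta> > 0) \<and>
      (AE X in lborel. AE \<theta> in lebesgue.
         (\<forall>i. (X :: (real^'d)^'n) $ i \<in> \<Omega>) \<longrightarrow> mu_low L lay (rescale L (c l s) \<phi>) X \<theta> > 0)"
    if \<tau>: "\<tau> > 0" for \<tau> :: real
  proof -
    obtain l s where s: "\<bar>s - 1\<bar> < \<tau>"
      "negligible {p :: (real^'p) \<times> ((real^'d)^'n). (\<forall>i. snd p $ i \<in> U) \<and>
         \<not> mu_low L lay (rescale L (c l s) \<phi>) (snd p) (fst p) > 0}"
      unfolding c_def using mu_low_null_set[OF assms(4,7,8) \<tau>] .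
    have \<Omega>: "x \<in> U" if "x \<in> \<Omega>" for x using that assms(6) closure_subset by blast
    let ?\<mu> = "mu_low L lay (rescale L (c l s) \<phi>)"
    have "AE \<theta> in lebesgue. AE X in lebesgue. (\<forall>i. (X :: (real^'d)^'n) $ i \<in> \<Omega>) \<longrightarrow> ?\<mu> X \<theta> > 0"
      using AE_lebesgue_pair_if_negligible(1)[OF s(2)]
    proof eventually_elim
      case (elim \<theta>)
      then show ?case by eventually_elim (use \<Omega> in auto)
    qed
    moreover have "AE X in lborel. AE \<theta> in lebesgue. (\<forall>i. (X :: (real^'d)^'n) $ i \<in> \<Omega>) \<longrightarrow> ?\<mu> X \<theta> > 0"
      using AE_lebesgue_pair_if_negligible(2)[OF s(2), THEN AE_completion_iff[THEN iffD1]]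
    proof eventually_elim
      case (elim X)
      then show ?case by eventually_elim (use \<Omega> in auto)
    qed
    moreover have "\<forall>m<L. \<bar>c l s m - 1\<bar> < \<tau>" using s(1) \<tau> by (simp add: c_def)
    ultimately show ?thesis by (intro exI conjI)
  qed
  show ?thesis
  proof (intro conjI allI impI, goal_cases)
    case (1 \<tau>)
    then show ?case using null[of \<tau>] by blast
  next
    case (2 \<tau>)
    obtain l s where c: "\<forall>m<L. \<bar>c l s m - 1\<bar> < \<tau>"
      "AE \<theta> in lebesgue. AE X in lebesgue.
         (\<forall>i. (X :: (real^'d)^'n) $ i \<in> \<Omega>) \<longrightarrow> mu_low L lay (rescale L (c l s) \<phi>) X \<theta> > 0"
      "AE X in lborel. AE \<theta> in lebesgue.
         (\<forall>i. (X :: (real^'d)^'n) $ i \<in> \<Omega>) \<longrightarrow> mu_low L lay (rescale L (c l s) \<phi>) X \<theta> > 0"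
      using null[OF 2(3)] by (elim exE conjE)
    define \<psi> where "\<psi> = rescale L (c l s) \<phi>"
    have \<pi>: "(\<lambda>X. ennreal (\<pi> X)) \<in> borel_measurable lborel"
      and supp: "AE X in lborel. (\<exists>i. X $ i \<notin> \<Omega>) \<longrightarrow> \<pi> X = 0"
      using 2(1) unfolding data_condition_def by auto
    \<comment> \<open>Only points of positive density count, and there the support condition places
      every data point in \<open>\<Omega>\<close>, hence in \<open>U\<close>.\<close>
    have "AE X in density lborel (\<lambda>X. ennreal (\<pi> X)). (\<forall>i. X $ i \<in> U) \<and>
       (AE \<theta> in lebesgue. mu_low L lay \<psi> X \<theta> > 0)"
      unfolding AE_density[OF \<pi>] using c(3) supp
    proof eventually_elim
      case (elim X)
      show ?case
      proof
        assume "0 < ennreal (\<pi> X)"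
        then have "\<forall>i. X $ i \<in> \<Omega>" using elim(2) by auto
        then show "(\<forall>i. X $ i \<in> U) \<and> (AE \<theta> in lebesgue. mu_low L lay \<psi> X \<theta> > 0)"
          using elim(1) assms(6) closure_subset unfolding \<psi>_def by auto
      qed
    qed
    then have gd: "AE X in density lborel (\<lambda>X. ennreal (\<pi> X)).
      \<exists>E. finite E \<and> (\<forall>\<eta>\<in>{0<..1} - E. \<exists>B\<in>null_sets lebesgue. \<forall>\<theta>0. \<theta>0 \<notin> B \<longrightarrow>
        (\<forall>k. mu_low L lay \<psi> X (gd_iterate \<eta> (loss L lay \<psi> y X) \<theta>0 k) > 0 \<and>
         (norm (gradient (loss L lay \<psi> y X) (gd_iterate \<eta> (loss L lay \<psi> y X) \<theta>0 k)))\<^sup>2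
           \<ge> 2 * mu_low L lay \<psi> X (gd_iterate \<eta> (loss L lay \<psi> y X) \<theta>0 k) / real CARD('n) *
             loss L lay \<psi> y X (gd_iterate \<eta> (loss L lay \<psi> y X) \<theta>0 k)))"
    proof eventually_elim
      case (elim X)
      then show ?case
        by (intro gd_iterates_mu_low_pos[OF assms(7,4) _ \<psi>_def[unfolded c_def] _ refl]) auto
    qed
    show ?case
    proof (rule exI[of _ "c l s"], intro conjI c(1,2), fold \<psi>_def, rule eventually_mono[OF gd], goal_cases)
      case (1 X)
      show ?case
        unfolding Let_def
        by (insert 1, elim exE conjE, intro exI conjI, assumption, intro ballI, drule (1) bspec, erule bexE,
            rule bexI[rotated], assumption, intro allI impI, erule allE, erule (1) impE, erule allE, assumption)
    qed
  qed
qed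

end
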